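(* For every $0<\epsilon\le 1$ there exists $0<a<1$ such that, as a function of $m$, the number of partition triples $(\lambda,\mu,\pi)$ satisfying all of the following is $\Omega(2^{m^a})$: (0) $k^\lambda_{\mu,\pi}=0$; (1) $\mu=\pi$; (2) $\mathrm{ht}(\mu)=m$ and $\mathrm{ht}(\lambda)\le m^\epsilon$; (3) $(\lambda,\mu,\pi)\in \mathrm{Kron}(m)$; (4) $|\lambda|=|\mu|=|\pi|\le m^3$; (5) $\lambda$ is not a hook.
   Context: For partitions $\lambda,\mu,\pi$ with $|\lambda|=|\mu|=|\pi|=n$ ($|\cdot|$ = sum of parts), the Kronecker coefficient $k^\lambda_{\mu,\pi}$ is the multiplicity of the irreducible $S_n$-representation $[\lambda]$ in $[\mu]\otimes[\pi]$ (equivalently, the multiplicity of $V_\mu(GL_r)\otimes V_\pi(GL_r)$ in the Weyl module $V_\lambda(GL_{r^2})$ restricted along the natural map $GL_r\times GL_r\to GL(\mathbb{C}^r\otimes\mathbb{C}^r)$). $\mathrm{ht}(\alpha)$ is the number of nonzero parts of a partition $\alpha$. For $r\ge1$, the Kronecker cone is $\mathrm{Kron}(r)=\overline{\{(\lambda,\mu,\pi)/l : \lambda,\mu,\pi\in\mathbb{N}^r \text{ partitions}, l\in\mathbb{Q}_{>0}, k^\lambda_{\mu,\pi}>0\}}\subseteq\mathbb{R}^{3r}$ (partitions with fewer than $r$ parts are padded with zeros). A hook is a partition of the form $(p,1^q)$, $p\ge1,q\ge0$. *)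

theory Defs
  imports
    "HOL-Analysis.Analysis"
    "HOL-Library.Function_Algebras"
    "HOL-Library.Landau_Symbols"
    "HOL-Combinatorics.Permutations"
begin

section \<open>Partitions\<close>

text \<open>Partitions are lists of positive parts in weakly decreasing order, so that
  the height is the length of the list and the size is the sum of the list.\<close>

definition is_partition :: "nat list \<Rightarrow> bool" where
  "is_partition xs \<longleftrightarrow> sorted_wrt (\<ge>) xs \<and> 0 \<notin> set xs"

definition is_hook :: "nat list \<Rightarrow> bool" where
  "is_hook xs \<longleftrightarrow> (\<exists>p q. p \<ge> 1 \<and> xs = p # replicate q 1)"


section \<open>Complex representations of symmetric groups\<close>

text \<open>The symmetric group on n letters is the set of all \<open>g\<close> with \<open>g permutes {..<n}\<close>.
  All representations are carried by subspaces of complex function spaces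
  \<open>'x \<Rightarrow> complex\<close>, with an action \<open>\<rho>\<close> that is linear on the whole function space.\<close>

definition cscale :: "complex \<Rightarrow> ('x \<Rightarrow> complex) \<Rightarrow> 'x \<Rightarrow> complex" where
  "cscale c f = (\<lambda>x. c * f x)"

global_interpretation cfun: vector_space "cscale :: complex \<Rightarrow> ('x \<Rightarrow> complex) \<Rightarrow> 'x \<Rightarrow> complex"
  by unfold_locales (auto simp: cscale_def fun_eq_iff algebra_simps)

type_synonym 'x action = "(nat \<Rightarrow> nat) \<Rightarrow> ('x \<Rightarrow> complex) \<Rightarrow> 'x \<Rightarrow> complex"

definition subrep :: "nat \<Rightarrow> 'x action \<Rightarrow> ('x \<Rightarrow> complex) set \<Rightarrow> bool" where
  "subrep n \<rho> U \<longleftrightarrow>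
     cfun.subspace U \<and> (\<forall>g. g permutes {..<n} \<longrightarrow> \<rho> g ` U \<subseteq> U)"

definition irreducible_rep :: "nat \<Rightarrow> 'x action \<Rightarrow> ('x \<Rightarrow> complex) set \<Rightarrow> bool" where
  "irreducible_rep n \<rho> U \<longleftrightarrow>
     subrep n \<rho> U \<and> U \<noteq> {0} \<and>
     (\<forall>U'. subrep n \<rho> U' \<and> U' \<subseteq> U \<longrightarrow> U' = {0} \<or> U' = U)"

definition rep_iso ::
  "nat \<Rightarrow> 'x action \<Rightarrow> ('x \<Rightarrow> complex) set \<Rightarrow> 'y action \<Rightarrow> ('y \<Rightarrow> complex) set \<Rightarrow> bool" where
  "rep_iso n \<rho> V \<sigma> W \<longleftrightarrow>
     (\<exists>\<phi>. bij_betw \<phi> V W \<and>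
        (\<forall>x\<in>V. \<forall>y\<in>V. \<phi> (x + y) = \<phi> x + \<phi> y) \<and>
        (\<forall>c. \<forall>x\<in>V. \<phi> (cscale c x) = cscale c (\<phi> x)) \<and>
        (\<forall>g. g permutes {..<n} \<longrightarrow> (\<forall>x\<in>V. \<phi> (\<rho> g x) = \<sigma> g (\<phi> x))))"

text \<open>\<open>W\<close> is the internal direct sum of the irreducible subrepresentations
  \<open>U 0, \<dots>, U (k - 1)\<close>.\<close>

definition irreducible_decomposition ::
  "nat \<Rightarrow> 'x action \<Rightarrow> ('x \<Rightarrow> complex) set \<Rightarrow> nat \<Rightarrow> (nat \<Rightarrow> ('x \<Rightarrow> complex) set) \<Rightarrow> bool" where
  "irreducible_decomposition n \<rho> W k U \<longleftrightarrow>
     (\<forall>i<k. irreducible_rep n \<rho> (U i)) \<and>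
     W = {\<Sum>i<k. u i |u. \<forall>i<k. u i \<in> U i} \<and>
     (\<forall>u. (\<forall>i<k. u i \<in> U i) \<and> (\<Sum>i<k. u i) = 0 \<longrightarrow> (\<forall>i<k. u i = 0))"

text \<open>The multiplicity of the irreducible representation \<open>V\<close> in \<open>W\<close>. A decomposition exists
  for finite-dimensional \<open>W\<close> by Maschke's theorem, and the number of its summands isomorphic
  to \<open>V\<close> does not depend on it, so the choice made by \<open>SOME\<close> is immaterial.\<close>

definition rep_multiplicity ::
  "nat \<Rightarrow> 'x action \<Rightarrow> ('x \<Rightarrow> complex) set \<Rightarrow> 'y action \<Rightarrow> ('y \<Rightarrow> complex) set \<Rightarrow> nat" where
  "rep_multiplicity n \<rho> V \<sigma> W =
     (SOME d. \<exists>k U. irreducible_decomposition n \<sigma> W k U \<and>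
                    d = card {i. i < k \<and> rep_iso n \<rho> V \<sigma> (U i)})"


section \<open>Specht modules\<close>

text \<open>The group algebra consists of the functions vanishing outside the symmetric group;
  the function \<open>a\<close> stands for the formal sum of the \<open>a g\<close> times \<open>g\<close>.\<close>

definition group_algebra :: "nat \<Rightarrow> ((nat \<Rightarrow> nat) \<Rightarrow> complex) set" where
  "group_algebra n = {a. \<forall>g. \<not> g permutes {..<n} \<longrightarrow> a g = 0}"

definition ga_mult ::
  "nat \<Rightarrow> ((nat \<Rightarrow> nat) \<Rightarrow> complex) \<Rightarrow> ((nat \<Rightarrow> nat) \<Rightarrow> complex) \<Rightarrow> (nat \<Rightarrow> nat) \<Rightarrow> complex" where
  "ga_mult n a b =
     (\<lambda>g. \<Sum>(h, k) | h permutes {..<n} \<and> k permutes {..<n} \<and> h \<circ> k = g. a h * b k)"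

text \<open>Left multiplication by \<open>g\<close>, written on coefficient functions.\<close>

definition left_act :: "(nat \<Rightarrow> nat) action" where
  "left_act g a = (\<lambda>s. a (inv g \<circ> s))"

text \<open>Rows and columns of the Young tableau of shape \<open>xs\<close> in which the numbers
  \<open>0, \<dots>, n - 1\<close> are entered row by row.\<close>

definition tableau_entry :: "nat list \<Rightarrow> nat \<Rightarrow> nat \<Rightarrow> nat" where
  "tableau_entry xs i j = sum_list (take i xs) + j"

definition tableau_row :: "nat list \<Rightarrow> nat \<Rightarrow> nat set" where
  "tableau_row xs i = {tableau_entry xs i j |j. i < length xs \<and> j < xs ! i}"

definition tableau_col :: "nat list \<Rightarrow> nat \<Rightarrow> nat set" where
  "tableau_col xs j = {tableau_entry xs i j |i. i < length xs \<and> j < xs ! i}"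

definition row_group :: "nat list \<Rightarrow> (nat \<Rightarrow> nat) set" where
  "row_group xs =
     {p. p permutes {..<sum_list xs} \<and> (\<forall>i. p ` tableau_row xs i = tableau_row xs i)}"

definition col_group :: "nat list \<Rightarrow> (nat \<Rightarrow> nat) set" where
  "col_group xs =
     {q. q permutes {..<sum_list xs} \<and> (\<forall>j. q ` tableau_col xs j = tableau_col xs j)}"

definition young_symmetrizer :: "nat list \<Rightarrow> (nat \<Rightarrow> nat) \<Rightarrow> complex" where
  "young_symmetrizer xs =
     (\<lambda>g. \<Sum>(p, q) | p \<in> row_group xs \<and> q \<in> col_group xs \<and> p \<circ> q = g. of_int (sign q))"

text \<open>The irreducible representation indexed by the partition \<open>xs\<close>: the left ideal of the
  group algebra generated by the Young symmetrizer, with the group acting by \<open>left_act\<close>.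
  In this convention the one-row partition gives the trivial representation and the
  one-column partition gives the sign representation.\<close>

definition specht :: "nat list \<Rightarrow> ((nat \<Rightarrow> nat) \<Rightarrow> complex) set" where
  "specht xs =
     {ga_mult (sum_list xs) a (young_symmetrizer xs) |a. a \<in> group_algebra (sum_list xs)}"


section \<open>Kronecker coefficients\<close>

text \<open>The tensor product of two function spaces is realised inside the functions on pairs,
  the pure tensor of \<open>v\<close> and \<open>w\<close> being \<open>(x, y) \<mapsto> v x * w y\<close>; under this identification
  \<open>diag_act g\<close> is \<open>left_act g\<close> on both tensor factors.\<close>

definition tensor_space ::
  "('x \<Rightarrow> complex) set \<Rightarrow> ('y \<Rightarrow> complex) set \<Rightarrow> ('x \<times> 'y \<Rightarrow> complex) set" where
  "tensor_space V W = cfun.span {(\<lambda>(x, y). v x * w y) |v w. v \<in> V \<and> w \<in> W}"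

definition diag_act :: "((nat \<Rightarrow> nat) \<times> (nat \<Rightarrow> nat)) action" where
  "diag_act g f = (\<lambda>(s, t). f (inv g \<circ> s, inv g \<circ> t))"

text \<open>Only meaningful for three partitions of the same size.\<close>

definition kronecker_coeff :: "nat list \<Rightarrow> nat list \<Rightarrow> nat list \<Rightarrow> nat" where
  "kronecker_coeff lam mu nu =
     rep_multiplicity (sum_list lam) left_act (specht lam)
       diag_act (tensor_space (specht mu) (specht nu))"


section \<open>The Kronecker cone\<close>

definition partition_vec :: "nat list \<Rightarrow> nat \<Rightarrow> real" where
  "partition_vec xs = (\<lambda>i. if i < length xs then real (xs ! i) else 0)"

text \<open>A vector of length r is encoded as a function on the natural numbers vanishing at all
  arguments \<open>\<ge> r\<close>. These functions form a closed subset of \<open>nat \<Rightarrow> real\<close> (with the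
  product topology) which is homeomorphic to Euclidean r-space, so the closure below is the
  closure in Euclidean 3r-space.\<close>

definition kronecker_cone :: "nat \<Rightarrow> ((nat \<Rightarrow> real) \<times> (nat \<Rightarrow> real) \<times> (nat \<Rightarrow> real)) set" where
  "kronecker_cone r = closure
     {(\<lambda>i. partition_vec lam i / of_rat l,
       \<lambda>i. partition_vec mu i / of_rat l,
       \<lambda>i. partition_vec nu i / of_rat l) |lam mu nu l.
        is_partition lam \<and> is_partition mu \<and> is_partition nu \<and>
        length lam \<le> r \<and> length mu \<le> r \<and> length nu \<le> r \<and>
        sum_list lam = sum_list mu \<and> sum_list mu = sum_list nu \<and>
        (l::rat) > 0 \<and> kronecker_coeff lam mu nu > 0}"

end

theory Submission
  imports Defs "HOL-Probability.Probability" "Jordan_Normal_Form.Determinant"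
begin

text \<open>
  The triples are \<open>(lam, (1^m), (1^m))\<close>, where \<open>lam\<close> is any non-hook partition of \<open>m\<close> of small
  height. Since \<open>[1^m] \<otimes> [1^m]\<close> is trivial, the Kronecker coefficient vanishes as soon as \<open>lam\<close>
  has two rows. To place the triple in the cone, let \<open>l\<close> be a power of two and show that
  \<open>(l lam, (l^m), (l^m))\<close> has positive Kronecker coefficient. The Young symmetrizer of \<open>l lam\<close> is
  applied to the tensor square of that of \<open>(l^m)\<close>, and the result is paired with a tensor made of
  \<open>l \<times> l\<close> matrices \<open>X\<^sub>k\<close>, one for each row \<open>k\<close>. The pairing is a signed sum of products of mixed
  discriminants of the \<open>X\<^sub>k\<close>. For Clifford matrices, \<open>det (\<Sum> y\<^sub>k X\<^sub>k) = (\<Sum> y\<^sub>k^2)^(l/2)\<close>, so these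
  mixed discriminants are, up to a positive factor, moments of a standard Gaussian vector, and the
  signed sum becomes the expectation of the \<open>l\<close>-th power of a nonzero polynomial. As \<open>l\<close> is even,
  it is positive.
\<close>

text \<open>The obstacle is positivity. The sum over \<open>col_group\<close> has terms of both
  signs, and the mixed discriminants of general matrices can have either sign as well, so nothing
  can be read off term by term. If, however, every mixed discriminant is the same positive multiple
  of a moment of a random vector, then independent vectors, one for each row of the rectangle, turn
  the whole signed sum into one expectation; and since each column of \<open>lam\<close> occurs
  \<open>l\<close> times in the scaled shape, the integrand is an \<open>l\<close>-th power.
  Polarization dictates the matrices: a mixed discriminant is determined by determinants of linear
  combinations, a Gaussian moment by moments of linear forms, and the latter are multiples of powers
  of a sum of squares. Clifford matrices have such determinants, in sizes that are powers of two;
  \<open>h + 2\<close> matrices take \<open>l = 2 ^ (h + 1)\<close>, so \<open>l\<close> is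
  exponential in the height of \<open>lam\<close>. This is harmless, because points of the cone may
  be scaled down by any \<open>l\<close>.\<close>

unbundle no m_inv_syntax

text \<open>As rewrite rules these also fire on eta-expanded vectors and destroy the vector operations.\<close>

declare plus_fun_apply [simp del] zero_fun_apply [simp del]
  minus_apply [simp del] uminus_apply [simp del]

lemmas fun_ops = plus_fun_apply zero_fun_apply minus_apply uminus_apply

lemma fun_sum_apply: "(\<Sum>i\<in>A. f i) x = (\<Sum>i\<in>A. f i x)"
  for f :: "'i \<Rightarrow> 'x \<Rightarrow> 'c::comm_monoid_add"
  by (induction A rule: infinite_finite_induct) (simp_all add: fun_ops)

section \<open>Orthogonal complements in spaces of finitely supported functions\<close>

text \<open>The ambient function spaces may be infinite-dimensional. Restricting to functions
  supported on a finite \<open>X\<close> gives finite dimension and makes the form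
  \<open>herm X\<close> definite.\<close>

definition fsupp :: "'x set \<Rightarrow> ('x \<Rightarrow> complex) set" where
  "fsupp X = {f. \<forall>x. x \<notin> X \<longrightarrow> f x = 0}"

definition herm :: "'x set \<Rightarrow> ('x \<Rightarrow> complex) \<Rightarrow> ('x \<Rightarrow> complex) \<Rightarrow> complex" where
  "herm X f g = (\<Sum>x\<in>X. f x * cnj (g x))"

lemma herm_add_left: "herm X (f + f') g = herm X f g + herm X f' g"
  unfolding herm_def plus_fun_apply distrib_right by (rule sum.distrib)

lemma herm_diff_left: "herm X (f - f') g = herm X f g - herm X f' g"
  unfolding herm_def minus_apply left_diff_distrib by (rule sum_subtractf)

lemma herm_scale_left: "herm X (cscale c f) g = c * herm X f g"
  unfolding herm_def cscale_def mult.assoc by (rule sum_distrib_left[symmetric])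

lemma herm_add_right: "herm X f (g + g') = herm X f g + herm X f g'"
  unfolding herm_def plus_fun_apply complex_cnj_add distrib_left by (rule sum.distrib)

lemma herm_scale_right: "herm X f (cscale c g) = cnj c * herm X f g"
  unfolding herm_def cscale_def complex_cnj_mult mult.left_commute[of "f _"]
  by (rule sum_distrib_left[symmetric])

lemma herm_zero_right [simp]: "herm X f 0 = 0"
  by (simp add: herm_def fun_ops)

lemma herm_zero_left [simp]: "herm X 0 f = 0"
  by (simp add: herm_def fun_ops)

lemma herm_sum_left: "herm X (\<Sum>i\<in>A. f i) g = (\<Sum>i\<in>A. herm X (f i) g)"
  by (induction A rule: infinite_finite_induct) (simp_all add: herm_add_left)

lemma herm_sum_right: "herm X f (\<Sum>i\<in>A. g i) = (\<Sum>i\<in>A. herm X f (g i))"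
  by (induction A rule: infinite_finite_induct) (simp_all add: herm_add_right)

lemma herm_self_eq_0:
  assumes "finite X" "f \<in> fsupp X" "herm X f f = 0"
  shows "f = 0"
proof -
  have "herm X f f = complex_of_real (\<Sum>x\<in>X. (cmod (f x))\<^sup>2)"
    unfolding herm_def of_real_sum by (intro sum.cong refl) (rule complex_norm_square[symmetric])
  hence "(\<Sum>x\<in>X. (cmod (f x))\<^sup>2) = 0"
    using assms(3) by (metis of_real_eq_0_iff)
  hence "\<forall>x\<in>X. (cmod (f x))\<^sup>2 = 0"
    using assms(1) by (subst (asm) sum_nonneg_eq_0_iff) auto
  thus ?thesis using assms(2) by (auto simp: fsupp_def fun_eq_iff fun_ops)
qed

lemma subspace_fsupp: "cfun.subspace (fsupp X)"
  by (auto simp: cfun.subspace_def fsupp_def cscale_def fun_ops)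

lemma fsupp_subset_span:
  assumes "finite X"
  shows "fsupp X \<subseteq> cfun.span ((\<lambda>x y. if y = x then 1 else 0) ` X)"
proof
  fix f assume f: "f \<in> fsupp X"
  have "f = (\<Sum>x\<in>X. cscale (f x) (\<lambda>y. if y = x then 1 else 0))"
  proof
    fix y
    have "(\<Sum>x\<in>X. cscale (f x) (\<lambda>y. if y = x then 1 else 0)) y = (\<Sum>x\<in>X. if y = x then f x else 0)"
      unfolding fun_sum_apply by (intro sum.cong) (auto simp: cscale_def)
    also have "\<dots> = f y" using f assms by (auto simp: fsupp_def)
    finally show "f y = (\<Sum>x\<in>X. cscale (f x) (\<lambda>y. if y = x then 1 else 0)) y" ..
  qed
  also have "\<dots> \<in> cfun.span ((\<lambda>x y. if y = x then 1 else 0) ` X)"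
    by (intro cfun.span_sum cfun.span_scale cfun.span_base) auto
  finally show "f \<in> cfun.span ((\<lambda>x y. if y = x then 1 else 0) ` X)" .
qed

lemma independent_finite:
  assumes "finite X" "B \<subseteq> fsupp X" "cfun.independent B"
  shows "finite B"
  using cfun.independent_span_bound[of "(\<lambda>x y. if y = x then 1 else 0) ` X" B]
    assms fsupp_subset_span[OF assms(1)] by auto

lemma dim_strict_mono:
  assumes X: "finite X" and V: "V \<subseteq> fsupp X" "cfun.subspace U" "U \<subset> V"
  shows "cfun.dim U < cfun.dim V"
proof -
  obtain B where B: "B \<subseteq> U" "cfun.independent B" "U \<subseteq> cfun.span B"
    using cfun.maximal_independent_subset[of U] by blast
  obtain B' where B': "B \<subseteq> B'" "B' \<subseteq> V" "cfun.independent B'" "V \<subseteq> cfun.span B'"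
    using cfun.maximal_independent_subset_extend[of B V] B V(3) by blast
  have fin: "finite B'" using independent_finite[OF X _ B'(3)] B'(2) V(1) by blast
  have "B \<noteq> B'"
    using B' B V(3) cfun.span_minimal[OF B(1) V(2)] by auto
  hence "card B < card B'" using B'(1) fin by (simp add: psubset_card_mono psubsetI)
  thus ?thesis
    using cfun.basis_card_eq_dim[OF B(1,3,2)] cfun.basis_card_eq_dim[OF B'(2,4,3)] by simp
qed

text \<open>Gram-Schmidt by induction on \<open>B\<close>: \<open>b'\<close> is the part of the new
  vector orthogonal to the old span, and the projection of \<open>w\<close> is corrected by a
  multiple of \<open>b'\<close>.\<close>

lemma orthogonal_projection_span:
  assumes X: "finite X" and B: "finite B" "B \<subseteq> fsupp X"
  shows "\<exists>v\<in>cfun.span B. \<forall>u\<in>cfun.span B. herm X (w - v) u = 0"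
  using B
proof (induction B arbitrary: w rule: finite_induct)
  case empty
  show ?case by (simp add: cfun.span_empty)
next
  case (insert b B)
  have sub: "cfun.span B \<subseteq> fsupp X"
    using insert.prems subspace_fsupp by (intro cfun.span_minimal) auto
  obtain pb where pb: "pb \<in> cfun.span B" "\<And>u. u \<in> cfun.span B \<Longrightarrow> herm X (b - pb) u = 0"
    using insert.IH[of b] insert.prems by auto
  obtain pw where pw: "pw \<in> cfun.span B" "\<And>u. u \<in> cfun.span B \<Longrightarrow> herm X (w - pw) u = 0"
    using insert.IH[of w] insert.prems by auto
  define b' where "b' = b - pb"
  have b'X: "b' \<in> fsupp X"
    unfolding b'_def using sub pb(1) insert.prems subspace_fsupp[of X]
    by (intro cfun.subspace_diff) auto
  have b': "b' \<in> cfun.span (insert b B)"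
    unfolding b'_def using subsetD[OF cfun.span_mono[OF subset_insertI] pb(1)]
    by (intro cfun.span_diff cfun.span_base[of b]) simp_all
  \<comment> \<open>If \<open>b'\<close> is 0, the division yields 0 and the next equation holds
    with both sides 0.\<close>
  define c where "c = herm X (w - pw) b' / herm X b' b'"
  have cb: "herm X (w - pw) b' = c * herm X b' b'"
  proof (cases "b' = 0")
    case False
    hence "herm X b' b' \<noteq> 0" using herm_self_eq_0[OF X b'X] by auto
    thus ?thesis by (simp add: c_def)
  qed auto
  define v where "v = pw + cscale c b'"
  have "v \<in> cfun.span (insert b B)"
    unfolding v_def using subsetD[OF cfun.span_mono[OF subset_insertI] pw(1)] b'
    by (intro cfun.span_add cfun.span_scale)
  moreover have "herm X (w - v) u = 0" if u: "u \<in> cfun.span (insert b B)" for u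
  proof -
    obtain k where k: "u - cscale k b \<in> cfun.span B"
      using cfun.span_breakdown_eq[of u b B] u by blast
    define u' where "u' = u - cscale k b + cscale k pb"
    have u': "u' \<in> cfun.span B"
      unfolding u'_def using k pb(1) by (intro cfun.span_add cfun.span_scale)
    have eq: "u = u' + cscale k b'"
      by (simp add: u'_def b'_def cscale_def fun_eq_iff fun_ops algebra_simps)
    define d where "d = w - pw"
    have wv: "w - v = d - cscale c b'"
      by (simp add: v_def d_def algebra_simps)
    have "herm X b' u' = 0" unfolding b'_def by (rule pb(2)[OF u'])
    moreover have "herm X d u' = 0" unfolding d_def by (rule pw(2)[OF u'])
    ultimately show ?thesis
      unfolding wv eq using cb[folded d_def]
      by (simp add: herm_diff_left herm_scale_left herm_add_right herm_scale_right)
  qed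
  ultimately show ?case by blast
qed

lemma orthogonal_projection:
  assumes X: "finite X" and M: "cfun.subspace M" "M \<subseteq> fsupp X"
  obtains v where "v \<in> M" "\<And>u. u \<in> M \<Longrightarrow> herm X (w - v) u = 0"
proof -
  obtain B where B: "B \<subseteq> M" "cfun.independent B" "M \<subseteq> cfun.span B"
    using cfun.maximal_independent_subset[of M] by blast
  have "cfun.span B = M" using cfun.span_minimal[OF B(1) M(1)] B(3) by auto
  moreover have "finite B" using independent_finite[OF X _ B(2)] B(1) M(2) by blast
  ultimately show ?thesis
    using orthogonal_projection_span[OF X, of B w] B(1) M(2) that by (metis subset_trans)
qed

section \<open>Actions induced by a permutation of the points\<close>

lemma finite_perms [simp, intro]: "finite {g. g permutes {..<n::nat}}"
  by (intro finite_permutations) auto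

definition ga_act ::
  "nat \<Rightarrow> 'x action \<Rightarrow> ((nat \<Rightarrow> nat) \<Rightarrow> complex) \<Rightarrow> ('x \<Rightarrow> complex) \<Rightarrow> 'x \<Rightarrow> complex" where
  "ga_act n \<rho> a f = (\<Sum>g | g permutes {..<n}. cscale (a g) (\<rho> g f))"

text \<open>\<open>\<theta>\<close> is a right action on points, so precomposition with it is a left
  action on functions; since it permutes the finite set \<open>X\<close>, this action is unitary for
  \<open>herm X\<close>. Left multiplication and the diagonal action both arise in this way, so the
  theorems of Maschke and Schur are proved once for both.\<close>

locale point_action =
  fixes n :: nat and X :: "'x set" and \<theta> :: "(nat \<Rightarrow> nat) \<Rightarrow> 'x \<Rightarrow> 'x"
  assumes finite_X: "finite X"
    and theta_id: "\<theta> id x = x"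
    and theta_comp: "g permutes {..<n} \<Longrightarrow> h permutes {..<n} \<Longrightarrow> \<theta> (g \<circ> h) x = \<theta> h (\<theta> g x)"
    and theta_in: "g permutes {..<n} \<Longrightarrow> \<theta> g x \<in> X \<longleftrightarrow> x \<in> X"
begin

definition act :: "'x action" where "act g f = (\<lambda>x. f (\<theta> g x))"

lemma act_add: "act g (f + f') = act g f + act g f'"
  and act_scale: "act g (cscale c f) = cscale c (act g f)"
  and act_zero [simp]: "act g 0 = 0"
  by (auto simp: act_def cscale_def fun_ops fun_eq_iff)

lemma act_sum: "act g (\<Sum>i\<in>A. f i) = (\<Sum>i\<in>A. act g (f i))"
  by (induction A rule: infinite_finite_induct) (simp_all add: act_add)

lemma act_id [simp]: "act id f = f"
  by (simp add: act_def theta_id)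

lemma act_comp:
  "g permutes {..<n} \<Longrightarrow> h permutes {..<n} \<Longrightarrow> act (g \<circ> h) f = act g (act h f)"
  by (simp add: act_def theta_comp)

lemma theta_inv: "g permutes {..<n} \<Longrightarrow> \<theta> g (\<theta> (inv g) x) = x"
  by (metis theta_comp theta_id permutes_inv permutes_inv_o(2))

lemma theta_inv': "g permutes {..<n} \<Longrightarrow> \<theta> (inv g) (\<theta> g x) = x"
  by (metis theta_comp theta_id permutes_inv permutes_inv_o(1))

lemma herm_act_left:
  assumes "g permutes {..<n}"
  shows "herm X (act g f) f' = herm X f (act (inv g) f')"
  unfolding herm_def act_def
  by (rule sum.reindex_bij_witness[of _ "\<theta> (inv g)" "\<theta> g"])
     (use assms in \<open>auto simp: theta_inv theta_inv' theta_in permutes_inv\<close>)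

lemma act_fsupp: "g permutes {..<n} \<Longrightarrow> f \<in> fsupp X \<Longrightarrow> act g f \<in> fsupp X"
  by (auto simp: act_def fsupp_def theta_in)

lemma subrep_iff:
  "subrep n act U \<longleftrightarrow> cfun.subspace U \<and> (\<forall>g f. g permutes {..<n} \<longrightarrow> f \<in> U \<longrightarrow> act g f \<in> U)"
  by (auto simp: subrep_def)

text \<open>By unitarity, moving \<open>g\<close> to the other side of \<open>herm X\<close>
  replaces it by \<open>inv g\<close>, which maps \<open>M\<close> into itself.\<close>

lemma subrep_complement:
  assumes "subrep n act W" "subrep n act M"
  shows "subrep n act {f\<in>W. \<forall>u\<in>M. herm X f u = 0}"
  using assms unfolding subrep_iff
  by (auto simp: cfun.subspace_def herm_add_left herm_scale_left herm_act_left permutes_inv)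

lemma exists_irreducible_subrep:
  assumes "subrep n act W" "W \<subseteq> fsupp X" "W \<noteq> {0}"
  shows "\<exists>M. irreducible_rep n act M \<and> M \<subseteq> W"
  using assms
proof (induction "cfun.dim W" arbitrary: W rule: less_induct)
  case less
  show ?case
  proof (cases "irreducible_rep n act W")
    case False
    then obtain U where U: "subrep n act U" "U \<subseteq> W" "U \<noteq> {0}" "U \<noteq> W"
      using less.prems by (auto simp: irreducible_rep_def)
    have "cfun.dim U < cfun.dim W"
      using U less.prems by (intro dim_strict_mono[OF finite_X]) (auto simp: subrep_def)
    from less.hyps[OF this U(1)] show ?thesis using U less.prems by blast
  qed auto
qed

text \<open>Maschke's theorem: an irreducible \<open>M\<close> is split off and its orthogonal
  complement in \<open>W\<close> has smaller dimension. Existence matters because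
  \<open>rep_multiplicity\<close> is a \<open>SOME\<close> value, about which one can only argue
  once some decomposition is available.\<close>

theorem exists_irreducible_decomposition:
  assumes "subrep n act W" "W \<subseteq> fsupp X"
  shows "\<exists>k U. irreducible_decomposition n act W k U"
  using assms
proof (induction "cfun.dim W" arbitrary: W rule: less_induct)
  case less
  have sW: "cfun.subspace W" using less.prems by (simp add: subrep_def)
  show ?case
  proof (cases "W = {0}")
    case True
    have "irreducible_decomposition n act W 0 (\<lambda>_. {0})"
      unfolding irreducible_decomposition_def True by simp
    thus ?thesis by blast
  next
    case False
    then obtain M where M: "irreducible_rep n act M" "M \<subseteq> W"
      using exists_irreducible_subrep less.prems by blast
    have rM: "subrep n act M" and M0: "M \<noteq> {0}" using M by (auto simp: irreducible_rep_def)
    have sM: "cfun.subspace M" using rM by (simp add: subrep_def)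
    define W' where "W' = {f\<in>W. \<forall>u\<in>M. herm X f u = 0}"
    have W': "subrep n act W'" "W' \<subseteq> W"
      unfolding W'_def using less.prems rM by (auto intro: subrep_complement)
    have M_W'0: "f = 0" if "f \<in> M" "f \<in> W'" for f
    proof (rule herm_self_eq_0[OF finite_X])
      show "f \<in> fsupp X" using that(1) M(2) less.prems(2) by blast
      show "herm X f f = 0" using that by (simp add: W'_def)
    qed
    have "W' \<noteq> W"
    proof
      assume "W' = W"
      hence "M \<subseteq> {0}" using M_W'0 M(2) by blast
      thus False using M0 cfun.subspace_0[OF sM] by blast
    qed
    hence "cfun.dim W' < cfun.dim W"
      using W' less.prems by (intro dim_strict_mono[OF finite_X]) (auto simp: subrep_def)
    from less.hyps[OF this W'(1)] W'(2) less.prems(2)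
    obtain k U where kU: "irreducible_decomposition n act W' k U" by blast
    have W'_eq: "W' = {\<Sum>i<k. u i |u. \<forall>i<k. u i \<in> U i}"
      and irr: "\<And>i. i < k \<Longrightarrow> irreducible_rep n act (U i)"
      and dir: "\<And>u. (\<forall>i<k. u i \<in> U i) \<Longrightarrow> (\<Sum>i<k. u i) = 0 \<Longrightarrow> \<forall>i<k. u i = 0"
      using kU unfolding irreducible_decomposition_def by blast+
    define U' where "U' = case_nat M U"
    have "irreducible_decomposition n act W (Suc k) U'"
      unfolding irreducible_decomposition_def
    proof (intro conjI allI impI)
      fix i assume "i < Suc k"
      thus "irreducible_rep n act (U' i)"
        using irr M by (cases i) (auto simp: U'_def)
    next
      show "W = {\<Sum>i<Suc k. u i |u. \<forall>i<Suc k. u i \<in> U' i}"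
      proof (intro equalityI subsetI)
        fix w assume w: "w \<in> W"
        obtain v where v: "v \<in> M" "\<And>u. u \<in> M \<Longrightarrow> herm X (w - v) u = 0"
          using orthogonal_projection[OF finite_X sM] M(2) less.prems(2) by (metis subset_trans)
        have "w - v \<in> W'"
          unfolding W'_def using v w M(2) cfun.subspace_diff[OF sW] by auto
        then obtain u where u: "w - v = (\<Sum>i<k. u i)" "\<forall>i<k. u i \<in> U i"
          unfolding W'_eq by auto
        have "w = (\<Sum>i<Suc k. case_nat v u i)"
          unfolding sum.lessThan_Suc_shift nat.case u(1)[symmetric] by simp
        moreover have "\<forall>i<Suc k. case_nat v u i \<in> U' i"
          using u v by (auto simp: U'_def split: nat.split)
        ultimately show "w \<in> {\<Sum>i<Suc k. u i |u. \<forall>i<Suc k. u i \<in> U' i}" by blast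
      next
        fix w assume "w \<in> {\<Sum>i<Suc k. u i |u. \<forall>i<Suc k. u i \<in> U' i}"
        then obtain u where u: "w = (\<Sum>i<Suc k. u i)" "\<forall>i<Suc k. u i \<in> U' i" by auto
        have "u 0 \<in> M" using u(2) by (auto simp: U'_def)
        moreover have "\<forall>i<k. u (Suc i) \<in> U i" using u(2) by (auto simp: U'_def)
        hence "(\<Sum>i<k. u (Suc i)) \<in> W'" unfolding W'_eq by blast
        ultimately show "w \<in> W"
          using W'(2) M(2) cfun.subspace_add[OF sW] unfolding u(1) sum.lessThan_Suc_shift by blast
      qed
    next
      fix u i assume u: "(\<forall>i<Suc k. u i \<in> U' i) \<and> (\<Sum>i<Suc k. u i) = 0" and i: "i < Suc k"
      have uM: "u 0 \<in> M" using u by (auto simp: U'_def)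
      have uU: "\<forall>i<k. u (Suc i) \<in> U i" using u by (auto simp: U'_def)
      have "u 0 + (\<Sum>i<k. u (Suc i)) = 0" using u unfolding sum.lessThan_Suc_shift by blast
      hence "(\<Sum>i<k. u (Suc i)) = - u 0" by (metis add_eq_0_iff)
      moreover have "(\<Sum>i<k. u (Suc i)) \<in> W'" unfolding W'_eq using uU by blast
      moreover have "- u 0 \<in> M" using cfun.subspace_neg[OF sM uM] .
      ultimately have "- u 0 = 0" using M_W'0 by metis
      moreover from this have "(\<Sum>i<k. u (Suc i)) = 0" using \<open>(\<Sum>i<k. u (Suc i)) = - u 0\<close> by simp
      ultimately show "u i = 0" using dir[OF uU] i by (cases i) auto
    qed
    thus ?thesis by blast
  qed
qed

lemma ga_act_add: "ga_act n act a (f + f') = ga_act n act a f + ga_act n act a f'"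
  by (simp add: ga_act_def act_add cfun.scale_right_distrib sum.distrib)

lemma ga_act_zero [simp]: "ga_act n act a 0 = 0"
  by (simp add: ga_act_def)

lemma ga_act_sum: "ga_act n act a (\<Sum>i\<in>A. f i) = (\<Sum>i\<in>A. ga_act n act a (f i))"
  by (induction A rule: infinite_finite_induct) (simp_all add: ga_act_add)

lemma ga_act_add_left: "ga_act n act (a + b) f = ga_act n act a f + ga_act n act b f"
  by (simp add: ga_act_def plus_fun_apply cfun.scale_left_distrib sum.distrib)

lemma ga_act_scale_left: "ga_act n act (cscale c a) f = cscale c (ga_act n act a f)"
proof -
  have "cscale c a g = c * a g" for g by (simp add: cscale_def)
  thus ?thesis by (simp add: ga_act_def cfun.scale_sum_right)
qed

lemma ga_act_subrep:
  assumes "subrep n act U" "f \<in> U"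
  shows "ga_act n act a f \<in> U"
  unfolding ga_act_def using assms
  by (intro cfun.subspace_sum cfun.subspace_scale) (auto simp: subrep_iff)

lemma act_ga_act:
  assumes "h permutes {..<n}"
  shows "act h (ga_act n act a f) = ga_act n act (left_act h a) f"
proof -
  have "act h (ga_act n act a f) = (\<Sum>g | g permutes {..<n}. cscale (a g) (act (h \<circ> g) f))"
    using assms by (simp add: ga_act_def act_sum act_scale act_comp)
  also have "\<dots> = (\<Sum>g | g permutes {..<n}. cscale (a (inv h \<circ> (h \<circ> g))) (act (h \<circ> g) f))"
    using assms by (simp add: o_assoc permutes_inv_o)
  also have "\<dots> = ga_act n act (left_act h a) f"
    unfolding ga_act_def left_act_def
    by (rule sum.reindex_bij_witness[of _ "\<lambda>g. inv h \<circ> g" "\<lambda>g. h \<circ> g"])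
       (use assms in \<open>auto simp: permutes_compose permutes_inv permutes_inverses fun_eq_iff\<close>)
  finally show ?thesis .
qed

text \<open>Acting by \<open>a\<close> has as adjoint the action of its image under the standard
  involution of the group algebra; semisimplicity is derived from this below.\<close>

lemma herm_ga_act_left:
  "herm X (ga_act n act a f) f' = herm X f (ga_act n act (\<lambda>g. cnj (a (inv g))) f')"
proof -
  have "herm X (ga_act n act a f) f' =
      (\<Sum>g | g permutes {..<n}. a g * herm X f (act (inv g) f'))"
    unfolding ga_act_def herm_sum_left
    by (intro sum.cong refl) (auto simp: herm_scale_left herm_act_left)
  also have "\<dots> = (\<Sum>g | g permutes {..<n}. a (inv g) * herm X f (act g f'))"
    by (rule sum.reindex_bij_witness[of _ inv inv])
       (auto simp: permutes_inv permutes_inv_inv)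
  also have "\<dots> = herm X f (ga_act n act (\<lambda>g. cnj (a (inv g))) f')"
    by (simp add: ga_act_def herm_sum_right herm_scale_right)
  finally show ?thesis .
qed

end

section \<open>Multiplicities and Schur's lemma\<close>

context point_action
begin

text \<open>Some component \<open>u i\<close> of \<open>w\<close> is not killed by \<open>c\<close>.
  Applying elements of \<open>V\<close> to this component is then an intertwining map from
  \<open>V\<close> to \<open>U i\<close>, nonzero at \<open>c\<close>, hence an isomorphism by
  Schur's argument on image and kernel. This is shown for every decomposition, so it covers the one
  picked by \<open>SOME\<close>.\<close>

lemma multiplicity_pos:
  assumes V: "irreducible_rep n left_act V" "c \<in> V"
    and W: "subrep n act W" "W \<subseteq> fsupp X"
    and w: "w \<in> W" "ga_act n act c w \<noteq> 0"
  shows "rep_multiplicity n left_act V act W > 0"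
proof -
  have pos: "card {i. i < k \<and> rep_iso n left_act V act (U i)} > 0"
    if dec: "irreducible_decomposition n act W k U" for k U
  proof -
    have W_eq: "W = {\<Sum>i<k. u i |u. \<forall>i<k. u i \<in> U i}"
      and irr: "\<And>i. i < k \<Longrightarrow> irreducible_rep n act (U i)"
      using dec unfolding irreducible_decomposition_def by blast+
    from w(1) obtain u where u: "w = (\<Sum>i<k. u i)" "\<forall>i<k. u i \<in> U i"
      unfolding W_eq by blast
    have "(\<Sum>i<k. ga_act n act c (u i)) \<noteq> 0"
      using w(2) unfolding u(1) ga_act_sum .
    then obtain i where i: "i < k" "ga_act n act c (u i) \<noteq> 0"
      by (meson lessThan_iff sum.neutral)
    define \<phi> where "\<phi> = (\<lambda>x. ga_act n act x (u i))"
    have irrU: "irreducible_rep n act (U i)" using irr i by blast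
    have sU: "subrep n act (U i)" using irrU by (simp add: irreducible_rep_def)
    have subU: "cfun.subspace (U i)" using sU by (simp add: subrep_def)
    have sV: "subrep n left_act V" using V by (simp add: irreducible_rep_def)
    have subV: "cfun.subspace V" using sV by (simp add: subrep_def)
    have \<phi>_add: "\<phi> (x + y) = \<phi> x + \<phi> y" for x y
      by (simp add: \<phi>_def ga_act_add_left)
    have \<phi>_scale: "\<phi> (cscale a x) = cscale a (\<phi> x)" for a x
      by (simp add: \<phi>_def ga_act_scale_left)
    have \<phi>_act: "\<phi> (left_act h x) = act h (\<phi> x)" if "h permutes {..<n}" for h x
      using that by (simp add: \<phi>_def act_ga_act)
    have \<phi>_0: "\<phi> 0 = 0" using \<phi>_scale[of 0 0] by simp
    have \<phi>_diff: "\<phi> (x - y) = \<phi> x - \<phi> y" for x y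
      using \<phi>_add[of "x - y" y] unfolding diff_add_cancel by (simp only: add_diff_cancel_right')
    have \<phi>_c: "\<phi> c \<noteq> 0" using i by (simp add: \<phi>_def)
    have "subrep n act (\<phi> ` V)"
      unfolding subrep_iff cfun.subspace_def
    proof (intro conjI allI impI ballI)
      show "0 \<in> \<phi> ` V" using imageI[OF cfun.subspace_0[OF subV], of \<phi>] unfolding \<phi>_0 .
    next
      fix x y assume "x \<in> \<phi> ` V" "y \<in> \<phi> ` V"
      then obtain x' y' where "x = \<phi> x'" "y = \<phi> y'" "x' \<in> V" "y' \<in> V" by blast
      thus "x + y \<in> \<phi> ` V"
        using imageI[OF cfun.subspace_add[OF subV, of x' y'], of \<phi>] by (simp only: \<phi>_add)
    next
      fix a x assume "x \<in> \<phi> ` V"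
      then obtain x' where "x = \<phi> x'" "x' \<in> V" by blast
      thus "cscale a x \<in> \<phi> ` V"
        using imageI[OF cfun.subspace_scale[OF subV, of x'], of \<phi>] by (simp only: \<phi>_scale)
    next
      fix h x assume h: "h permutes {..<n}" and "x \<in> \<phi> ` V"
      then obtain y where y: "x = \<phi> y" "y \<in> V" by blast
      have "left_act h y \<in> V" using sV y(2) h by (auto simp: subrep_def)
      thus "act h x \<in> \<phi> ` V" unfolding y(1) \<phi>_act[OF h, symmetric] by blast
    qed
    moreover have "\<phi> ` V \<subseteq> U i"
      unfolding \<phi>_def using ga_act_subrep[OF sU] u(2) i(1) by blast
    moreover have "\<phi> ` V \<noteq> {0}" using \<phi>_c V(2) by blast
    ultimately have surj: "\<phi> ` V = U i"
      using irrU unfolding irreducible_rep_def by blast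
    define K where "K = {x\<in>V. \<phi> x = 0}"
    have "subrep n left_act K"
      unfolding subrep_def cfun.subspace_def
    proof (intro conjI ballI allI impI image_subsetI)
      show "0 \<in> K" using \<phi>_0 cfun.subspace_0[OF subV] by (simp add: K_def)
    next
      fix x y assume "x \<in> K" "y \<in> K"
      thus "x + y \<in> K" using cfun.subspace_add[OF subV] by (simp add: K_def \<phi>_add)
    next
      fix a x assume "x \<in> K"
      thus "cscale a x \<in> K" using cfun.subspace_scale[OF subV] by (simp add: K_def \<phi>_scale)
    next
      fix h x assume h: "h permutes {..<n}" and x: "x \<in> K"
      have "left_act h x \<in> V" using sV x h by (auto simp: subrep_def K_def)
      thus "left_act h x \<in> K" using x by (simp add: K_def \<phi>_act[OF h])
    qed
    moreover have "K \<subseteq> V" "K \<noteq> V" using V(2) \<phi>_c by (auto simp: K_def)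
    ultimately have K0: "K = {0}" using V(1) unfolding irreducible_rep_def by blast
    have "inj_on \<phi> V"
    proof (rule inj_onI)
      fix x y assume xy: "x \<in> V" "y \<in> V" "\<phi> x = \<phi> y"
      hence "x - y \<in> K"
        unfolding K_def using cfun.subspace_diff[OF subV] by (simp add: \<phi>_diff)
      thus "x = y" using K0 by simp
    qed
    with surj have "bij_betw \<phi> V (U i)" by (simp add: bij_betw_def)
    hence "rep_iso n left_act V act (U i)"
      unfolding rep_iso_def by (intro exI[of _ \<phi>] conjI ballI allI impI \<phi>_add \<phi>_scale \<phi>_act)
    with i(1) have "i \<in> {i. i < k \<and> rep_iso n left_act V act (U i)}" by blast
    thus ?thesis by (subst card_gt_0_iff) auto
  qed
  obtain k U where kU: "irreducible_decomposition n act W k U"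
    using exists_irreducible_decomposition[OF W] by blast
  have "\<exists>d k U. irreducible_decomposition n act W k U \<and>
      d = card {i. i < k \<and> rep_iso n left_act V act (U i)}"
    using kU by blast
  from someI_ex[OF this] obtain k U where "irreducible_decomposition n act W k U"
    "rep_multiplicity n left_act V act W = card {i. i < k \<and> rep_iso n left_act V act (U i)}"
    unfolding rep_multiplicity_def[symmetric] by blast
  thus ?thesis using pos by metis
qed

lemma multiplicity_zero:
  assumes W: "subrep n act W" "W \<subseteq> fsupp X"
    and no: "\<And>U. irreducible_rep n act U \<Longrightarrow> U \<subseteq> W \<Longrightarrow> \<not> rep_iso n left_act V act U"
  shows "rep_multiplicity n left_act V act W = 0"
proof -
  have zero: "card {i. i < k \<and> rep_iso n left_act V act (U i)} = 0"
    if dec: "irreducible_decomposition n act W k U" for k U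
  proof -
    have W_eq: "W = {\<Sum>i<k. u i |u. \<forall>i<k. u i \<in> U i}"
      and irr: "\<And>i. i < k \<Longrightarrow> irreducible_rep n act (U i)"
      using dec unfolding irreducible_decomposition_def by blast+
    have "U i \<subseteq> W" if i: "i < k" for i
    proof
      fix v assume v: "v \<in> U i"
      define u where "u = (\<lambda>j. if j = i then v else 0)"
      have "u j \<in> U j" if "j < k" for j
        using irr[OF that] v cfun.subspace_0 by (auto simp: u_def irreducible_rep_def subrep_def)
      moreover have "v = (\<Sum>j<k. u j)"
        unfolding u_def using i by (subst sum.delta) auto
      ultimately show "v \<in> W" unfolding W_eq by blast
    qed
    hence "{i. i < k \<and> rep_iso n left_act V act (U i)} = {}"
      using no irr by blast
    thus ?thesis by simp
  qed
  obtain k U where kU: "irreducible_decomposition n act W k U"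
    using exists_irreducible_decomposition[OF W] by blast
  have "\<exists>d k U. irreducible_decomposition n act W k U \<and>
      d = card {i. i < k \<and> rep_iso n left_act V act (U i)}"
    using kU by blast
  from someI_ex[OF this] obtain k U where "irreducible_decomposition n act W k U"
    "rep_multiplicity n left_act V act W = card {i. i < k \<and> rep_iso n left_act V act (U i)}"
    unfolding rep_multiplicity_def[symmetric] by blast
  thus ?thesis using zero by metis
qed

lemma ga_act_assoc:
  "ga_act n act (ga_act n left_act a b) f = ga_act n act a (ga_act n act b f)"
proof -
  have sum_left: "ga_act n act (\<Sum>i\<in>A. x i) f = (\<Sum>i\<in>A. ga_act n act (x i) f)" for A x
  proof (induction A rule: infinite_finite_induct)
    case (insert i A)
    thus ?case by (simp add: ga_act_add_left)
  qed (simp_all add: ga_act_def fun_ops)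
  have "ga_act n act (ga_act n left_act a b) f =
      (\<Sum>g | g permutes {..<n}. cscale (a g) (ga_act n act (left_act g b) f))"
    unfolding ga_act_def[of n left_act] sum_left by (simp add: ga_act_scale_left)
  also have "\<dots> = (\<Sum>g | g permutes {..<n}. cscale (a g) (act g (ga_act n act b f)))"
    by (intro sum.cong refl) (simp add: act_ga_act)
  finally show ?thesis by (simp add: ga_act_def[of n act a])
qed

end

section \<open>Left multiplication and the diagonal action as point actions\<close>

abbreviation left_theta :: "(nat \<Rightarrow> nat) \<Rightarrow> (nat \<Rightarrow> nat) \<Rightarrow> nat \<Rightarrow> nat" where
  "left_theta g s \<equiv> inv g \<circ> s"

definition diag_theta :: "(nat \<Rightarrow> nat) \<Rightarrow> (nat \<Rightarrow> nat) \<times> (nat \<Rightarrow> nat) \<Rightarrow> (nat \<Rightarrow> nat) \<times> (nat \<Rightarrow> nat)" where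
  "diag_theta g = (\<lambda>(s, t). (inv g \<circ> s, inv g \<circ> t))"

lemma inv_comp_permutes_iff:
  assumes "g permutes A"
  shows "inv g \<circ> s permutes A \<longleftrightarrow> s permutes A"
proof
  assume "inv g \<circ> s permutes A"
  hence "g \<circ> (inv g \<circ> s) permutes A" using assms by (rule permutes_compose)
  thus "s permutes A" by (simp add: o_assoc permutes_inv_o(1)[OF assms])
qed (use assms in \<open>auto intro: permutes_compose permutes_inv\<close>)

lemma inv_comp_perm:
  assumes "g permutes A" "h permutes A"
  shows "inv (g \<circ> h) = inv h \<circ> inv g"
  using assms by (intro o_inv_distrib) (auto simp: permutes_bij)

global_interpretation left: point_action n "{g. g permutes {..<n}}" left_theta
  rewrites "point_action.act left_theta = left_act"
    and "fsupp {g. g permutes {..<n}} = group_algebra n"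
  for n
proof -
  show *: "point_action n {g. g permutes {..<n}} left_theta"
    by unfold_locales (auto simp: inv_comp_perm o_assoc inv_comp_permutes_iff)
  show "point_action.act left_theta = left_act"
    by (simp add: fun_eq_iff point_action.act_def[OF *] left_act_def)
  show "fsupp {g. g permutes {..<n}} = group_algebra n"
    by (auto simp: fsupp_def group_algebra_def)
qed

global_interpretation diag: point_action n "{g. g permutes {..<n}} \<times> {g. g permutes {..<n}}" diag_theta
  rewrites "point_action.act diag_theta = diag_act"
  for n
proof -
  show *: "point_action n ({g. g permutes {..<n}} \<times> {g. g permutes {..<n}}) diag_theta"
    by unfold_locales (auto simp: inv_comp_perm o_assoc inv_comp_permutes_iff diag_theta_def)
  show "point_action.act diag_theta = diag_act"
    by (auto simp: fun_eq_iff point_action.act_def[OF *] diag_act_def diag_theta_def)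
qed

lemma ga_act_left_apply:
  "ga_act n left_act a b s = (\<Sum>g | g permutes {..<n}. a g * b (inv g \<circ> s))"
  by (simp add: ga_act_def fun_sum_apply cscale_def left_act_def)

text \<open>Outside the symmetric group \<open>ga_mult\<close> vanishes because its index set is
  empty; the support condition on \<open>b\<close> makes \<open>ga_act\<close> vanish there
  too.\<close>

lemma ga_mult_eq_ga_act:
  assumes "b \<in> group_algebra n"
  shows "ga_mult n a b = ga_act n left_act a b"
proof
  fix s
  have "ga_mult n a b s =
      (\<Sum>(h, k)\<in>{(h, k). h permutes {..<n} \<and> k permutes {..<n} \<and> h \<circ> k = s}. a h * b k)"
    by (simp add: ga_mult_def)
  also have "\<dots> = (\<Sum>g\<in>{g. g permutes {..<n} \<and> s permutes {..<n}}. a g * b (inv g \<circ> s))"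
    by (rule sum.reindex_bij_witness[of _ "\<lambda>g. (g, inv g \<circ> s)" fst])
       (auto simp: o_assoc permutes_inv_o inv_comp_permutes_iff permutes_compose)
  also have "\<dots> = ga_act n left_act a b s"
  proof (cases "s permutes {..<n}")
    case False
    hence "b (inv g \<circ> s) = 0" if "g permutes {..<n}" for g
      using assms inv_comp_permutes_iff[OF that] by (auto simp: group_algebra_def)
    with False show ?thesis by (simp add: ga_act_left_apply)
  qed (simp add: ga_act_left_apply)
  finally show "ga_mult n a b s = ga_act n left_act a b s" .
qed

text \<open>With \<open>s\<close> the adjoint of \<open>u\<close>, the product \<open>v\<close> of
  \<open>s\<close> and \<open>u\<close> lies in \<open>U\<close>, so \<open>u\<close> times
  \<open>v\<close> is 0. Pairing this product with \<open>u\<close> gives the norm of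
  \<open>v\<close>, so \<open>v\<close> is 0; pairing \<open>v\<close> with the unit gives the norm
  of \<open>u\<close>, so \<open>u\<close> is 0.\<close>

lemma left_ideal_square_zero:
  assumes U: "subrep n left_act U" "U \<subseteq> group_algebra n"
    and sq: "\<And>u v. u \<in> U \<Longrightarrow> v \<in> U \<Longrightarrow> ga_act n left_act u v = 0"
    and u: "u \<in> U"
  shows "u = 0"
proof -
  let ?G = "{g. g permutes {..<n}}"
  define s where "s = (\<lambda>g. cnj (u (inv g)))"
  define v where "v = ga_act n left_act s u"
  have v: "v \<in> U" unfolding v_def by (rule left.ga_act_subrep[OF U(1) u])
  have "herm ?G (ga_act n left_act u v) u = herm ?G v v"
    unfolding left.herm_ga_act_left by (simp add: v_def s_def)
  hence "herm ?G v v = 0" by (simp add: sq[OF u v])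
  hence v0: "v = 0"
    using U v by (intro herm_self_eq_0[of ?G]) (auto simp: fsupp_def group_algebra_def)
  \<comment> \<open>The unit of the group algebra.\<close>
  define \<delta> :: "(nat \<Rightarrow> nat) \<Rightarrow> complex" where "\<delta> = (\<lambda>g. if g = id then 1 else 0)"
  have "ga_act n left_act (\<lambda>g. cnj (s (inv g))) \<delta> = u"
  proof
    fix t
    have "ga_act n left_act (\<lambda>g. cnj (s (inv g))) \<delta> t =
        (\<Sum>g | g permutes {..<n}. if g = t then u t else 0)"
      unfolding ga_act_left_apply
    proof (intro sum.cong refl)
      fix g assume "g \<in> ?G"
      hence g: "g permutes {..<n}" by simp
      have "inv g \<circ> t = id \<longleftrightarrow> g = t"
        using permutes_inv_o[OF g] by (metis comp_id fun.map_comp id_comp)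
      thus "cnj (s (inv g)) * \<delta> (inv g \<circ> t) = (if g = t then u t else 0)"
        by (auto simp: s_def \<delta>_def permutes_inv_inv[OF g])
    qed
    also have "\<dots> = u t"
      using u U(2) by (auto simp: group_algebra_def)
    finally show "ga_act n left_act (\<lambda>g. cnj (s (inv g))) \<delta> t = u t" .
  qed
  hence "herm ?G v \<delta> = herm ?G u u"
    unfolding v_def left.herm_ga_act_left by simp
  hence "herm ?G u u = 0" using v0 by simp
  thus "u = 0"
    using U u by (intro herm_self_eq_0[of ?G]) (auto simp: fsupp_def group_algebra_def)
qed

section \<open>Tableaux\<close>

text \<open>The inverse of \<open>tableau_entry\<close>: it returns the row and the column of a
  number. The value for \<open>[]\<close> is reached only by numbers beyond the tableau.\<close>

fun cell :: "nat list \<Rightarrow> nat \<Rightarrow> nat \<times> nat" where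
  "cell [] x = (0, x)"
| "cell (k # xs) x = (if x < k then (0, x) else map_prod Suc id (cell xs (x - k)))"

lemma tableau_entry_Cons:
  "tableau_entry (k # xs) 0 j = j" "tableau_entry (k # xs) (Suc i) j = k + tableau_entry xs i j"
  by (simp_all add: tableau_entry_def)

lemma cell_tableau_entry:
  "i < length xs \<Longrightarrow> j < xs ! i \<Longrightarrow> cell xs (tableau_entry xs i j) = (i, j)"
proof (induction xs arbitrary: i)
  case (Cons k xs)
  thus ?case by (cases i) (auto simp: tableau_entry_Cons)
qed simp

lemma tableau_entry_less:
  "i < length xs \<Longrightarrow> j < xs ! i \<Longrightarrow> tableau_entry xs i j < sum_list xs"
proof (induction xs arbitrary: i)
  case (Cons k xs)
  thus ?case by (cases i) (auto simp: tableau_entry_Cons)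
qed simp

lemma cell_in_shape:
  "x < sum_list xs \<Longrightarrow> fst (cell xs x) < length xs \<and> snd (cell xs x) < xs ! fst (cell xs x) \<and>
     tableau_entry xs (fst (cell xs x)) (snd (cell xs x)) = x"
proof (induction xs arbitrary: x)
  case (Cons k xs)
  thus ?case using Cons.IH[of "x - k"] by (auto simp: tableau_entry_Cons)
qed simp

text \<open>Because entries are numbered row by row, stretching all rows by \<open>l\<close> turns
  the box \<open>s\<close> into the \<open>l\<close> consecutive boxes \<open>l * s + c\<close> of
  the same row. Division with remainder by \<open>l\<close> therefore governs all scaled
  shapes.\<close>

lemma cell_scale:
  assumes "l > 0" "c < l" "s < sum_list xs"
  shows "cell (map ((*) l) xs) (l * s + c) = (fst (cell xs s), l * snd (cell xs s) + c)"
  using assms(3)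
proof (induction xs arbitrary: s)
  case (Cons k xs)
  show ?case
  proof (cases "s < k")
    case True
    hence "l * Suc s \<le> l * k" by (intro mult_le_mono) auto
    hence "l * s + c < l * k" using assms by simp
    thus ?thesis using True by simp
  next
    case False
    hence "l * k \<le> l * s" by simp
    hence "\<not> l * s + c < l * k" by linarith
    moreover have "l * s + c - l * k = l * (s - k) + c"
      using False \<open>l * k \<le> l * s\<close> by (simp add: diff_mult_distrib2)
    ultimately show ?thesis using Cons.IH[of "s - k"] Cons.prems False
      by (simp add: prod_eq_iff)
  qed
qed simp

section \<open>Stabilizers of rows and columns\<close>

abbreviation trow :: "nat list \<Rightarrow> nat \<Rightarrow> nat" where "trow xs x \<equiv> fst (cell xs x)"
abbreviation tcol :: "nat list \<Rightarrow> nat \<Rightarrow> nat" where "tcol xs x \<equiv> snd (cell xs x)"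

lemma tableau_row_eq: "tableau_row xs i = {x. x < sum_list xs \<and> trow xs x = i}"
  unfolding tableau_row_def using cell_in_shape[of _ xs]
  by (force simp: cell_tableau_entry tableau_entry_less)

lemma tableau_col_eq: "tableau_col xs j = {x. x < sum_list xs \<and> tcol xs x = j}"
  unfolding tableau_col_def using cell_in_shape[of _ xs]
  by (force simp: cell_tableau_entry tableau_entry_less)

text \<open>Row groups, column groups, blocks of a rectangle and residue classes modulo
  \<open>l\<close> are all stabilizers of a labelling, so they can share one set of closure and
  factorization properties.\<close>

definition fibre_group :: "nat \<Rightarrow> (nat \<Rightarrow> nat) \<Rightarrow> (nat \<Rightarrow> nat) set" where
  "fibre_group n r = {p. p permutes {..<n} \<and> (\<forall>x<n. r (p x) = r x)}"

text \<open>An injection that preserves labels maps each finite fibre into itself, hence onto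
  itself.\<close>

lemma fibre_group_eq:
  "fibre_group n r = {p. p permutes {..<n} \<and> (\<forall>i. p ` {x. x < n \<and> r x = i} = {x. x < n \<and> r x = i})}"
proof (rule equalityI; rule subsetI)
  fix p assume p: "p \<in> fibre_group n r"
  hence pp: "p permutes {..<n}" by (simp add: fibre_group_def)
  have "p ` {x. x < n \<and> r x = i} = {x. x < n \<and> r x = i}" for i
  proof (rule endo_inj_surj)
    show "p ` {x. x < n \<and> r x = i} \<subseteq> {x. x < n \<and> r x = i}"
      using p permutes_in_image[OF pp] by (auto simp: fibre_group_def)
    show "inj_on p {x. x < n \<and> r x = i}"
      using permutes_inj_on[OF pp] .
  qed simp
  thus "p \<in> {p. p permutes {..<n} \<and> (\<forall>i. p ` {x. x < n \<and> r x = i} = {x. x < n \<and> r x = i})}"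
    using pp by blast
next
  fix p assume p: "p \<in> {p. p permutes {..<n} \<and> (\<forall>i. p ` {x. x < n \<and> r x = i} = {x. x < n \<and> r x = i})}"
  have "r (p x) = r x" if "x < n" for x
  proof -
    have "p x \<in> p ` {y. y < n \<and> r y = r x}" using that by blast
    also have "\<dots> = {y. y < n \<and> r y = r x}" using p by blast
    finally show ?thesis by blast
  qed
  thus "p \<in> fibre_group n r" using p by (simp add: fibre_group_def)
qed

lemma row_group_eq: "row_group xs = fibre_group (sum_list xs) (trow xs)"
  and col_group_eq: "col_group xs = fibre_group (sum_list xs) (tcol xs)"
  by (simp_all add: row_group_def col_group_def fibre_group_eq tableau_row_eq tableau_col_eq)

lemma finite_fibre_group [simp, intro]: "finite (fibre_group n r)"
  by (rule finite_subset[OF _ finite_perms[of n]]) (auto simp: fibre_group_def)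

lemma fibre_group_permutes: "p \<in> fibre_group n r \<Longrightarrow> p permutes {..<n}"
  by (simp add: fibre_group_def)

lemma fibre_group_apply: "p \<in> fibre_group n r \<Longrightarrow> x < n \<Longrightarrow> r (p x) = r x"
  by (simp add: fibre_group_def)

lemma fibre_group_id: "id \<in> fibre_group n r"
  by (simp add: fibre_group_def permutes_id)

lemma permutes_lessThan_iff: "p permutes {..<n} \<Longrightarrow> p x < n \<longleftrightarrow> x < n" for n :: nat
  using permutes_in_image[of p "{..<n}" x] by simp

lemma fibre_group_comp:
  "p \<in> fibre_group n r \<Longrightarrow> q \<in> fibre_group n r \<Longrightarrow> p \<circ> q \<in> fibre_group n r"
  by (auto simp: fibre_group_def permutes_compose permutes_lessThan_iff)

lemma fibre_group_inv:
  assumes "p \<in> fibre_group n r"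
  shows "inv p \<in> fibre_group n r"
proof -
  have p: "p permutes {..<n}" using assms by (simp add: fibre_group_def)
  have "r (inv p x) = r x" if "x < n" for x
  proof -
    have "inv p x < n" using that permutes_lessThan_iff[OF permutes_inv[OF p]] by simp
    from fibre_group_apply[OF assms this] show ?thesis by (simp add: permutes_inverses[OF p])
  qed
  thus ?thesis using p by (simp add: fibre_group_def permutes_inv)
qed

lemma fibre_group_transpose:
  assumes "x < n" "y < n" "r x = r y"
  shows "Transposition.transpose x y \<in> fibre_group n r"
  using assms by (auto simp: fibre_group_def Transposition.transpose_def intro!: permutes_swap_id)

lemma row_col_group_Int:
  assumes "p \<in> row_group xs" "p \<in> col_group xs"
  shows "p = id"
proof
  fix x
  show "p x = id x"
  proof (cases "x < sum_list xs")
    case True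
    hence "p x < sum_list xs"
      using assms by (simp add: row_group_eq fibre_group_def permutes_lessThan_iff)
    moreover have "cell xs (p x) = cell xs x"
      using assms True fibre_group_apply[of p _ "trow xs"] fibre_group_apply[of p _ "tcol xs"]
      by (simp add: row_group_eq col_group_eq prod_eq_iff)
    ultimately show ?thesis
      using cell_in_shape[OF True] cell_in_shape[of "p x" xs] by simp
  next
    case False
    thus ?thesis using assms by (simp add: row_group_eq fibre_group_def permutes_def)
  qed
qed

lemma sign_of_permutes:
  assumes "p permutes {..<n::nat}" "q permutes {..<n}"
  shows "sign (p \<circ> q) = sign p * sign q" "sign (inv p) = sign p"
proof -
  have "permutation p" "permutation q"
    using assms permutation_permutes finite_lessThan by blast+
  thus "sign (p \<circ> q) = sign p * sign q" "sign (inv p) = sign p"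
    by (simp_all add: sign_compose sign_inverse)
qed

lemma row_col_unique:
  assumes "p \<in> row_group xs" "p' \<in> row_group xs" "q \<in> col_group xs" "q' \<in> col_group xs"
    and "p \<circ> q = p' \<circ> q'"
  shows "p = p' \<and> q = q'"
proof -
  have per: "p permutes {..<sum_list xs}" "p' permutes {..<sum_list xs}"
    "q permutes {..<sum_list xs}" "q' permutes {..<sum_list xs}"
    using assms by (auto simp: row_group_eq col_group_eq fibre_group_def)
  have "inv p' \<circ> p = inv p' \<circ> (p \<circ> q) \<circ> inv q"
    by (simp add: fun_eq_iff permutes_inverses[OF per(3)])
  also have "\<dots> = q' \<circ> inv q"
    unfolding assms(5) by (simp add: fun_eq_iff permutes_inverses[OF per(2)])
  finally have eq: "inv p' \<circ> p = q' \<circ> inv q" .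
  have "inv p' \<circ> p \<in> row_group xs"
    using assms by (simp add: row_group_eq fibre_group_comp fibre_group_inv)
  moreover have "inv p' \<circ> p \<in> col_group xs"
    unfolding eq using assms by (simp add: col_group_eq fibre_group_comp fibre_group_inv)
  ultimately have 1: "inv p' \<circ> p = id" by (rule row_col_group_Int)
  hence "p' \<circ> (inv p' \<circ> p) = p'" by simp
  hence "p = p'" by (simp add: o_assoc permutes_inv_o[OF per(2)])
  moreover have "(q' \<circ> inv q) \<circ> q = q" using 1 eq by simp
  hence "q' = q" by (simp add: o_assoc[symmetric] permutes_inv_o[OF per(3)])
  ultimately show ?thesis by simp
qed

section \<open>Young symmetrizers and irreducibility of Specht modules\<close>

text \<open>Obtained by grouping the pairs \<open>(p, q)\<close> by their product; every later
  pairing against a Young symmetrizer is expanded in this way.\<close>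

lemma sum_row_col:
  "(\<Sum>g | g permutes {..<sum_list xs}. young_symmetrizer xs g * F g) =
     (\<Sum>p\<in>row_group xs. \<Sum>q\<in>col_group xs. of_int (sign q) * F (p \<circ> q))"
proof -
  let ?G = "{g. g permutes {..<sum_list xs}}"
  let ?R = "row_group xs \<times> col_group xs"
  have finR: "finite ?R" by (simp add: row_group_eq col_group_eq)
  have im: "(\<lambda>(p, q). p \<circ> q) ` ?R \<subseteq> ?G"
    by (auto simp: row_group_eq col_group_eq fibre_group_def permutes_compose)
  have "young_symmetrizer xs g * F g =
      (\<Sum>(p, q)\<in>{z\<in>?R. (\<lambda>(p, q). p \<circ> q) z = g}. of_int (sign q) * F (p \<circ> q))" for g
    unfolding young_symmetrizer_def sum_distrib_right
    by (rule sum.cong) auto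
  hence "(\<Sum>g\<in>?G. young_symmetrizer xs g * F g) =
      (\<Sum>g\<in>?G. \<Sum>(p, q)\<in>{z\<in>?R. (\<lambda>(p, q). p \<circ> q) z = g}. of_int (sign q) * F (p \<circ> q))"
    by simp
  also have "\<dots> = (\<Sum>(p, q)\<in>?R. of_int (sign q) * F (p \<circ> q))"
    by (rule sum.group[OF finR finite_perms im])
  also have "\<dots> = (\<Sum>p\<in>row_group xs. \<Sum>q\<in>col_group xs. of_int (sign q) * F (p \<circ> q))"
    by (simp add: sum.cartesian_product)
  finally show ?thesis .
qed

lemma young_symmetrizer_row_col:
  assumes "p \<in> row_group xs" "q \<in> col_group xs"
  shows "young_symmetrizer xs (p \<circ> q) = of_int (sign q)"
proof -
  have "{(p', q'). p' \<in> row_group xs \<and> q' \<in> col_group xs \<and> p' \<circ> q' = p \<circ> q} = {(p, q)}"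
    using row_col_unique assms by blast
  thus ?thesis by (simp add: young_symmetrizer_def)
qed

lemma young_symmetrizer_outside:
  assumes "\<And>p q. p \<in> row_group xs \<Longrightarrow> q \<in> col_group xs \<Longrightarrow> g \<noteq> p \<circ> q"
  shows "young_symmetrizer xs g = 0"
proof -
  have "{(p', q'). p' \<in> row_group xs \<and> q' \<in> col_group xs \<and> p' \<circ> q' = g} = {}"
    using assms by blast
  thus ?thesis by (simp only: young_symmetrizer_def sum.empty)
qed

lemma young_symmetrizer_group_algebra: "young_symmetrizer xs \<in> group_algebra (sum_list xs)"
  unfolding group_algebra_def
proof (intro CollectI allI impI)
  fix g assume "\<not> g permutes {..<sum_list xs}"
  hence "g \<noteq> p \<circ> q" if "p \<in> row_group xs" "q \<in> col_group xs" for p q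
    using that by (auto simp: row_group_eq col_group_eq fibre_group_def permutes_compose)
  thus "young_symmetrizer xs g = 0" by (rule young_symmetrizer_outside)
qed

lemma young_symmetrizer_id: "young_symmetrizer xs id = 1"
  using young_symmetrizer_row_col[of id xs id] by (simp add: row_group_eq col_group_eq fibre_group_id)

lemma young_symmetrizer_row_inv:
  assumes "p \<in> row_group xs"
  shows "young_symmetrizer xs (p \<circ> g) = young_symmetrizer xs g"
proof (cases "\<exists>p' q'. p' \<in> row_group xs \<and> q' \<in> col_group xs \<and> g = p' \<circ> q'")
  case True
  then obtain p' q' where g: "p' \<in> row_group xs" "q' \<in> col_group xs" "g = p' \<circ> q'" by blast
  have "p \<circ> p' \<in> row_group xs" using assms g by (simp add: row_group_eq fibre_group_comp)
  from young_symmetrizer_row_col[OF this g(2)] young_symmetrizer_row_col[OF g(1,2)]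
  show ?thesis by (simp add: g(3) o_assoc)
next
  case False
  have pp: "p permutes {..<sum_list xs}" using assms by (simp add: row_group_eq fibre_group_def)
  have "p \<circ> g \<noteq> p' \<circ> q'" if "p' \<in> row_group xs" "q' \<in> col_group xs" for p' q'
  proof
    assume "p \<circ> g = p' \<circ> q'"
    hence "inv p \<circ> (p \<circ> g) = inv p \<circ> (p' \<circ> q')" by simp
    hence "g = (inv p \<circ> p') \<circ> q'" by (simp add: o_assoc permutes_inv_o[OF pp])
    moreover have "inv p \<circ> p' \<in> row_group xs"
      using assms that by (simp add: row_group_eq fibre_group_comp fibre_group_inv)
    ultimately show False using False that by blast
  qed
  hence "young_symmetrizer xs (p \<circ> g) = 0" by (rule young_symmetrizer_outside)
  moreover have "young_symmetrizer xs g = 0" using False by (intro young_symmetrizer_outside) blast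
  ultimately show ?thesis by simp
qed

lemma young_symmetrizer_col_sign:
  assumes "q \<in> col_group xs"
  shows "young_symmetrizer xs (g \<circ> q) = of_int (sign q) * young_symmetrizer xs g"
proof (cases "\<exists>p' q'. p' \<in> row_group xs \<and> q' \<in> col_group xs \<and> g = p' \<circ> q'")
  case True
  then obtain p' q' where g: "p' \<in> row_group xs" "q' \<in> col_group xs" "g = p' \<circ> q'" by blast
  have "q' \<circ> q \<in> col_group xs" using assms g by (simp add: col_group_eq fibre_group_comp)
  moreover have "sign (q' \<circ> q) = sign q' * sign q"
    using assms g by (intro sign_of_permutes[where n = "sum_list xs"]) (auto simp: col_group_eq fibre_group_def)
  ultimately show ?thesis
    using young_symmetrizer_row_col[OF g(1), of "q' \<circ> q"] young_symmetrizer_row_col[OF g(1,2)]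
    by (simp add: g(3) o_assoc)
next
  case False
  have pq: "q permutes {..<sum_list xs}" using assms by (simp add: col_group_eq fibre_group_def)
  have "g \<circ> q \<noteq> p' \<circ> q'" if "p' \<in> row_group xs" "q' \<in> col_group xs" for p' q'
  proof
    assume "g \<circ> q = p' \<circ> q'"
    hence "(g \<circ> q) \<circ> inv q = (p' \<circ> q') \<circ> inv q" by simp
    hence "g = p' \<circ> (q' \<circ> inv q)" by (simp add: o_assoc[symmetric] permutes_inv_o[OF pq])
    moreover have "q' \<circ> inv q \<in> col_group xs"
      using assms that by (simp add: col_group_eq fibre_group_comp fibre_group_inv)
    ultimately show False using False that by blast
  qed
  hence "young_symmetrizer xs (g \<circ> q) = 0" by (rule young_symmetrizer_outside)
  moreover have "young_symmetrizer xs g = 0" using False by (intro young_symmetrizer_outside) blast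
  ultimately show ?thesis by simp
qed

text \<open>For each \<open>t\<close>, the cells \<open>(trow x, tcol (inv g x))\<close> with second coordinate below \<open>t\<close>
  are as many as the cells of the shape in the first \<open>t\<close> columns; row by row they cannot be more,
  so there is equality in each row, and \<open>t\<close> may be taken to be the length of the row.\<close>

lemma mixed_cell_in_shape:
  assumes g: "g permutes {..<sum_list xs}"
    and inj: "\<And>x y. x < sum_list xs \<Longrightarrow> y < sum_list xs \<Longrightarrow> trow xs x = trow xs y \<Longrightarrow>
          tcol xs (inv g x) = tcol xs (inv g y) \<Longrightarrow> x = y"
    and x: "x < sum_list xs"
  shows "tcol xs (inv g x) < xs ! trow xs x"
proof -
  define n where "n = sum_list xs"
  define t where "t = xs ! trow xs x"
  define A where "A = (\<lambda>i. {y. y < n \<and> trow xs y = i \<and> tcol xs (inv g y) < t})"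
  define B where "B = (\<lambda>i. {y. y < n \<and> trow xs y = i \<and> tcol xs y < t})"
  have finA: "finite (A i)" and finB: "finite (B i)" for i by (auto simp: A_def B_def)
  have cs: "trow xs y < length xs" "tcol xs y < xs ! trow xs y"
    "tableau_entry xs (trow xs y) (tcol xs y) = y" if "y < n" for y
    using cell_in_shape[of y xs] that by (simp_all add: n_def)
  have te: "tableau_entry xs i j < n" if "i < length xs" "j < xs ! i" for i j
    using that by (simp add: n_def tableau_entry_less)
  have row: "card {y. y < n \<and> trow xs y = i} = xs ! i" if "i < length xs" for i
  proof -
    have "bij_betw (tableau_entry xs i) {..<xs ! i} {y. y < n \<and> trow xs y = i}"
      by (rule bij_betwI[of _ _ _ "tcol xs"])
         (use that cs te in \<open>auto simp: cell_tableau_entry\<close>)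
    from bij_betw_same_card[OF this] show ?thesis by simp
  qed
  have B: "card (B i) = min (xs ! i) t" if "i < length xs" for i
  proof -
    have "bij_betw (tableau_entry xs i) {..<min (xs ! i) t} (B i)"
      unfolding B_def
      by (rule bij_betwI[of _ _ _ "tcol xs"])
         (use that cs te in \<open>auto simp: cell_tableau_entry\<close>)
    from bij_betw_same_card[OF this] show ?thesis by simp
  qed
  have A_le: "card (A i) \<le> card (B i)" if i: "i < length xs" for i
  proof -
    have "card (A i) \<le> card {y. y < n \<and> trow xs y = i}"
      by (intro card_mono) (auto simp: A_def)
    moreover have "card (A i) \<le> card {..<t}"
      by (rule card_inj_on_le[of "\<lambda>y. tcol xs (inv g y)"])
         (use inj in \<open>auto simp: A_def n_def inj_on_def\<close>)
    ultimately show ?thesis using B[OF i] row[OF i] by simp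
  qed
  have "bij_betw (inv g) {y. y < n \<and> tcol xs (inv g y) < t} {y. y < n \<and> tcol xs y < t}"
    by (rule bij_betwI[of _ _ _ g])
       (use g in \<open>auto simp: n_def permutes_inverses permutes_lessThan_iff permutes_inv\<close>)
  hence card_eq: "card {y. y < n \<and> tcol xs (inv g y) < t} = card {y. y < n \<and> tcol xs y < t}"
    by (rule bij_betw_same_card)
  have split: "card {y. y < n \<and> P y} = (\<Sum>i<length xs. card {y. y < n \<and> trow xs y = i \<and> P y})" for P
  proof -
    have "{y. y < n \<and> P y} = (\<Union>i<length xs. {y. y < n \<and> trow xs y = i \<and> P y})"
      using cs(1) by auto
    moreover have "card (\<Union>i<length xs. {y. y < n \<and> trow xs y = i \<and> P y}) =
        (\<Sum>i<length xs. card {y. y < n \<and> trow xs y = i \<and> P y})"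
      by (rule card_UN_disjoint) auto
    ultimately show ?thesis by (rule trans[OF arg_cong])
  qed
  have sums: "(\<Sum>i<length xs. card (A i)) = (\<Sum>i<length xs. card (B i))"
    using card_eq split[of "\<lambda>y. tcol xs (inv g y) < t"] split[of "\<lambda>y. tcol xs y < t"]
    by (simp only: A_def B_def)
  have i: "trow xs x < length xs" using cell_in_shape[OF x] by simp
  have "card (A (trow xs x)) = card (B (trow xs x))"
    using sum_mono_inv[OF sums A_le, of "trow xs x"] i by simp
  hence "card (A (trow xs x)) = card {y. y < n \<and> trow xs y = trow xs x}"
    using B[OF i] row[OF i] by (simp add: t_def)
  hence "A (trow xs x) = {y. y < n \<and> trow xs y = trow xs x}"
    by (intro card_subset_eq) (auto simp: A_def)
  hence "x \<in> A (trow xs x)" using x by (simp add: n_def)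
  thus ?thesis by (simp add: A_def t_def)
qed

text \<open>Sending \<open>x\<close> to the box in the row of \<open>x\<close> and the column of
  \<open>inv g x\<close> defines a row permutation \<open>p'\<close>: the previous lemma says that
  this box exists, and the hypothesis says that the map is injective. By construction
  \<open>p' \<circ> g\<close> preserves columns.\<close>

lemma row_col_factorization:
  assumes g: "g permutes {..<sum_list xs}"
    and inj: "\<And>x y. x < sum_list xs \<Longrightarrow> y < sum_list xs \<Longrightarrow> trow xs x = trow xs y \<Longrightarrow>
          tcol xs (inv g x) = tcol xs (inv g y) \<Longrightarrow> x = y"
  shows "\<exists>p\<in>row_group xs. \<exists>q\<in>col_group xs. g = p \<circ> q"
proof -
  define n where "n = sum_list xs"
  define p' where "p' = (\<lambda>x. if x < n then tableau_entry xs (trow xs x) (tcol xs (inv g x)) else x)"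
  have mixed: "tcol xs (inv g x) < xs ! trow xs x" if "x < n" for x
    using that unfolding n_def by (intro mixed_cell_in_shape[OF g]) (auto intro: inj)
  have cell_p': "cell xs (p' x) = (trow xs x, tcol xs (inv g x))" and p'_less: "p' x < n" if "x < n" for x
    using that mixed[of x] cell_in_shape[of x xs]
    by (auto simp: p'_def n_def cell_tableau_entry tableau_entry_less)
  have "p' permutes {..<n}"
  proof (rule bij_imp_permutes)
    have "inj_on p' {..<n}"
    proof (rule inj_onI)
      fix x y assume xy: "x \<in> {..<n}" "y \<in> {..<n}" "p' x = p' y"
      hence "(trow xs x, tcol xs (inv g x)) = (trow xs y, tcol xs (inv g y))"
        using cell_p'[of x] cell_p'[of y] by simp
      thus "x = y" using inj[of x y] xy by (simp add: n_def)
    qed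
    moreover have "p' ` {..<n} \<subseteq> {..<n}" using p'_less by blast
    ultimately show "bij_betw p' {..<n} {..<n}"
      by (metis bij_betw_def endo_inj_surj finite_lessThan)
  qed (simp add: p'_def)
  hence p'_row: "p' \<in> row_group xs"
    using cell_p' by (simp add: row_group_eq fibre_group_def n_def)
  have gn: "g permutes {..<n}" using g by (simp add: n_def)
  have pn: "p' permutes {..<n}" using p'_row by (simp add: row_group_eq fibre_group_def n_def)
  have "p' \<circ> g \<in> col_group xs"
    using cell_p' permutes_lessThan_iff[OF gn] permutes_compose[OF gn pn]
    by (simp add: col_group_eq fibre_group_def n_def permutes_inverses[OF gn])
  moreover have "inv p' \<in> row_group xs" using p'_row by (simp add: row_group_eq fibre_group_inv)
  moreover have "g = inv p' \<circ> (p' \<circ> g)" by (simp add: o_assoc permutes_inv_o[OF pn])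
  ultimately show ?thesis by blast
qed

text \<open>The classical lemma of von Neumann. On products of a row and a column permutation the
  symmetries fix \<open>y\<close> up to the factor \<open>y id\<close>. Any other \<open>g\<close>
  has two entries in a common row whose preimages share a column; their transposition is a row
  permutation on the left of \<open>g\<close> and a column permutation on its right, so
  \<open>y g = - y g\<close>.\<close>

lemma row_col_invariant_multiple:
  assumes y: "y \<in> group_algebra (sum_list xs)"
    and row: "\<And>p g. p \<in> row_group xs \<Longrightarrow> g permutes {..<sum_list xs} \<Longrightarrow> y (p \<circ> g) = y g"
    and col: "\<And>q g. q \<in> col_group xs \<Longrightarrow> g permutes {..<sum_list xs} \<Longrightarrow> y (g \<circ> q) = of_int (sign q) * y g"
  shows "y = cscale (y id) (young_symmetrizer xs)"
proof
  fix g
  consider "\<not> g permutes {..<sum_list xs}" | p q where "p \<in> row_group xs" "q \<in> col_group xs" "g = p \<circ> q"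
    | "g permutes {..<sum_list xs}" "\<And>p q. p \<in> row_group xs \<Longrightarrow> q \<in> col_group xs \<Longrightarrow> g \<noteq> p \<circ> q"
    by blast
  thus "y g = cscale (y id) (young_symmetrizer xs) g"
  proof cases
    case 1
    thus ?thesis using y young_symmetrizer_group_algebra[of xs]
      by (simp add: group_algebra_def cscale_def)
  next
    case 2
    have "y g = y (id \<circ> q)"
      unfolding 2(3) id_comp using 2(1,2) by (intro row) (auto simp: col_group_eq fibre_group_def)
    also have "\<dots> = of_int (sign q) * y id" using 2(2) by (intro col) (auto simp: permutes_id)
    finally show ?thesis
      using young_symmetrizer_row_col[OF 2(1,2)] by (simp add: cscale_def 2(3))
  next
    case 3
    have "\<not> (\<forall>a b. a < sum_list xs \<longrightarrow> b < sum_list xs \<longrightarrow> trow xs a = trow xs b \<longrightarrow>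
        tcol xs (inv g a) = tcol xs (inv g b) \<longrightarrow> a = b)"
    proof
      assume *: "\<forall>a b. a < sum_list xs \<longrightarrow> b < sum_list xs \<longrightarrow> trow xs a = trow xs b \<longrightarrow>
        tcol xs (inv g a) = tcol xs (inv g b) \<longrightarrow> a = b"
      have "\<exists>p\<in>row_group xs. \<exists>q\<in>col_group xs. g = p \<circ> q"
        by (rule row_col_factorization[OF 3(1)]) (use * in blast)
      thus False using 3(2) by blast
    qed
    then obtain a b where ab: "a < sum_list xs" "b < sum_list xs" "trow xs a = trow xs b"
      "tcol xs (inv g a) = tcol xs (inv g b)" "a \<noteq> b" by blast
    have t: "Transposition.transpose a b \<in> row_group xs"
      using ab by (simp add: row_group_eq fibre_group_transpose)
    have less: "inv g a < sum_list xs" "inv g b < sum_list xs"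
      using ab permutes_lessThan_iff[OF permutes_inv[OF 3(1)]] by simp_all
    have q: "Transposition.transpose (inv g a) (inv g b) \<in> col_group xs"
      using ab less by (simp add: col_group_eq fibre_group_transpose)
    have "inv g a \<noteq> inv g b"
      using ab(5) permutes_inj[OF permutes_inv[OF 3(1)]] by (simp add: inj_eq)
    hence "y (g \<circ> Transposition.transpose (inv g a) (inv g b)) = - y g"
      using col[OF q 3(1)] by (simp add: sign_swap_id)
    moreover have "Transposition.transpose a b \<circ> g = g \<circ> Transposition.transpose (inv g a) (inv g b)"
      using permutes_bij[OF 3(1)] by (rule transpose_comp_eq)
    ultimately have "y g = - y g" using row[OF t 3(1)] by simp
    hence "y g = 0" by simp
    thus ?thesis using young_symmetrizer_outside[OF 3(2)] by (simp add: cscale_def)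
  qed
qed

section \<open>Specht modules as minimal left ideals\<close>

lemma specht_eq:
  "specht xs = {ga_act (sum_list xs) left_act a (young_symmetrizer xs) |a. a \<in> group_algebra (sum_list xs)}"
  unfolding specht_def by (simp add: ga_mult_eq_ga_act[OF young_symmetrizer_group_algebra])

lemma young_symmetrizer_in_specht: "young_symmetrizer xs \<in> specht xs"
proof -
  define \<delta> :: "(nat \<Rightarrow> nat) \<Rightarrow> complex" where "\<delta> = (\<lambda>g. if g = id then 1 else 0)"
  have "ga_act (sum_list xs) left_act \<delta> (young_symmetrizer xs) s = young_symmetrizer xs s" for s
  proof -
    have "ga_act (sum_list xs) left_act \<delta> (young_symmetrizer xs) s =
        (\<Sum>g | g permutes {..<sum_list xs}. if g = id then young_symmetrizer xs s else 0)"
      unfolding ga_act_left_apply by (intro sum.cong) (auto simp: \<delta>_def)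
    also have "\<dots> = young_symmetrizer xs s" by (simp add: permutes_id)
    finally show ?thesis .
  qed
  hence "young_symmetrizer xs = ga_act (sum_list xs) left_act \<delta> (young_symmetrizer xs)" by (simp add: fun_eq_iff)
  moreover have "\<delta> \<in> group_algebra (sum_list xs)"
    using permutes_id[of "{..<sum_list xs}"] by (auto simp: \<delta>_def group_algebra_def)
  ultimately show ?thesis unfolding specht_eq by blast
qed

lemma left_act_group_algebra:
  "g permutes {..<n} \<Longrightarrow> a \<in> group_algebra n \<Longrightarrow> left_act g a \<in> group_algebra n"
  by (rule left.act_fsupp)

lemma subspace_group_algebra: "cfun.subspace (group_algebra n)"
  using subspace_fsupp[of "{g. g permutes {..<n}}"] by (simp add: fsupp_def group_algebra_def)

lemma subrep_group_algebra: "subrep n left_act (group_algebra n)"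
  unfolding left.subrep_iff using subspace_group_algebra left_act_group_algebra by blast

lemma specht_subset: "specht xs \<subseteq> group_algebra (sum_list xs)"
  unfolding specht_eq using left.ga_act_subrep[OF subrep_group_algebra young_symmetrizer_group_algebra] by blast

lemma subrep_specht: "subrep (sum_list xs) left_act (specht xs)"
  unfolding left.subrep_iff cfun.subspace_def
proof (intro conjI ballI allI impI)
  show "0 \<in> specht xs"
  proof -
    have "0 = ga_act (sum_list xs) left_act 0 (young_symmetrizer xs)"
      by (simp add: ga_act_def fun_ops)
    thus ?thesis unfolding specht_eq using cfun.subspace_0[OF subspace_group_algebra] by blast
  qed
next
  fix x y assume "x \<in> specht xs" "y \<in> specht xs"
  then obtain a b where ab: "a \<in> group_algebra (sum_list xs)" "b \<in> group_algebra (sum_list xs)"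
    "x = ga_act (sum_list xs) left_act a (young_symmetrizer xs)"
    "y = ga_act (sum_list xs) left_act b (young_symmetrizer xs)"
    unfolding specht_eq by blast
  show "x + y \<in> specht xs"
    unfolding ab(3,4) left.ga_act_add_left[symmetric] specht_eq
    using cfun.subspace_add[OF subspace_group_algebra ab(1,2)] by blast
next
  fix c x assume "x \<in> specht xs"
  then obtain a where a: "a \<in> group_algebra (sum_list xs)"
    "x = ga_act (sum_list xs) left_act a (young_symmetrizer xs)"
    unfolding specht_eq by blast
  show "cscale c x \<in> specht xs"
    unfolding a(2) left.ga_act_scale_left[symmetric] specht_eq
    using cfun.subspace_scale[OF subspace_group_algebra a(1)] by blast
next
  fix g x assume g: "g permutes {..<sum_list xs}" and "x \<in> specht xs"
  then obtain a where a: "a \<in> group_algebra (sum_list xs)"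
    "x = ga_act (sum_list xs) left_act a (young_symmetrizer xs)"
    unfolding specht_eq by blast
  show "left_act g x \<in> specht xs"
    unfolding a(2) left.act_ga_act[OF g] specht_eq
    using left_act_group_algebra[OF g a(1)] by blast
qed

text \<open>Right multiplication commutes with the left action, so the whole left ideal inherits the
  column rule of its generator.\<close>

lemma specht_col_sign:
  assumes x: "x \<in> specht xs" and q: "q \<in> col_group xs"
  shows "x (g \<circ> q) = of_int (sign q) * x g"
proof -
  obtain a where a: "x = ga_act (sum_list xs) left_act a (young_symmetrizer xs)"
    using x unfolding specht_eq by blast
  show ?thesis
    unfolding a ga_act_left_apply o_assoc young_symmetrizer_col_sign[OF q]
    by (simp add: sum_distrib_left mult.left_commute)
qed

text \<open>The product is row-invariant on the left because of the symmetrizer acting on it, and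
  alternates under columns on the right because it lies in the left ideal.\<close>

lemma young_symmetrizer_act_specht:
  assumes "u \<in> specht xs"
  shows "\<exists>k. ga_act (sum_list xs) left_act (young_symmetrizer xs) u = cscale k (young_symmetrizer xs)"
proof -
  let ?y = "ga_act (sum_list xs) left_act (young_symmetrizer xs) u"
  have y: "?y \<in> specht xs" by (rule left.ga_act_subrep[OF subrep_specht assms])
  have "?y = cscale (?y id) (young_symmetrizer xs)"
  proof (rule row_col_invariant_multiple)
    show "?y \<in> group_algebra (sum_list xs)" using y specht_subset by blast
  next
    fix p g assume p: "p \<in> row_group xs"
    hence pp: "p permutes {..<sum_list xs}" by (simp add: row_group_eq fibre_group_def)
    have ip: "inv p permutes {..<sum_list xs}" using pp by (rule permutes_inv)
    have "left_act (inv p) (young_symmetrizer xs) = young_symmetrizer xs"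
      using young_symmetrizer_row_inv[OF p]
      by (simp add: left_act_def permutes_inv_inv[OF pp] fun_eq_iff)
    hence "left_act (inv p) ?y = ?y" unfolding left.act_ga_act[OF ip] by simp
    thus "?y (p \<circ> g) = ?y g"
      by (metis left_act_def permutes_inv_inv[OF pp])
  next
    fix q g assume "q \<in> col_group xs"
    with y show "?y (g \<circ> q) = of_int (sign q) * ?y g" by (rule specht_col_sign)
  qed
  thus ?thesis by blast
qed

text \<open>The symmetrizer maps a submodule \<open>U\<close> into its own multiples. If some image
  is nonzero, \<open>U\<close> contains the generator; otherwise products of elements of
  \<open>U\<close> vanish, and a left ideal with this property is 0.\<close>

theorem irreducible_specht: "irreducible_rep (sum_list xs) left_act (specht xs)"
  unfolding irreducible_rep_def
proof (intro conjI allI impI)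
  show "subrep (sum_list xs) left_act (specht xs)" by (rule subrep_specht)
  show "specht xs \<noteq> {0}"
  proof
    assume "specht xs = {0}"
    hence "young_symmetrizer xs = 0" using young_symmetrizer_in_specht by blast
    thus False using young_symmetrizer_id[of xs] by (simp add: fun_ops)
  qed
next
  fix U assume U: "subrep (sum_list xs) left_act U \<and> U \<subseteq> specht xs"
  let ?n = "sum_list xs" and ?c = "young_symmetrizer xs"
  show "U = {0} \<or> U = specht xs"
  proof (cases "\<exists>u\<in>U. ga_act ?n left_act ?c u \<noteq> 0")
    case True
    then obtain u where u: "u \<in> U" "ga_act ?n left_act ?c u \<noteq> 0" by blast
    obtain k where k: "ga_act ?n left_act ?c u = cscale k ?c"
      using young_symmetrizer_act_specht[of u xs] u(1) U by blast
    have "k \<noteq> 0" using u(2) k by auto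
    have "cscale k ?c \<in> U" unfolding k[symmetric] using left.ga_act_subrep U u(1) by blast
    moreover have "cfun.subspace U" using U by (simp add: subrep_def)
    ultimately have "cscale (1 / k) (cscale k ?c) \<in> U" by (rule cfun.subspace_scale[rotated])
    hence "?c \<in> U" using \<open>k \<noteq> 0\<close> by simp
    hence "ga_act ?n left_act a ?c \<in> U" for a using left.ga_act_subrep U by blast
    hence "specht xs \<subseteq> U" unfolding specht_eq by blast
    thus ?thesis using U by blast
  next
    case False
    have "ga_act ?n left_act u v = 0" if uv: "u \<in> U" "v \<in> U" for u v
    proof -
      obtain a where a: "u = ga_act ?n left_act a ?c"
        using uv(1) U unfolding specht_eq by blast
      have "ga_act ?n left_act ?c v = 0" using False uv(2) by blast
      thus ?thesis unfolding a left.ga_act_assoc by simp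
    qed
    hence "u = 0" if "u \<in> U" for u
      using left_ideal_square_zero[of ?n U u] U specht_subset that by blast
    moreover have "cfun.subspace U" using U by (simp add: subrep_def)
    hence "0 \<in> U" by (rule cfun.subspace_0)
    ultimately have "U = {0}" by blast
    thus ?thesis by blast
  qed
qed

section \<open>Vanishing and positivity criteria for Kronecker coefficients\<close>

lemma diag_act_tensor:
  "diag_act g (\<lambda>(x, y). v x * w y) = (\<lambda>(x, y). left_act g v x * left_act g w y)"
  by (auto simp: diag_act_def left_act_def)

lemma subspace_tensor_space: "cfun.subspace (tensor_space V W)"
  by (simp add: tensor_space_def cfun.subspace_span)

lemma tensor_in_tensor_space: "v \<in> V \<Longrightarrow> w \<in> W \<Longrightarrow> (\<lambda>(x, y). v x * w y) \<in> tensor_space V W"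
  unfolding tensor_space_def by (rule cfun.span_base) blast

lemma tensor_space_subset:
  assumes "cfun.subspace T" "\<And>v w. v \<in> V \<Longrightarrow> w \<in> W \<Longrightarrow> (\<lambda>(x, y). v x * w y) \<in> T"
  shows "tensor_space V W \<subseteq> T"
  unfolding tensor_space_def using assms by (intro cfun.span_minimal) auto

lemma subrep_tensor_space:
  assumes "subrep n left_act V" "subrep n left_act W"
  shows "subrep n diag_act (tensor_space V W)"
  unfolding diag.subrep_iff
proof (intro conjI allI impI)
  show "cfun.subspace (tensor_space V W)" by (rule subspace_tensor_space)
next
  fix g f assume g: "g permutes {..<n}" and f: "f \<in> tensor_space V W"
  have "tensor_space V W \<subseteq> {f. diag_act g f \<in> tensor_space V W}"
  proof (rule tensor_space_subset)
    show "cfun.subspace {f. diag_act g f \<in> tensor_space V W}"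
      unfolding cfun.subspace_def mem_Collect_eq diag.act_add diag.act_scale diag.act_zero
      using subspace_tensor_space[of V W] unfolding cfun.subspace_def by blast
  next
    fix v w assume "v \<in> V" "w \<in> W"
    hence "left_act g v \<in> V" "left_act g w \<in> W"
      using assms g by (auto simp: left.subrep_iff)
    thus "(\<lambda>(x, y). v x * w y) \<in> {f. diag_act g f \<in> tensor_space V W}"
      unfolding mem_Collect_eq diag_act_tensor by (rule tensor_in_tensor_space)
  qed
  thus "diag_act g f \<in> tensor_space V W" using f by blast
qed

lemma tensor_space_fsupp:
  assumes "V \<subseteq> group_algebra n" "W \<subseteq> group_algebra n"
  shows "tensor_space V W \<subseteq> fsupp ({g. g permutes {..<n}} \<times> {g. g permutes {..<n}})"
proof (rule tensor_space_subset)
  fix v w assume "v \<in> V" "w \<in> W"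
  hence "v \<in> group_algebra n" "w \<in> group_algebra n" using assms by auto
  thus "(\<lambda>(x, y). v x * w y) \<in> fsupp ({g. g permutes {..<n}} \<times> {g. g permutes {..<n}})"
    by (auto simp: fsupp_def group_algebra_def)
qed (rule subspace_fsupp)

text \<open>In a single column every permutation is a column permutation, so the elements of the
  module are multiples of the sign function.\<close>

lemma left_act_specht_column:
  assumes v: "v \<in> specht (replicate m 1)" and g: "g permutes {..<m}"
  shows "left_act g v = cscale (of_int (sign g)) v"
proof
  fix s
  have n: "sum_list (replicate m 1) = m" by (simp add: sum_list_replicate)
  have col: "q \<in> col_group (replicate m 1)" if "q permutes {..<m}" for q
  proof -
    have "tcol (replicate m 1) x = 0" if "x < m" for x
      using cell_in_shape[of x "replicate m 1"] that
      by (auto simp: sum_list_replicate simp del: One_nat_def)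
    thus ?thesis using that permutes_lessThan_iff[OF that]
      by (simp add: col_group_eq fibre_group_def sum_list_replicate)
  qed
  have v_eq: "v h = of_int (sign h) * v id" if "h permutes {..<m}" for h
    using specht_col_sign[OF v col[OF that], of id] by simp
  show "left_act g v s = cscale (of_int (sign g)) v s"
  proof (cases "s permutes {..<m}")
    case True
    have "inv g \<circ> s permutes {..<m}" using g True by (simp add: inv_comp_permutes_iff)
    moreover have "sign (inv g \<circ> s) = sign g * sign s"
      using sign_of_permutes(1)[OF permutes_inv[OF g] True] sign_of_permutes(2)[OF g g] by simp
    ultimately show ?thesis
      using v_eq[of "inv g \<circ> s"] v_eq[OF True] by (simp add: left_act_def cscale_def)
  next
    case False
    hence "\<not> inv g \<circ> s permutes {..<m}" using g by (simp add: inv_comp_permutes_iff)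
    moreover have "v \<in> group_algebra m" using specht_subset[of "replicate m 1"] v unfolding n by blast
    ultimately show ?thesis using False by (simp add: left_act_def cscale_def group_algebra_def)
  qed
qed

text \<open>The tensor square of the sign is trivial. An isomorphism with a summand would make
  \<open>t\<close>, the swap of the two top boxes of the first column, fix the Young symmetrizer
  \<open>c\<close>; but \<open>c\<close> takes the value 1 at \<open>id\<close> and -1 at
  \<open>t\<close>.\<close>

theorem kronecker_coeff_columns_eq_0:
  assumes len: "length xs \<ge> 2" and pos: "0 \<notin> set xs"
  defines "m \<equiv> sum_list xs"
  shows "kronecker_coeff xs (replicate m 1) (replicate m 1) = 0"
proof -
  let ?C = "specht (replicate m 1)"
  have n: "sum_list (replicate m 1) = m" by (simp add: sum_list_replicate)
  have sC: "subrep m left_act ?C" using subrep_specht[of "replicate m 1"] by (simp only: n)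
  have CG: "?C \<subseteq> group_algebra m" using specht_subset[of "replicate m 1"] by (simp only: n)
  have triv: "diag_act g f = f" if g: "g permutes {..<m}" and f: "f \<in> tensor_space ?C ?C" for g f
  proof -
    have "tensor_space ?C ?C \<subseteq> {f. diag_act g f = f}"
    proof (rule tensor_space_subset)
      show "cfun.subspace {f. diag_act g f = f}"
        unfolding cfun.subspace_def mem_Collect_eq diag.act_add diag.act_scale diag.act_zero by simp
    next
      fix v w assume vw: "v \<in> ?C" "w \<in> ?C"
      have "(of_int (sign g) :: complex) * of_int (sign g) = 1"
        unfolding of_int_mult[symmetric] by simp
      hence "of_int (sign g) * v x * (of_int (sign g) * w y) = v x * w y" for x y
        by (metis mult.assoc mult.left_commute mult.right_neutral mult.commute)
      hence "(\<lambda>(x, y). of_int (sign g) * v x * (of_int (sign g) * w y)) = (\<lambda>(x, y). v x * w y)"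
        by (simp only:)
      thus "(\<lambda>(x, y). v x * w y) \<in> {f. diag_act g f = f}"
        unfolding mem_Collect_eq diag_act_tensor left_act_specht_column[OF vw(1) g]
          left_act_specht_column[OF vw(2) g] cscale_def .
    qed
    thus ?thesis using f by blast
  qed
  have "rep_multiplicity m left_act (specht xs) diag_act (tensor_space ?C ?C) = 0"
  proof (rule diag.multiplicity_zero)
    show "subrep m diag_act (tensor_space ?C ?C)" by (rule subrep_tensor_space[OF sC sC])
    show "tensor_space ?C ?C \<subseteq> fsupp ({g. g permutes {..<m}} \<times> {g. g permutes {..<m}})"
      by (rule tensor_space_fsupp[OF CG CG])
  next
    fix U assume U: "U \<subseteq> tensor_space ?C ?C"
    show "\<not> rep_iso m left_act (specht xs) diag_act U"
    proof
      assume "rep_iso m left_act (specht xs) diag_act U"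
      then obtain \<phi> where \<phi>: "bij_betw \<phi> (specht xs) U"
        and eq: "\<And>g x. g permutes {..<m} \<Longrightarrow> x \<in> specht xs \<Longrightarrow> \<phi> (left_act g x) = diag_act g (\<phi> x)"
        unfolding rep_iso_def by blast
      let ?a = "tableau_entry xs 0 0" and ?b = "tableau_entry xs 1 0"
      have p: "xs ! 0 > 0" "xs ! 1 > 0"
        using len pos nth_mem[of 0 xs] nth_mem[of 1 xs] by (metis gr0I less_le_trans one_less_numeral_iff
            pos2 semiring_norm(76))+
      have cells: "cell xs ?a = (0, 0)" "cell xs ?b = (1, 0)"
        using len p by (auto intro!: cell_tableau_entry)
      have less: "?a < m" "?b < m"
        unfolding m_def using len p by (auto intro!: tableau_entry_less)
      define t where "t = Transposition.transpose ?a ?b"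
      have ab: "?a \<noteq> ?b" using cells by (metis prod.inject zero_neq_one)
      have t: "t \<in> col_group xs"
        unfolding t_def col_group_eq using less cells
        by (intro fibre_group_transpose) (simp_all add: m_def)
      have tm: "t permutes {..<m}" using t by (simp add: col_group_eq fibre_group_def m_def)
      let ?c = "young_symmetrizer xs"
      have c: "?c \<in> specht xs" by (rule young_symmetrizer_in_specht)
      have tc: "left_act t ?c \<in> specht xs"
        using subrep_specht[of xs] c tm unfolding left.subrep_iff m_def by blast
      have "\<phi> ?c \<in> tensor_space ?C ?C" using \<phi> c U by (auto simp: bij_betw_def)
      hence "\<phi> (left_act t ?c) = \<phi> ?c" using eq[OF tm c] triv[OF tm] by simp
      hence "left_act t ?c = ?c" using \<phi> c tc by (auto simp: bij_betw_def inj_on_def)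
      hence "?c (inv t \<circ> t) = ?c t" by (metis left_act_def)
      moreover have "?c (inv t \<circ> t) = 1" by (simp add: permutes_inv_o[OF tm] young_symmetrizer_id)
      moreover have "?c t = -1"
        using young_symmetrizer_row_col[OF _ t, of id] ab
        by (simp add: row_group_eq fibre_group_id t_def sign_swap_id)
      ultimately show False by simp
    qed
  qed
  thus ?thesis by (simp add: kronecker_coeff_def m_def)
qed

text \<open>The extra sign cancels the sign carried by the column permutations, so the column sum
  collapses to a cardinality, while the row sum becomes alternating. This produces determinants from
  the rows of the rectangle.\<close>

lemma signed_sum_young_symmetrizer:
  fixes F :: "(nat \<Rightarrow> nat) \<Rightarrow> complex"
  assumes F: "\<And>p q. p \<in> row_group xs \<Longrightarrow> q \<in> col_group xs \<Longrightarrow> F (p \<circ> q) = F p"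
  shows "(\<Sum>g | g permutes {..<sum_list xs}. of_int (sign g) * young_symmetrizer xs g * F g) =
    of_nat (card (col_group xs)) * (\<Sum>p\<in>row_group xs. of_int (sign p) * F p)"
proof -
  have "(\<Sum>g | g permutes {..<sum_list xs}. of_int (sign g) * young_symmetrizer xs g * F g) =
      (\<Sum>g | g permutes {..<sum_list xs}. young_symmetrizer xs g * (of_int (sign g) * F g))"
    by (intro sum.cong refl) (simp add: mult_ac)
  also have "\<dots> = (\<Sum>p\<in>row_group xs. \<Sum>q\<in>col_group xs. of_int (sign q) * (of_int (sign (p \<circ> q)) * F (p \<circ> q)))"
    by (rule sum_row_col)
  also have "\<dots> = (\<Sum>p\<in>row_group xs. \<Sum>q\<in>col_group xs. of_int (sign p) * F p)"
  proof (intro sum.cong refl)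
    fix p q assume pq: "p \<in> row_group xs" "q \<in> col_group xs"
    have "sign (p \<circ> q) = sign p * sign q"
      using pq by (intro sign_of_permutes[where n = "sum_list xs"])
        (auto simp: row_group_eq col_group_eq fibre_group_def)
    moreover have "(of_int (sign q) :: complex) * of_int (sign q) = 1"
      unfolding of_int_mult[symmetric] by simp
    ultimately show "of_int (sign q) * (of_int (sign (p \<circ> q)) * F (p \<circ> q)) = of_int (sign p) * F p"
      using F[OF pq] by (simp add: mult_ac)
  qed
  also have "\<dots> = of_nat (card (col_group xs)) * (\<Sum>p\<in>row_group xs. of_int (sign p) * F p)"
    by (simp add: sum_distrib_left)
  finally show ?thesis .
qed

lemma sum_fibre_group_inv:
  "(\<Sum>p\<in>fibre_group n r. F p) = (\<Sum>p\<in>fibre_group n r. F (inv p))"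
  by (rule sum.reindex_bij_witness[of _ inv inv])
     (auto simp: fibre_group_inv permutes_inv_inv[OF fibre_group_permutes])

text \<open>What remains of the pairing after the column sums have collapsed: the box
  \<open>x\<close> carries the matrix \<open>X (\<kappa> x)\<close>, whose indices are the columns
  of the images of \<open>x\<close> under two row permutations.\<close>

definition mixed_form :: "nat list \<Rightarrow> (nat \<Rightarrow> nat \<Rightarrow> nat \<Rightarrow> complex) \<Rightarrow> (nat \<Rightarrow> nat) \<Rightarrow> complex" where
  "mixed_form mu X \<kappa> = (\<Sum>p\<in>row_group mu. \<Sum>p'\<in>row_group mu. of_int (sign p) * of_int (sign p') *
     (\<Prod>x<sum_list mu. X (\<kappa> x) (tcol mu (p x)) (tcol mu (p' x))))"

text \<open>The product depends on \<open>g\<close> only through the columns of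
  \<open>inv g x\<close>, which do not change when \<open>g\<close> is multiplied on the right by a
  column permutation. So the signed collapse applies in each of the two variables; the inverses
  disappear by reindexing, since inversion preserves signs.\<close>

lemma mixed_form_young_symmetrizer:
  fixes X :: "nat \<Rightarrow> nat \<Rightarrow> nat \<Rightarrow> complex" and mu :: "nat list"
  defines "n \<equiv> sum_list mu" and "y \<equiv> young_symmetrizer mu"
  shows "(\<Sum>g | g permutes {..<n}. \<Sum>g' | g' permutes {..<n}.
      of_int (sign g) * of_int (sign g') * y g * y g' *
        (\<Prod>x<n. X (\<kappa> x) (tcol mu (inv g x)) (tcol mu (inv g' x)))) =
    (of_nat (card (col_group mu)))\<^sup>2 * mixed_form mu X \<kappa>"
proof -
  have inv_col: "tcol mu (inv (p \<circ> q) x) = tcol mu (inv p x)"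
    if "p \<in> row_group mu" "q \<in> col_group mu" "x < n" for p q x
  proof -
    have pq: "p permutes {..<n}" "q permutes {..<n}"
      using that by (auto simp: row_group_eq col_group_eq fibre_group_def n_def)
    have "inv p x < n" using that(3) permutes_lessThan_iff[OF permutes_inv[OF pq(1)]] by simp
    moreover have "inv q \<in> fibre_group n (tcol mu)"
      using that(2) by (simp add: col_group_eq fibre_group_inv n_def)
    ultimately have "tcol mu (inv q (inv p x)) = tcol mu (inv p x)"
      using fibre_group_apply[of "inv q" n "tcol mu"] by blast
    thus ?thesis by (simp add: inv_comp_perm[OF pq])
  qed
  let ?Z = "\<lambda>g g'. \<Prod>x<n. X (\<kappa> x) (tcol mu (inv g x)) (tcol mu (inv g' x))"
  let ?C = "of_nat (card (col_group mu)) :: complex"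
  have "(\<Sum>g | g permutes {..<n}. \<Sum>g' | g' permutes {..<n}.
      of_int (sign g) * of_int (sign g') * y g * y g' * ?Z g g') =
    (\<Sum>g | g permutes {..<n}. of_int (sign g) * y g *
      (\<Sum>g' | g' permutes {..<n}. of_int (sign g') * y g' * ?Z g g'))"
    by (simp add: sum_distrib_left mult_ac)
  also have "\<dots> = (\<Sum>g | g permutes {..<n}. of_int (sign g) * y g *
      (?C * (\<Sum>p\<in>row_group mu. of_int (sign p) * ?Z g p)))"
    unfolding n_def y_def
    by (subst signed_sum_young_symmetrizer) (auto simp: inv_col[unfolded n_def])
  also have "\<dots> = ?C * (\<Sum>p\<in>row_group mu. of_int (sign p) *
      (?C * (\<Sum>p'\<in>row_group mu. of_int (sign p') * ?Z p p')))"
    unfolding n_def y_def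
    by (subst signed_sum_young_symmetrizer) (auto simp: inv_col[unfolded n_def])
  also have "\<dots> = ?C\<^sup>2 * (\<Sum>p\<in>row_group mu. \<Sum>p'\<in>row_group mu.
      of_int (sign p) * of_int (sign p') * ?Z p p')"
    by (simp add: sum_distrib_left power2_eq_square mult_ac)
  also have "(\<Sum>p\<in>row_group mu. \<Sum>p'\<in>row_group mu. of_int (sign p) * of_int (sign p') * ?Z p p') =
      mixed_form mu X \<kappa>"
  proof -
    have s: "sign (inv p) = sign p" "inv (inv p) = p" if "p \<in> row_group mu" for p
      using that sign_of_permutes(2)[of p n p] permutes_inv_inv[of p "{..<n}"]
      by (auto simp: row_group_eq fibre_group_def n_def)
    have "(\<Sum>p\<in>row_group mu. \<Sum>p'\<in>row_group mu. of_int (sign p) * of_int (sign p') * ?Z p p') =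
      (\<Sum>p\<in>row_group mu. \<Sum>p'\<in>row_group mu. of_int (sign (inv p)) * of_int (sign (inv p')) * ?Z (inv p) (inv p'))"
      unfolding row_group_eq
      by (subst sum_fibre_group_inv, rule sum.cong[OF refl], rule sum_fibre_group_inv)
    also have "\<dots> = mixed_form mu X \<kappa>"
      unfolding mixed_form_def n_def[symmetric] by (intro sum.cong refl) (simp add: s)
    finally show ?thesis .
  qed
  finally show ?thesis .
qed

text \<open>A linear functional \<open>L\<close> is nonzero at the vector obtained by applying the
  symmetrizer \<open>c\<close> to \<open>w\<close>, the tensor square of the symmetrizer of
  \<open>mu\<close>; hence that vector is nonzero and \<open>multiplicity_pos\<close> applies.
  Translating both summation variables by \<open>h\<close> moves the diagonal action into the
  labelling, which becomes \<open>trow xs \<circ> h\<close>, and the sign of \<open>h\<close> occurs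
  twice and cancels. The row part of \<open>c\<close> leaves this labelling unchanged, so only the
  column sum remains.\<close>

theorem kronecker_coeff_pos_criterion:
  fixes X :: "nat \<Rightarrow> nat \<Rightarrow> nat \<Rightarrow> complex"
  assumes size: "sum_list xs = sum_list mu"
    and nz: "(\<Sum>q\<in>col_group xs. of_int (sign q) * mixed_form mu X (trow xs \<circ> q)) \<noteq> 0"
  shows "kronecker_coeff xs mu mu > 0"
proof -
  define n where "n = sum_list xs"
  have n': "sum_list mu = n" using size by (simp add: n_def)
  define y where "y = young_symmetrizer mu"
  define c where "c = young_symmetrizer xs"
  define w where "w = (\<lambda>(s, t). y s * y t)"
  let ?G = "{g. g permutes {..<n}}"
  define Z where "Z = (\<lambda>\<kappa> g g'. \<Prod>x<n. X (\<kappa> x) (tcol mu (inv g x)) (tcol mu (inv g' x)))"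
  define Y where "Y = (\<lambda>\<kappa>. \<Sum>g\<in>?G. \<Sum>g'\<in>?G. of_int (sign g) * of_int (sign g') * y g * y g' * Z \<kappa> g g')"
  define L where "L = (\<lambda>F. \<Sum>g\<in>?G. \<Sum>g'\<in>?G. of_int (sign g) * of_int (sign g') * Z (trow xs) g g' * F (g, g'))"
  have L_act: "L (diag_act h w) = Y (trow xs \<circ> h)" if h: "h permutes {..<n}" for h
  proof -
    have re: "(\<Sum>g\<in>?G. F g) = (\<Sum>g\<in>?G. F (h \<circ> g))" for F :: "(nat \<Rightarrow> nat) \<Rightarrow> complex"
      by (rule setum_permutations_compose_left[OF h])
    have Zh: "Z (trow xs) (h \<circ> g) (h \<circ> g') = Z (trow xs \<circ> h) g g'"
      if "g permutes {..<n}" "g' permutes {..<n}" for g g'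
      unfolding Z_def inv_comp_perm[OF h that(1)] inv_comp_perm[OF h that(2)]
      by (rule prod.reindex_bij_witness[of _ h "inv h"])
         (use h in \<open>auto simp: permutes_inverses permutes_lessThan_iff permutes_inv\<close>)
    have "L (diag_act h w) = (\<Sum>g\<in>?G. \<Sum>g'\<in>?G. of_int (sign (h \<circ> g)) * of_int (sign (h \<circ> g')) *
        Z (trow xs) (h \<circ> g) (h \<circ> g') * diag_act h w (h \<circ> g, h \<circ> g'))"
      unfolding L_def by (subst re, rule sum.cong[OF refl], rule re)
    also have "\<dots> = Y (trow xs \<circ> h)"
      unfolding Y_def
    proof (intro sum.cong refl)
      fix g g' assume "g \<in> ?G" "g' \<in> ?G"
      hence g: "g permutes {..<n}" "g' permutes {..<n}" by auto
      have "diag_act h w (h \<circ> g, h \<circ> g') = y g * y g'"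
        by (simp add: diag_act_def w_def o_assoc permutes_inv_o[OF h])
      moreover have "(of_int (sign h) :: complex) * of_int (sign h) = 1"
        unfolding of_int_mult[symmetric] by simp
      hence "of_int (sign (h \<circ> g)) * of_int (sign (h \<circ> g')) = (of_int (sign g) * of_int (sign g') :: complex)"
        using sign_of_permutes(1)[OF h g(1)] sign_of_permutes(1)[OF h g(2)]
        by (simp add: mult_ac)
      ultimately show "of_int (sign (h \<circ> g)) * of_int (sign (h \<circ> g')) *
          Z (trow xs) (h \<circ> g) (h \<circ> g') * diag_act h w (h \<circ> g, h \<circ> g') =
        of_int (sign g) * of_int (sign g') * y g * y g' * Z (trow xs \<circ> h) g g'"
        unfolding Zh[OF g] by (simp add: mult_ac)
    qed
    finally show ?thesis .
  qed
  have Y_eq: "Y \<kappa> = (of_nat (card (col_group mu)))\<^sup>2 * mixed_form mu X \<kappa>" for \<kappa>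
    unfolding Y_def Z_def y_def
    using mixed_form_young_symmetrizer[of mu X \<kappa>] by (simp only: n')
  have Y_cong: "Y \<kappa> = Y \<kappa>'" if "\<And>x. x < n \<Longrightarrow> \<kappa> x = \<kappa>' x" for \<kappa> \<kappa>'
    unfolding Y_def Z_def using that by (auto intro!: sum.cong prod.cong)
  have L_sum: "L (\<Sum>h\<in>A. cscale (a h) (F h)) = (\<Sum>h\<in>A. a h * L (F h))" for A a F
  proof -
    have "L (\<Sum>h\<in>A. cscale (a h) (F h)) = (\<Sum>g\<in>?G. \<Sum>g'\<in>?G. \<Sum>h\<in>A. a h *
        (of_int (sign g) * of_int (sign g') * Z (trow xs) g g' * F h (g, g')))"
      unfolding L_def fun_sum_apply cscale_def sum_distrib_left
      by (intro sum.cong refl) (simp add: mult_ac)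
    also have "\<dots> = (\<Sum>g\<in>?G. \<Sum>h\<in>A. \<Sum>g'\<in>?G. a h *
        (of_int (sign g) * of_int (sign g') * Z (trow xs) g g' * F h (g, g')))"
      by (intro sum.cong refl sum.swap)
    also have "\<dots> = (\<Sum>h\<in>A. \<Sum>g\<in>?G. \<Sum>g'\<in>?G. a h *
        (of_int (sign g) * of_int (sign g') * Z (trow xs) g g' * F h (g, g')))"
      by (rule sum.swap)
    finally show ?thesis by (simp add: L_def sum_distrib_left)
  qed
  have "L (ga_act n diag_act c w) = (\<Sum>h\<in>?G. c h * L (diag_act h w))"
    unfolding ga_act_def by (rule L_sum)
  also have "\<dots> = (\<Sum>h\<in>?G. c h * Y (trow xs \<circ> h))"
    by (intro sum.cong refl) (simp add: L_act)
  also have "\<dots> = (\<Sum>p\<in>row_group xs. \<Sum>q\<in>col_group xs. of_int (sign q) * Y (trow xs \<circ> (p \<circ> q)))"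
    unfolding c_def n_def by (rule sum_row_col)
  also have "\<dots> = (\<Sum>p\<in>row_group xs. \<Sum>q\<in>col_group xs. of_int (sign q) * Y (trow xs \<circ> q))"
  proof (intro sum.cong refl)
    fix p q assume pq: "p \<in> row_group xs" "q \<in> col_group xs"
    have "Y (trow xs \<circ> (p \<circ> q)) = Y (trow xs \<circ> q)"
    proof (rule Y_cong)
      fix x assume "x < n"
      hence "q x < n" using pq(2) by (simp add: col_group_eq fibre_group_def n_def permutes_lessThan_iff)
      thus "(trow xs \<circ> (p \<circ> q)) x = (trow xs \<circ> q) x"
        using pq(1) fibre_group_apply[of p n "trow xs"] by (simp add: row_group_eq n_def)
    qed
    thus "of_int (sign q) * Y (trow xs \<circ> (p \<circ> q)) = of_int (sign q) * Y (trow xs \<circ> q)" by simp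
  qed
  also have "\<dots> = of_nat (card (row_group xs)) * (\<Sum>q\<in>col_group xs. of_int (sign q) * Y (trow xs \<circ> q))"
    by simp
  also have "(\<Sum>q\<in>col_group xs. of_int (sign q) * Y (trow xs \<circ> q)) =
      (of_nat (card (col_group mu)))\<^sup>2 * (\<Sum>q\<in>col_group xs. of_int (sign q) * mixed_form mu X (trow xs \<circ> q))"
    unfolding Y_eq by (simp add: sum_distrib_left mult_ac)
  finally have L_eq: "L (ga_act n diag_act c w) = of_nat (card (row_group xs)) *
      ((of_nat (card (col_group mu)))\<^sup>2 * (\<Sum>q\<in>col_group xs. of_int (sign q) * mixed_form mu X (trow xs \<circ> q)))" .
  have "card (row_group xs) > 0" "card (col_group mu) > 0"
    using fibre_group_id by (auto simp: card_gt_0_iff row_group_eq col_group_eq)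
  hence L_nz: "L (ga_act n diag_act c w) \<noteq> 0" using nz unfolding L_eq by simp
  have "ga_act n diag_act c w \<noteq> 0"
  proof
    assume "ga_act n diag_act c w = 0"
    thus False using L_nz by (simp add: L_def fun_ops)
  qed
  moreover have "w \<in> tensor_space (specht mu) (specht mu)"
    unfolding w_def y_def by (intro tensor_in_tensor_space young_symmetrizer_in_specht)
  moreover have "subrep n diag_act (tensor_space (specht mu) (specht mu))"
    using subrep_specht[of mu] by (intro subrep_tensor_space) (simp_all only: n')
  moreover have "tensor_space (specht mu) (specht mu) \<subseteq> fsupp (?G \<times> ?G)"
    using specht_subset[of mu] by (intro tensor_space_fsupp) (simp_all only: n')
  moreover have "irreducible_rep n left_act (specht xs)"
    unfolding n_def by (rule irreducible_specht)
  moreover have "c \<in> specht xs" unfolding c_def by (rule young_symmetrizer_in_specht)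
  ultimately have "rep_multiplicity n left_act (specht xs) diag_act (tensor_space (specht mu) (specht mu)) > 0"
    by (intro diag.multiplicity_pos)
  thus ?thesis by (simp add: kronecker_coeff_def n_def)
qed

section \<open>Signed sums over products of permutation groups\<close>

text \<open>A numbering of an \<open>a\<close> by \<open>b\<close> rectangle, with \<open>d1\<close>
  naming the block and \<open>d2\<close> the place in it. It serves twice: for the rows of
  \<open>(l^m)\<close> and for the \<open>l\<close> interleaved copies of a shape inside its
  scaling.\<close>

locale grid =
  fixes n a b :: nat and e :: "nat \<Rightarrow> nat \<Rightarrow> nat" and d1 d2 :: "nat \<Rightarrow> nat"
  assumes e_less: "i < a \<Longrightarrow> j < b \<Longrightarrow> e i j < n"
    and d_e: "i < a \<Longrightarrow> j < b \<Longrightarrow> d1 (e i j) = i" "i < a \<Longrightarrow> j < b \<Longrightarrow> d2 (e i j) = j"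
    and d_less: "x < n \<Longrightarrow> d1 x < a" "x < n \<Longrightarrow> d2 x < b"
    and e_d: "x < n \<Longrightarrow> e (d1 x) (d2 x) = x"
begin

definition slice :: "(nat \<Rightarrow> nat) \<Rightarrow> nat \<Rightarrow> nat \<Rightarrow> nat" where
  "slice p i = (\<lambda>j. if j < b then d2 (p (e i j)) else j)"

text \<open>Only the first \<open>k\<close> blocks are permuted. The bound is there for the
  induction that computes the sign, in which one more block contributes one more factor.\<close>

definition glue_upto :: "nat \<Rightarrow> (nat \<Rightarrow> nat \<Rightarrow> nat) \<Rightarrow> nat \<Rightarrow> nat" where
  "glue_upto k \<sigma> = (\<lambda>x. if x < n \<and> d1 x < k then e (d1 x) (\<sigma> (d1 x) (d2 x)) else x)"

lemma glue_upto_permutes_sign: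
  assumes "\<And>i. i < a \<Longrightarrow> \<sigma> i permutes {..<b}" "k \<le> a"
  shows "glue_upto k \<sigma> permutes {..<n} \<and> sign (glue_upto k \<sigma>) = (\<Prod>i<k. sign (\<sigma> i))"
  using assms(2)
proof (induction k)
  case 0
  have "glue_upto 0 \<sigma> = id" by (simp add: glue_upto_def fun_eq_iff)
  thus ?case by (simp only: permutes_id sign_id lessThan_0 prod.empty simp_thms)
next
  case (Suc k)
  hence k: "k < a" by simp
  have inj: "inj_on (e k) {..<b}"
    using d_e(2)[OF k] by (metis inj_onI lessThan_iff)
  let ?A = "e k ` {..<b}"
  let ?p = "map_permutation {..<b} (e k) (\<sigma> k)"
  have p: "?p permutes ?A"
    using inj assms(1)[OF k] by (intro map_permutation_permutes) (auto simp: bij_betw_def)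
  have pn: "?p permutes {..<n}"
    using e_less[OF k] by (intro permutes_subset[OF p]) auto
  have sg: "sign ?p = sign (\<sigma> k)"
    using inj assms(1)[OF k] by (intro sign_map_permutation) auto
  have app: "?p (e k j) = e k (\<sigma> k j)" if "j < b" for j
    using inj that by (intro map_permutation_apply) auto
  have \<sigma>_less: "\<sigma> i j < b" if "i < a" "j < b" for i j
    using permutes_lessThan_iff[OF assms(1)[OF that(1)]] that(2) by simp
  have "glue_upto (Suc k) \<sigma> = ?p \<circ> glue_upto k \<sigma>"
  proof
    fix x
    consider "\<not> (x < n \<and> d1 x < Suc k)" | "x < n" "d1 x = k" | "x < n" "d1 x < k" by linarith
    thus "glue_upto (Suc k) \<sigma> x = (?p \<circ> glue_upto k \<sigma>) x"
    proof cases
      case 1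
      have "x \<notin> ?A" using 1 d_e(1)[OF k] e_less[OF k] by auto
      hence "?p x = x" using p by (simp add: permutes_def)
      thus ?thesis using 1 by (auto simp: glue_upto_def)
    next
      case 2
      thus ?thesis using app[OF d_less(2)[OF 2(1)]] e_d[OF 2(1)] by (simp add: glue_upto_def)
    next
      case 3
      have less: "d1 x < a" "d2 x < b" using d_less[OF 3(1)] .
      have "e (d1 x) (\<sigma> (d1 x) (d2 x)) \<notin> ?A"
        using d_e(1)[OF less(1) \<sigma>_less[OF less]] d_e(1)[OF k] 3(2) by auto
      hence "?p (e (d1 x) (\<sigma> (d1 x) (d2 x))) = e (d1 x) (\<sigma> (d1 x) (d2 x))"
        using p by (simp add: permutes_def)
      thus ?thesis using 3 by (simp add: glue_upto_def)
    qed
  qed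
  moreover have g: "glue_upto k \<sigma> permutes {..<n}" "sign (glue_upto k \<sigma>) = (\<Prod>i<k. sign (\<sigma> i))"
    using Suc by simp_all
  moreover have "(\<Prod>i<Suc k. sign (\<sigma> i)) = sign (\<sigma> k) * (\<Prod>i<k. sign (\<sigma> i))"
    by (simp add: mult.commute)
  ultimately show ?case
    using permutes_compose[OF g(1) pn] sign_of_permutes(1)[OF pn g(1)] by (simp only: sg simp_thms)
qed

definition glue :: "(nat \<Rightarrow> nat \<Rightarrow> nat) \<Rightarrow> nat \<Rightarrow> nat" where
  "glue = glue_upto a"

lemma glue_apply: "x < n \<Longrightarrow> glue \<sigma> x = e (d1 x) (\<sigma> (d1 x) (d2 x))"
  by (simp add: glue_def glue_upto_def d_less)

lemma glue_outside: "\<not> x < n \<Longrightarrow> glue \<sigma> x = x"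
  by (simp add: glue_def glue_upto_def)

lemma slice_permutes:
  assumes p: "p \<in> fibre_group n d1" and i: "i < a"
  shows "slice p i permutes {..<b}"
proof (rule bij_imp_permutes)
  have pp: "p permutes {..<n}" using p by (simp add: fibre_group_def)
  have "inj_on (slice p i) {..<b}"
  proof (rule inj_onI)
    fix j k assume jk: "j \<in> {..<b}" "k \<in> {..<b}" "slice p i j = slice p i k"
    have less: "p (e i j) < n" "p (e i k) < n"
      using jk i by (simp_all add: permutes_lessThan_iff[OF pp] e_less)
    have "d1 (p (e i j)) = i" "d1 (p (e i k)) = i"
      using jk i fibre_group_apply[OF p] by (simp_all add: d_e e_less)
    moreover have "d2 (p (e i j)) = d2 (p (e i k))" using jk by (simp add: slice_def)
    ultimately have "p (e i j) = p (e i k)" using e_d[OF less(1)] e_d[OF less(2)] by simp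
    hence eq: "e i j = e i k" using permutes_inj[OF pp] by (simp only: inj_eq)
    have "j < b" "k < b" using jk by auto
    from d_e(2)[OF i this(1)] d_e(2)[OF i this(2)] eq show "j = k" by metis
  qed
  moreover have "slice p i ` {..<b} \<subseteq> {..<b}"
  proof safe
    fix j assume "j < b"
    hence "p (e i j) < n" using i by (simp only: permutes_lessThan_iff[OF pp] e_less)
    from d_less(2)[OF this] show "slice p i j < b" using \<open>j < b\<close> by (simp only: slice_def if_True)
  qed
  ultimately show "bij_betw (slice p i) {..<b} {..<b}"
    by (metis bij_betw_def endo_inj_surj finite_lessThan)
qed (simp add: slice_def)

lemma slice_glue:
  assumes "\<sigma> i permutes {..<b}" "i < a"
  shows "slice (glue \<sigma>) i = \<sigma> i"
proof
  fix j
  show "slice (glue \<sigma>) i j = \<sigma> i j"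
  proof (cases "j < b")
    case True
    thus ?thesis using assms permutes_lessThan_iff[OF assms(1)]
      by (simp add: slice_def glue_apply e_less d_e)
  next
    case False
    thus ?thesis using assms(1) by (simp add: slice_def permutes_def)
  qed
qed

lemma glue_slice:
  assumes p: "p \<in> fibre_group n d1"
  shows "glue (slice p) = p"
proof
  fix x
  have pp: "p permutes {..<n}" using p by (simp add: fibre_group_def)
  show "glue (slice p) x = p x"
  proof (cases "x < n")
    case True
    have "p x < n" using True by (simp add: permutes_lessThan_iff[OF pp])
    from e_d[OF this] show ?thesis
      using True fibre_group_apply[OF p True] by (simp add: glue_apply slice_def d_less e_d)
  next
    case False
    thus ?thesis using pp by (simp add: glue_outside permutes_def)
  qed
qed

lemma glue_in_fibre_group:
  assumes "\<And>i. i < a \<Longrightarrow> \<sigma> i permutes {..<b}"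
  shows "glue \<sigma> \<in> fibre_group n d1"
proof -
  have "\<sigma> i j < b" if "i < a" "j < b" for i j
    using permutes_lessThan_iff[OF assms[OF that(1)]] that(2) by simp
  thus ?thesis
    using glue_upto_permutes_sign[of \<sigma> a] assms
    by (simp add: fibre_group_def glue_def[symmetric] glue_apply d_e d_less)
qed

text \<open>\<open>slice\<close> and \<open>glue\<close> identify the stabilizer of the blocks with
  a product of symmetric groups, and signs multiply, so the claim is distributivity.
  \<open>K\<close> restricts the slices: all permutations for a rectangle, the column group of the
  original shape for a scaled shape.\<close>

theorem signed_sum_factorization:
  fixes G :: "nat \<Rightarrow> (nat \<Rightarrow> nat) \<Rightarrow> 'c::comm_ring_1"
  assumes K: "\<And>i. i < a \<Longrightarrow> K i \<subseteq> {\<sigma>. \<sigma> permutes {..<b}}"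
  shows "(\<Sum>p\<in>{p\<in>fibre_group n d1. \<forall>i<a. slice p i \<in> K i}. of_int (sign p) * (\<Prod>i<a. G i (slice p i))) =
    (\<Prod>i<a. \<Sum>\<sigma>\<in>K i. of_int (sign \<sigma>) * G i \<sigma>)"
proof -
  have finK: "finite (K i)" if "i < a" for i
    using K[OF that] by (rule finite_subset) simp
  have "(\<Prod>i<a. \<Sum>\<sigma>\<in>K i. of_int (sign \<sigma>) * G i \<sigma>) =
      (\<Sum>\<sigma>\<in>PiE {..<a} K. \<Prod>i<a. of_int (sign (\<sigma> i)) * G i (\<sigma> i))"
    using finK by (intro prod_sum_PiE) auto
  also have "\<dots> = (\<Sum>p\<in>{p\<in>fibre_group n d1. \<forall>i<a. slice p i \<in> K i}. of_int (sign p) * (\<Prod>i<a. G i (slice p i)))"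
  proof (rule sum.reindex_bij_witness[of _ "\<lambda>p. restrict (slice p) {..<a}" glue])
    fix \<sigma> assume \<sigma>: "\<sigma> \<in> PiE {..<a} K"
    hence per: "\<sigma> i permutes {..<b}" if "i < a" for i using K[OF that] that by auto
    have sl: "slice (glue \<sigma>) i = \<sigma> i" if "i < a" for i using slice_glue per that by blast
    show "restrict (slice (glue \<sigma>)) {..<a} = \<sigma>"
      using \<sigma> sl by (auto simp: PiE_def extensional_def fun_eq_iff restrict_def)
    show "glue \<sigma> \<in> {p\<in>fibre_group n d1. \<forall>i<a. slice p i \<in> K i}"
      using glue_in_fibre_group per sl \<sigma> by auto
    have "sign (glue \<sigma>) = (\<Prod>i<a. sign (\<sigma> i))"
      using glue_upto_permutes_sign[of \<sigma> a] per by (simp add: glue_def)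
    thus "of_int (sign (glue \<sigma>)) * (\<Prod>i<a. G i (slice (glue \<sigma>) i)) =
        (\<Prod>i<a. of_int (sign (\<sigma> i)) * G i (\<sigma> i))"
      by (simp add: sl prod.distrib of_int_prod)
  next
    fix p assume p: "p \<in> {p\<in>fibre_group n d1. \<forall>i<a. slice p i \<in> K i}"
    have "glue (restrict (slice p) {..<a}) = glue (slice p)"
      by (auto simp: glue_def glue_upto_def fun_eq_iff)
    thus "glue (restrict (slice p) {..<a}) = p" using glue_slice p by simp
    show "restrict (slice p) {..<a} \<in> PiE {..<a} K" using p by auto
  qed
  finally show ?thesis by simp
qed

lemma prod_grid: "(\<Prod>x<n. F x) = (\<Prod>i<a. \<Prod>j<b. F (e i j))"
  for F :: "nat \<Rightarrow> 'c::comm_monoid_mult"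
proof -
  have "(\<Prod>x<n. F x) = (\<Prod>(i, j)\<in>{..<a} \<times> {..<b}. F (e i j))"
    by (rule prod.reindex_bij_witness[of _ "\<lambda>(i, j). e i j" "\<lambda>x. (d1 x, d2 x)"])
       (auto simp: e_less d_e d_less e_d)
  thus ?thesis by (simp add: prod.cartesian_product)
qed

end

section \<open>Rectangles and scaled shapes through division with remainder\<close>

lemma mult_add_less: "s < m \<Longrightarrow> c < l \<Longrightarrow> l * s + c < l * m" for s m c l :: nat
proof -
  assume "s < m" "c < l"
  hence "l * Suc s \<le> l * m" by (intro mult_le_mono) auto
  thus ?thesis using \<open>c < l\<close> by simp
qed

lemma div_less_of_less_mult: "x < l * m \<Longrightarrow> x div l < m" for x l m :: nat
  by (simp add: less_mult_imp_div_less mult.commute)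

lemma grid_div_mod: "grid (l * m) m l (\<lambda>s c. l * s + c) (\<lambda>x. x div l) (\<lambda>x. x mod l)"
  if "l > 0" for l m :: nat
  using that by unfold_locales (auto simp: mult_add_less div_less_of_less_mult)

lemma grid_mod_div: "grid (l * m) l m (\<lambda>c s. l * s + c) (\<lambda>x. x mod l) (\<lambda>x. x div l)"
  if "l > 0" for l m :: nat
  using that by unfold_locales (auto simp: mult_add_less div_less_of_less_mult)

lemma cell_map_scale:
  assumes "l > 0" "x < l * sum_list xs"
  shows "cell (map ((*) l) xs) x = (trow xs (x div l), l * tcol xs (x div l) + x mod l)"
proof -
  have "x div l < sum_list xs" using assms by (simp add: div_less_of_less_mult)
  from cell_scale[OF assms(1) mod_less_divisor[OF assms(1), of x] this]
  show ?thesis by simp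
qed

lemma cell_replicate:
  assumes "l > 0" "x < l * m"
  shows "cell (replicate m l) x = (x div l, x mod l)"
proof -
  have one: "cell (replicate m 1) s = (s, 0)" if "s < m" for s
    using that by (induction m arbitrary: s) auto
  have "x div l < m" using assms by (simp add: div_less_of_less_mult)
  with cell_map_scale[OF assms(1), of x "replicate m 1"] one assms
  show ?thesis by (simp add: map_replicate sum_list_replicate)
qed

text \<open>The coefficient of the product of all \<open>y c\<close> in the determinant of the sum
  of \<open>y c\<close> times \<open>X (k c)\<close>, that is, \<open>l\<close> factorial times the
  normalized mixed discriminant.\<close>

definition mixed_disc :: "nat \<Rightarrow> (nat \<Rightarrow> nat \<Rightarrow> nat \<Rightarrow> 'c::comm_ring_1) \<Rightarrow> (nat \<Rightarrow> nat) \<Rightarrow> 'c" where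
  "mixed_disc l X k = (\<Sum>\<tau> | \<tau> permutes {..<l}. \<Sum>\<sigma> | \<sigma> permutes {..<l}.
     of_int (sign \<tau>) * of_int (sign \<sigma>) * (\<Prod>c<l. X (k c) (\<sigma> c) (\<tau> c)))"

text \<open>The row group of \<open>(l^m)\<close> is a product of \<open>m\<close> symmetric groups.
  The factorization is applied to the sum over \<open>p\<close> with \<open>p'\<close> fixed, and
  then to the sum over \<open>p'\<close>.\<close>

lemma mixed_form_rectangle:
  assumes l: "l > 0"
  shows "mixed_form (replicate m l) X \<kappa> = (\<Prod>s<m. mixed_disc l X (\<lambda>c. \<kappa> (l * s + c)))"
proof -
  interpret grid "l * m" m l "\<lambda>s c. l * s + c" "\<lambda>x. x div l" "\<lambda>x. x mod l"
    by (rule grid_div_mod[OF l])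
  have n: "sum_list (replicate m l) = l * m" by (simp add: sum_list_replicate)
  have cong: "fibre_group (l * m) (trow (replicate m l)) = fibre_group (l * m) (\<lambda>x. x div l)"
    unfolding fibre_group_def using cell_replicate[OF l, of _ m]
    by (auto simp: permutes_lessThan_iff)
  define R where "R = fibre_group (l * m) (\<lambda>x. x div l)"
  let ?S = "\<lambda>_::nat. {\<sigma>. \<sigma> permutes {..<l}}"
  have R: "R = {p\<in>fibre_group (l * m) (\<lambda>x. x div l). \<forall>i<m. slice p i \<in> ?S i}"
    using slice_permutes by (auto simp: R_def)
  have row: "row_group (replicate m l) = R"
    unfolding row_group_eq n cong R_def ..
  have fac: "(\<Sum>p\<in>R. of_int (sign p) * (\<Prod>i<m. G i (slice p i))) =
      (\<Prod>i<m. \<Sum>\<sigma> | \<sigma> permutes {..<l}. of_int (sign \<sigma>) * G i \<sigma>)"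
    for G :: "nat \<Rightarrow> (nat \<Rightarrow> nat) \<Rightarrow> complex"
    unfolding R by (rule signed_sum_factorization) simp
  have tc: "tcol (replicate m l) (p x) = p x mod l" if "p \<in> R" "x < l * m" for p x
    using that cell_replicate[OF l, of "p x" m]
    by (simp add: R_def fibre_group_def permutes_lessThan_iff)
  have pg: "(\<Prod>x<l * m. X (\<kappa> x) (p x mod l) (p' x mod l)) =
      (\<Prod>s<m. \<Prod>c<l. X (\<kappa> (l * s + c)) (slice p s c) (slice p' s c))" for p p'
    unfolding prod_grid by (intro prod.cong refl) (simp add: slice_def)
  have "mixed_form (replicate m l) X \<kappa> = (\<Sum>p\<in>R. \<Sum>p'\<in>R. of_int (sign p) * of_int (sign p') *
      (\<Prod>x<l * m. X (\<kappa> x) (p x mod l) (p' x mod l)))"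
    unfolding mixed_form_def row n by (intro sum.cong refl) (simp add: tc)
  also have "\<dots> = (\<Sum>p'\<in>R. of_int (sign p') * (\<Sum>p\<in>R. of_int (sign p) *
      (\<Prod>s<m. \<Prod>c<l. X (\<kappa> (l * s + c)) (slice p s c) (slice p' s c))))"
    unfolding pg sum_distrib_left
    by (subst sum.swap, intro sum.cong refl) (simp only: mult.assoc mult.left_commute)
  also have "\<dots> = (\<Sum>p'\<in>R. of_int (sign p') * (\<Prod>s<m. \<Sum>\<sigma> | \<sigma> permutes {..<l}. of_int (sign \<sigma>) *
      (\<Prod>c<l. X (\<kappa> (l * s + c)) (\<sigma> c) (slice p' s c))))"
    by (subst fac) simp
  also have "\<dots> = (\<Prod>s<m. \<Sum>\<tau> | \<tau> permutes {..<l}. of_int (sign \<tau>) *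
      (\<Sum>\<sigma> | \<sigma> permutes {..<l}. of_int (sign \<sigma>) * (\<Prod>c<l. X (\<kappa> (l * s + c)) (\<sigma> c) (\<tau> c))))"
    by (rule fac)
  also have "\<dots> = (\<Prod>s<m. mixed_disc l X (\<lambda>c. \<kappa> (l * s + c)))"
    by (simp add: mixed_disc_def sum_distrib_left mult_ac)
  finally show ?thesis .
qed

text \<open>Scaling a shape by \<open>l\<close> replaces each column by \<open>l\<close> copies of itself.\<close>

lemma signed_sum_col_group_scale:
  fixes z :: "nat \<Rightarrow> nat \<Rightarrow> 'c::comm_ring_1" and xs :: "nat list"
  assumes l: "l > 0"
  defines "m \<equiv> sum_list xs"
  shows "(\<Sum>q\<in>col_group (map ((*) l) xs). of_int (sign q) *
      (\<Prod>s<m. \<Prod>c<l. z s (trow (map ((*) l) xs) (q (l * s + c))))) =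
    (\<Sum>q\<in>col_group xs. of_int (sign q) * (\<Prod>s<m. z s (trow xs (q s)))) ^ l"
proof -
  interpret grid "l * m" l m "\<lambda>c s. l * s + c" "\<lambda>x. x mod l" "\<lambda>x. x div l"
    by (rule grid_mod_div[OF l])
  let ?xs = "map ((*) l) xs"
  have n: "sum_list ?xs = l * m" by (simp add: m_def sum_list_const_mult)
  have cl: "cell ?xs x = (trow xs (x div l), l * tcol xs (x div l) + x mod l)" if "x < l * m" for x
    using cell_map_scale[OF l] that by (simp add: m_def)
  have eq_iff: "l * u + x mod l = l * v + y mod l \<longleftrightarrow> u = v \<and> x mod l = y mod l" for u v x y
  proof
    assume *: "l * u + x mod l = l * v + y mod l"
    have "(l * u + x mod l) div l = u" "(l * v + y mod l) div l = v"
      "(l * u + x mod l) mod l = x mod l" "(l * v + y mod l) mod l = y mod l"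
      using l by simp_all
    with * show "u = v \<and> x mod l = y mod l" by metis
  qed simp
  \<comment> \<open>A column number of the scaled shape encodes a column of \<open>xs\<close>
    together with a residue modulo \<open>l\<close>. Preserving it means staying in one of the
    \<open>l\<close> copies of \<open>xs\<close> and preserving the columns within that
    copy.\<close>
  have col: "col_group ?xs = {p\<in>fibre_group (l * m) (\<lambda>x. x mod l). \<forall>c<l. slice p c \<in> col_group xs}"
    (is "_ = ?R")
  proof (rule equalityI; rule subsetI)
    fix p assume "p \<in> col_group ?xs"
    hence p: "p permutes {..<l * m}" "\<And>x. x < l * m \<Longrightarrow> tcol ?xs (p x) = tcol ?xs x"
      unfolding col_group_eq n fibre_group_def by blast+
    have px: "tcol xs (p x div l) = tcol xs (x div l) \<and> p x mod l = x mod l" if "x < l * m" for x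
      using p(2)[OF that] cl[OF that] cl[of "p x"] that
      by (simp add: permutes_lessThan_iff[OF p(1)] eq_iff)
    have fg: "p \<in> fibre_group (l * m) (\<lambda>x. x mod l)"
      using p px by (simp add: fibre_group_def)
    moreover have "slice p c \<in> col_group xs" if "c < l" for c
      using slice_permutes[OF fg that] px that
      by (simp add: col_group_eq fibre_group_def m_def[symmetric] slice_def mult_add_less)
    ultimately show "p \<in> ?R" by blast
  next
    fix p assume p: "p \<in> ?R"
    hence pp: "p permutes {..<l * m}" and pm: "\<And>x. x < l * m \<Longrightarrow> p x mod l = x mod l"
      by (auto simp: fibre_group_def)
    have "tcol xs (p x div l) = tcol xs (x div l)" if x: "x < l * m" for x
    proof -
      have c: "x mod l < l" "x div l < m" using d_less[OF x] .
      hence "slice p (x mod l) \<in> col_group xs" using p by blast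
      hence "tcol xs (slice p (x mod l) (x div l)) = tcol xs (x div l)"
        using c by (simp add: col_group_eq fibre_group_def m_def)
      thus ?thesis using c by (simp add: slice_def)
    qed
    thus "p \<in> col_group ?xs"
      using pp pm cl unfolding col_group_eq n fibre_group_def
      by (simp add: permutes_lessThan_iff)
  qed
  have "(\<Sum>q\<in>col_group ?xs. of_int (sign q) * (\<Prod>s<m. \<Prod>c<l. z s (trow ?xs (q (l * s + c))))) =
      (\<Sum>q\<in>?R. of_int (sign q) * (\<Prod>c<l. \<Prod>s<m. z s (trow xs (slice q c s))))"
    unfolding col
  proof (intro sum.cong refl)
    fix q assume "q \<in> ?R"
    hence q: "q permutes {..<l * m}" by (auto simp: fibre_group_def)
    have "trow ?xs (q (l * s + c)) = trow xs (slice q c s)" if "s < m" "c < l" for s c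
      using cl[of "q (l * s + c)"] that by (simp add: permutes_lessThan_iff[OF q] mult_add_less slice_def)
    hence "(\<Prod>s<m. \<Prod>c<l. z s (trow ?xs (q (l * s + c)))) = (\<Prod>s<m. \<Prod>c<l. z s (trow xs (slice q c s)))"
      by (intro prod.cong refl) simp
    also have "\<dots> = (\<Prod>c<l. \<Prod>s<m. z s (trow xs (slice q c s)))" by (rule prod.swap)
    finally show "of_int (sign q) * (\<Prod>s<m. \<Prod>c<l. z s (trow ?xs (q (l * s + c)))) =
      of_int (sign q) * (\<Prod>c<l. \<Prod>s<m. z s (trow xs (slice q c s)))" by simp
  qed
  also have "\<dots> = (\<Prod>c<l. \<Sum>q\<in>col_group xs. of_int (sign q) * (\<Prod>s<m. z s (trow xs (q s))))"
    by (rule signed_sum_factorization[where G = "\<lambda>_ \<sigma>. \<Prod>s<m. z s (trow xs (\<sigma> s))"])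
       (auto simp: col_group_eq fibre_group_def m_def)
  finally show ?thesis by simp
qed

section \<open>Ryser's formula\<close>

text \<open>Inclusion-exclusion: passing to complements gives the expansion of \<open>1 - 1\<close>
  to the power \<open>card (N - A)\<close>.\<close>

lemma sum_supersets_sign:
  assumes "finite N" "A \<subseteq> N"
  shows "(\<Sum>S | A \<subseteq> S \<and> S \<subseteq> N. (-1) ^ card (N - S)) = (if A = N then 1 else 0 :: 'a::comm_ring_1)"
proof -
  have "(\<Sum>S | A \<subseteq> S \<and> S \<subseteq> N. (-1) ^ card (N - S)) = (\<Sum>T\<in>Pow (N - A). (-1) ^ card T :: 'a)"
    by (rule sum.reindex_bij_witness[of _ "\<lambda>T. N - T" "\<lambda>S. N - S"]) (use assms in auto)
  also have "\<dots> = (\<Prod>x\<in>N - A. 1 - 1)"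
    using assms by (subst prod_diff_conv_sum) auto
  also have "\<dots> = (if A = N then 1 else 0)"
  proof (cases "A = N")
    case False
    hence "N - A \<noteq> {}" using assms by blast
    hence "card (N - A) \<noteq> 0" using assms by simp
    then obtain c where "card (N - A) = Suc c" using not0_implies_Suc by blast
    thus ?thesis using False by (simp del: card_Diff_subset)
  qed simp
  finally show ?thesis .
qed

text \<open>The products expand over maps \<phi> with image in \<open>S\<close>. Summing the signs
  over all \<open>S\<close> containing the image leaves only the surjective maps, which are the
  permutations.\<close>

lemma ryser:
  fixes a :: "nat \<Rightarrow> nat \<Rightarrow> 'a::comm_ring_1"
  shows "(\<Sum>S\<in>Pow {..<l}. (-1) ^ card ({..<l} - S) * (\<Prod>i<l. \<Sum>j\<in>S. a i j)) =
    (\<Sum>\<sigma> | \<sigma> permutes {..<l}. \<Prod>i<l. a i (\<sigma> i))"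
proof -
  let ?N = "{..<l}" and ?F = "{..<l} \<rightarrow>\<^sub>E {..<l}"
  have finS: "finite S" if "S \<in> Pow ?N" for S using that by (auto intro: finite_subset)
  have exp: "(\<Prod>i<l. \<Sum>j\<in>S. a i j) = (\<Sum>\<phi>\<in>?F. if \<phi> ` ?N \<subseteq> S then \<Prod>i<l. a i (\<phi> i) else 0)"
    if S: "S \<in> Pow ?N" for S
  proof -
    have "(\<Prod>i<l. \<Sum>j\<in>S. a i j) = (\<Sum>\<phi>\<in>?N \<rightarrow>\<^sub>E S. \<Prod>i<l. a i (\<phi> i))"
      using finS[OF S] by (intro prod_sum_PiE) auto
    also have "?N \<rightarrow>\<^sub>E S = {\<phi>\<in>?F. \<phi> ` ?N \<subseteq> S}"
      using S by (auto simp: PiE_def Pi_def extensional_def)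
    also have "(\<Sum>\<phi>\<in>{\<phi>\<in>?F. \<phi> ` ?N \<subseteq> S}. \<Prod>i<l. a i (\<phi> i)) =
        (\<Sum>\<phi>\<in>?F. if \<phi> ` ?N \<subseteq> S then \<Prod>i<l. a i (\<phi> i) else 0)"
      by (rule sum.inter_filter) (auto intro: finite_PiE)
    finally show ?thesis .
  qed
  have "(\<Sum>S\<in>Pow ?N. (-1) ^ card (?N - S) * (\<Prod>i<l. \<Sum>j\<in>S. a i j)) =
      (\<Sum>S\<in>Pow ?N. \<Sum>\<phi>\<in>?F. (if \<phi> ` ?N \<subseteq> S then (-1) ^ card (?N - S) * (\<Prod>i<l. a i (\<phi> i)) else 0))"
    by (intro sum.cong refl) (simp add: exp sum_distrib_left if_distrib[of "\<lambda>x. _ * x"] cong: if_cong)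
  also have "\<dots> = (\<Sum>\<phi>\<in>?F. \<Sum>S\<in>Pow ?N. (if \<phi> ` ?N \<subseteq> S then (-1) ^ card (?N - S) * (\<Prod>i<l. a i (\<phi> i)) else 0))"
    by (rule sum.swap)
  also have "\<dots> = (\<Sum>\<phi>\<in>?F. if \<phi> ` ?N = ?N then \<Prod>i<l. a i (\<phi> i) else 0)"
  proof (intro sum.cong refl)
    fix \<phi> assume "\<phi> \<in> ?F"
    hence im: "\<phi> ` ?N \<subseteq> ?N" by auto
    have "(\<Sum>S\<in>Pow ?N. (if \<phi> ` ?N \<subseteq> S then (-1) ^ card (?N - S) * (\<Prod>i<l. a i (\<phi> i)) else 0)) =
        (\<Sum>S\<in>{S\<in>Pow ?N. \<phi> ` ?N \<subseteq> S}. (-1) ^ card (?N - S) * (\<Prod>i<l. a i (\<phi> i)))"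
      by (rule sum.inter_filter[symmetric]) simp
    also have "{S\<in>Pow ?N. \<phi> ` ?N \<subseteq> S} = {S. \<phi> ` ?N \<subseteq> S \<and> S \<subseteq> ?N}" by auto
    also have "(\<Sum>S | \<phi> ` ?N \<subseteq> S \<and> S \<subseteq> ?N. (-1) ^ card (?N - S) * (\<Prod>i<l. a i (\<phi> i))) =
        (if \<phi> ` ?N = ?N then \<Prod>i<l. a i (\<phi> i) else 0)"
      by (simp only: sum_distrib_right[symmetric] sum_supersets_sign[OF finite_lessThan im]) simp
    finally show "(\<Sum>S\<in>Pow ?N. (if \<phi> ` ?N \<subseteq> S then (-1) ^ card (?N - S) * (\<Prod>i<l. a i (\<phi> i)) else 0)) =
        (if \<phi> ` ?N = ?N then \<Prod>i<l. a i (\<phi> i) else 0)" .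
  qed
  also have "\<dots> = (\<Sum>\<phi>\<in>{\<phi>\<in>?F. \<phi> ` ?N = ?N}. \<Prod>i<l. a i (\<phi> i))"
    by (rule sum.inter_filter[symmetric]) (auto intro: finite_PiE)
  also have "\<dots> = (\<Sum>\<sigma> | \<sigma> permutes ?N. \<Prod>i<l. a i (\<sigma> i))"
  proof (rule sum.reindex_bij_witness[of _ "\<lambda>\<sigma>. restrict \<sigma> ?N" "\<lambda>\<phi> i. if i < l then \<phi> i else i"])
    fix \<phi> assume \<phi>: "\<phi> \<in> {\<phi>\<in>?F. \<phi> ` ?N = ?N}"
    show "restrict (\<lambda>i. if i < l then \<phi> i else i) ?N = \<phi>"
      using \<phi> by (auto simp: PiE_def extensional_def fun_eq_iff restrict_def)
    have "bij_betw \<phi> ?N ?N"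
      using \<phi> eq_card_imp_inj_on[of ?N \<phi>] by (auto simp: bij_betw_def)
    hence "bij_betw (\<lambda>i. if i < l then \<phi> i else i) ?N ?N"
      by (subst bij_betw_cong[of _ _ \<phi>]) auto
    hence "(\<lambda>i. if i < l then \<phi> i else i) permutes ?N"
      by (rule bij_imp_permutes) simp
    thus "(\<lambda>i. if i < l then \<phi> i else i) \<in> {\<sigma>. \<sigma> permutes ?N}" by simp
    show "(\<Prod>i<l. a i (if i < l then \<phi> i else i)) = (\<Prod>i<l. a i (\<phi> i))"
      by (intro prod.cong) auto
  next
    fix \<sigma> assume "\<sigma> \<in> {\<sigma>. \<sigma> permutes ?N}"
    hence \<sigma>: "\<sigma> permutes ?N" by simp
    show "(\<lambda>i. if i < l then restrict \<sigma> ?N i else i) = \<sigma>"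
      using \<sigma> by (auto simp: fun_eq_iff permutes_def)
    have "restrict \<sigma> ?N ` ?N = ?N" using permutes_image[OF \<sigma>] by simp
    thus "restrict \<sigma> ?N \<in> {\<phi>\<in>?F. \<phi> ` ?N = ?N}"
      using permutes_in_image[OF \<sigma>] by auto
  qed
  finally show ?thesis .
qed

text \<open>The permanent of a matrix with equal rows gives the polarization identity, which
  recovers a product of variables from \<open>l\<close>-th powers of partial sums.\<close>

lemma ryser_power:
  fixes x :: "nat \<Rightarrow> 'a::comm_ring_1"
  shows "(\<Sum>S\<in>Pow {..<l}. (-1) ^ card ({..<l} - S) * (\<Sum>j\<in>S. x j) ^ l) = of_nat (fact l) * (\<Prod>j<l. x j)"
proof -
  have "(\<Sum>S\<in>Pow {..<l}. (-1) ^ card ({..<l} - S) * (\<Sum>j\<in>S. x j) ^ l) =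
      (\<Sum>\<sigma> | \<sigma> permutes {..<l}. \<Prod>i<l. x (\<sigma> i))"
    using ryser[of l "\<lambda>_ j. x j"] by simp
  also have "\<dots> = (\<Sum>\<sigma> | \<sigma> permutes {..<l}. \<Prod>j<l. x j)"
  proof (intro sum.cong refl)
    fix \<sigma> assume "\<sigma> \<in> {\<sigma>. \<sigma> permutes {..<l}}"
    hence "\<sigma> permutes {..<l}" by simp
    from prod.permute[OF this, of x] show "(\<Prod>i<l. x (\<sigma> i)) = (\<Prod>j<l. x j)" by (simp add: o_def)
  qed
  also have "\<dots> = of_nat (fact l) * (\<Prod>j<l. x j)"
    by (simp add: card_permutations)
  finally show ?thesis .
qed

text \<open>Polarization of the determinant. After the substitution \<open>i = \<sigma> c\<close>,
  the sum over permutations in the index of \<open>k\<close> is, for fixed \<tau>, a permanent.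
  Ryser's formula turns it into sums over \<open>S\<close>, and the remaining sum over \<tau> is the
  determinant of the sum of the matrices \<open>X (k j)\<close> for \<open>j\<close> in
  \<open>S\<close>.\<close>

lemma mixed_disc_ryser:
  fixes X :: "nat \<Rightarrow> nat \<Rightarrow> nat \<Rightarrow> 'a::comm_ring_1"
  shows "mixed_disc l X k = (\<Sum>S\<in>Pow {..<l}. (-1) ^ card ({..<l} - S) *
    (\<Sum>\<tau> | \<tau> permutes {..<l}. of_int (sign \<tau>) * (\<Prod>i<l. \<Sum>j\<in>S. X (k j) i (\<tau> i))))"
proof -
  let ?P = "{\<sigma>. \<sigma> permutes {..<l}}"
  have "mixed_disc l X k = (\<Sum>\<sigma>\<in>?P. \<Sum>\<tau>\<in>?P. of_int (sign \<tau>) * of_int (sign \<sigma>) * (\<Prod>c<l. X (k c) (\<sigma> c) (\<tau> c)))"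
    unfolding mixed_disc_def by (rule sum.swap)
  also have "\<dots> = (\<Sum>\<sigma>\<in>?P. \<Sum>\<tau>\<in>?P. of_int (sign \<tau>) * (\<Prod>i<l. X (k (inv \<sigma> i)) i (\<tau> i)))"
  proof (rule sum.cong[OF refl])
    fix \<sigma> assume "\<sigma> \<in> ?P"
    hence \<sigma>: "\<sigma> permutes {..<l}" by simp
    have "(\<Sum>\<tau>\<in>?P. of_int (sign \<tau>) * of_int (sign \<sigma>) * (\<Prod>c<l. X (k c) (\<sigma> c) (\<tau> c))) =
        (\<Sum>\<tau>\<in>?P. of_int (sign (\<tau> \<circ> \<sigma>)) * of_int (sign \<sigma>) * (\<Prod>c<l. X (k c) (\<sigma> c) ((\<tau> \<circ> \<sigma>) c)))"
      by (rule sum_permutations_compose_right[OF \<sigma>])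
    also have "\<dots> = (\<Sum>\<tau>\<in>?P. of_int (sign \<tau>) * (\<Prod>i<l. X (k (inv \<sigma> i)) i (\<tau> i)))"
    proof (intro sum.cong refl)
      fix \<tau> assume "\<tau> \<in> ?P"
      hence "sign (\<tau> \<circ> \<sigma>) * sign \<sigma> = sign \<tau>"
        using sign_of_permutes(1)[OF _ \<sigma>, of \<tau>] by simp
      hence "of_int (sign (\<tau> \<circ> \<sigma>)) * of_int (sign \<sigma>) = (of_int (sign \<tau>) :: 'a)"
        unfolding of_int_mult[symmetric] by (rule arg_cong)
      moreover have "(\<Prod>c<l. X (k c) (\<sigma> c) ((\<tau> \<circ> \<sigma>) c)) = (\<Prod>i<l. X (k (inv \<sigma> i)) i (\<tau> i))"
        by (rule prod.reindex_bij_witness[of _ "inv \<sigma>" \<sigma>])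
           (use \<sigma> in \<open>auto simp: permutes_inverses permutes_lessThan_iff permutes_inv\<close>)
      ultimately show "of_int (sign (\<tau> \<circ> \<sigma>)) * of_int (sign \<sigma>) * (\<Prod>c<l. X (k c) (\<sigma> c) ((\<tau> \<circ> \<sigma>) c)) =
          of_int (sign \<tau>) * (\<Prod>i<l. X (k (inv \<sigma> i)) i (\<tau> i))" by simp
    qed
    finally show "(\<Sum>\<tau>\<in>?P. of_int (sign \<tau>) * of_int (sign \<sigma>) * (\<Prod>c<l. X (k c) (\<sigma> c) (\<tau> c))) =
      (\<Sum>\<tau>\<in>?P. of_int (sign \<tau>) * (\<Prod>i<l. X (k (inv \<sigma> i)) i (\<tau> i)))" .
  qed
  also have "\<dots> = (\<Sum>\<sigma>\<in>?P. \<Sum>\<tau>\<in>?P. of_int (sign \<tau>) * (\<Prod>i<l. X (k (\<sigma> i)) i (\<tau> i)))"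
    by (rule sum_permutations_inverse[symmetric])
  also have "\<dots> = (\<Sum>\<tau>\<in>?P. of_int (sign \<tau>) * (\<Sum>\<sigma>\<in>?P. \<Prod>i<l. X (k (\<sigma> i)) i (\<tau> i)))"
    by (subst sum.swap) (simp add: sum_distrib_left)
  also have "\<dots> = (\<Sum>\<tau>\<in>?P. of_int (sign \<tau>) *
      (\<Sum>S\<in>Pow {..<l}. (-1) ^ card ({..<l} - S) * (\<Prod>i<l. \<Sum>j\<in>S. X (k j) i (\<tau> i))))"
  proof (intro sum.cong refl)
    fix \<tau>
    show "of_int (sign \<tau>) * (\<Sum>\<sigma>\<in>?P. \<Prod>i<l. X (k (\<sigma> i)) i (\<tau> i)) = of_int (sign \<tau>) *
      (\<Sum>S\<in>Pow {..<l}. (-1) ^ card ({..<l} - S) * (\<Prod>i<l. \<Sum>j\<in>S. X (k j) i (\<tau> i)))"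
      using ryser[of l "\<lambda>i j. X (k j) i (\<tau> i)"] by simp
  qed
  also have "\<dots> = (\<Sum>S\<in>Pow {..<l}. (-1) ^ card ({..<l} - S) *
      (\<Sum>\<tau>\<in>?P. of_int (sign \<tau>) * (\<Prod>i<l. \<Sum>j\<in>S. X (k j) i (\<tau> i))))"
    unfolding sum_distrib_left by (subst sum.swap) (simp only: mult.left_commute)
  finally show ?thesis .
qed

section \<open>Clifford matrices\<close>

text \<open>A real symmetric matrix, linear in \<open>y 0\<close> to \<open>y h\<close>, whose
  square is the sum of squares times the identity. Each doubling of the size adds one generator
  anticommuting with the earlier ones.\<close>

fun clifford :: "nat \<Rightarrow> (nat \<Rightarrow> real) \<Rightarrow> real mat" where
  "clifford 0 y = mat 1 1 (\<lambda>_. y 0)"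
| "clifford (Suc h) y = four_block_mat (clifford h y) (y (Suc h) \<cdot>\<^sub>m 1\<^sub>m (2 ^ h))
     (y (Suc h) \<cdot>\<^sub>m 1\<^sub>m (2 ^ h)) (- clifford h y)"

lemma clifford_carrier [simp]: "clifford h y \<in> carrier_mat (2 ^ h) (2 ^ h)"
proof (induction h)
  case (Suc h)
  have "- clifford h y \<in> carrier_mat (2 ^ h) (2 ^ h)" using Suc by simp
  from four_block_carrier_mat[OF Suc this] show ?case by (simp add: mult_2)
qed simp

lemma clifford_dim [simp]: "dim_row (clifford h y) = 2 ^ h" "dim_col (clifford h y) = 2 ^ h"
  by (rule carrier_matD[OF clifford_carrier])+

lemma clifford_square: "clifford h y * clifford h y = (\<Sum>v\<le>h. (y v)\<^sup>2) \<cdot>\<^sub>m 1\<^sub>m (2 ^ h)"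
proof (induction h)
  case 0
  show ?case by (rule eq_matI) (auto simp: scalar_prod_def power2_eq_square)
next
  case (Suc h)
  let ?H = "clifford h y" and ?n = "2 ^ h :: nat"
  let ?Y = "y (Suc h) \<cdot>\<^sub>m 1\<^sub>m ?n"
  have H: "?H \<in> carrier_mat ?n ?n" and mH: "- ?H \<in> carrier_mat ?n ?n"
    and Y: "?Y \<in> carrier_mat ?n ?n" by auto
  have HY: "?H * ?Y = y (Suc h) \<cdot>\<^sub>m ?H"     by (simp only: mult_smult_distrib[OF H one_carrier_mat] right_mult_one_mat[OF H])
  have YH: "?Y * ?H = y (Suc h) \<cdot>\<^sub>m ?H"     by (simp only: mult_smult_assoc_mat[OF one_carrier_mat H] left_mult_one_mat[OF H])
  have YY: "?Y * ?Y = (y (Suc h))\<^sup>2 \<cdot>\<^sub>m 1\<^sub>m ?n"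
    by (rule eq_matI) (auto simp: power2_eq_square)
  have mHY: "- ?H * ?Y = - (y (Suc h) \<cdot>\<^sub>m ?H)" using HY H Y by simp
  have YmH: "?Y * - ?H = - (y (Suc h) \<cdot>\<^sub>m ?H)" using YH H Y by simp
  have mHmH: "- ?H * - ?H = (\<Sum>v\<le>h. (y v)\<^sup>2) \<cdot>\<^sub>m 1\<^sub>m ?n" using Suc H by simp
  have "clifford (Suc h) y * clifford (Suc h) y = four_block_mat (?H * ?H + ?Y * ?Y) (?H * ?Y + ?Y * - ?H)
      (?Y * ?H + - ?H * ?Y) (?Y * ?Y + - ?H * - ?H)"
    unfolding clifford.simps by (rule mult_four_block_mat[OF H Y Y mH H Y Y mH])
  also have "\<dots> = (\<Sum>v\<le>Suc h. (y v)\<^sup>2) \<cdot>\<^sub>m 1\<^sub>m (2 ^ Suc h)"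
    unfolding HY YH YY mHY YmH mHmH Suc
    by (rule eq_matI) (auto simp: algebra_simps mult_2)
  finally show ?case .
qed

text \<open>The off-diagonal blocks are scalar, so the block determinant formula applies and gives
  the power \<open>2 ^ h\<close> of minus the sum of squares. For \<open>h > 0\<close> this exponent
  is even and the sign disappears; for \<open>h = 0\<close> it would remain.\<close>

lemma det_clifford:
  assumes "h > 0"
  shows "Determinant.det (clifford (Suc h) y) = (\<Sum>v\<le>Suc h. (y v)\<^sup>2) ^ (2 ^ h)"
proof -
  let ?H = "clifford h y" and ?n = "2 ^ h :: nat"
  let ?Y = "y (Suc h) \<cdot>\<^sub>m 1\<^sub>m ?n"
  have H: "?H \<in> carrier_mat ?n ?n" and mH: "- ?H \<in> carrier_mat ?n ?n"
    and Y: "?Y \<in> carrier_mat ?n ?n" by auto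
  have "?Y * - ?H = - ?H * ?Y"
    by (simp only: mult_smult_distrib[OF mH one_carrier_mat] right_mult_one_mat[OF mH]
        mult_smult_assoc_mat[OF one_carrier_mat mH] left_mult_one_mat[OF mH])
  hence "Determinant.det (clifford (Suc h) y) = Determinant.det (?H * - ?H - ?Y * ?Y)"
    unfolding clifford.simps by (rule det_four_block_mat[OF H Y Y mH])
  also have "?H * - ?H - ?Y * ?Y = (- (\<Sum>v\<le>Suc h. (y v)\<^sup>2)) \<cdot>\<^sub>m 1\<^sub>m ?n"
  proof -
    have "?H * - ?H = - ((\<Sum>v\<le>h. (y v)\<^sup>2) \<cdot>\<^sub>m 1\<^sub>m ?n)" using clifford_square[of h y] H by simp
    moreover have "?Y * ?Y = (y (Suc h))\<^sup>2 \<cdot>\<^sub>m 1\<^sub>m ?n"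
      by (rule eq_matI) (auto simp: power2_eq_square)
    ultimately show ?thesis by (simp only:) (rule eq_matI; auto)
  qed
  also have "Determinant.det \<dots> = (- (\<Sum>v\<le>Suc h. (y v)\<^sup>2)) ^ ?n"
    by simp
  also have "\<dots> = (\<Sum>v\<le>Suc h. (y v)\<^sup>2) ^ ?n" using assms by (intro power_minus_even) simp
  finally show ?thesis .
qed

lemma clifford_sum:
  "i < 2 ^ h \<Longrightarrow> j < 2 ^ h \<Longrightarrow>
    clifford h (\<lambda>v. \<Sum>s\<in>S. f s v) $$ (i, j) = (\<Sum>s\<in>S. clifford h (f s) $$ (i, j))"
proof (induction h arbitrary: i j)
  case (Suc h)
  show ?case
    using Suc.prems Suc.IH[of i j] Suc.IH[of "i - 2 ^ h" "j - 2 ^ h"]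
    by (auto simp: sum_negf sum_distrib_right[symmetric])
qed simp

definition clifford_unit :: "nat \<Rightarrow> nat \<Rightarrow> nat \<Rightarrow> nat \<Rightarrow> real" where
  "clifford_unit h k i j = clifford h (\<lambda>v. if v = k then 1 else 0) $$ (i, j)"

text \<open>By linearity the sum of generators is the Clifford matrix whose coordinate at
  \<open>v\<close> counts the \<open>j\<close> in \<open>S\<close> with
  \<open>k j = v\<close>.\<close>

lemma clifford_unit_det:
  assumes "h > 0"
  defines "l \<equiv> 2 ^ Suc h"
  shows "(\<Sum>\<tau> | \<tau> permutes {..<l}. of_int (sign \<tau>) * (\<Prod>i<l. \<Sum>j\<in>S. clifford_unit (Suc h) (k j) i (\<tau> i))) =
    (\<Sum>v\<le>Suc h. (\<Sum>j\<in>S. if v = k j then 1 else 0)\<^sup>2) ^ (2 ^ h)"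
proof -
  let ?y = "\<lambda>v. \<Sum>j\<in>S. if v = k j then 1 else 0 :: real"
  have "Determinant.det (clifford (Suc h) ?y) =
      (\<Sum>\<tau> | \<tau> permutes {0..<l}. signof \<tau> * (\<Prod>i = 0..<l. clifford (Suc h) ?y $$ (i, \<tau> i)))"
    unfolding l_def by (rule det_def') (rule clifford_carrier)
  also have "\<dots> = (\<Sum>\<tau> | \<tau> permutes {..<l}. of_int (sign \<tau>) *
      (\<Prod>i<l. \<Sum>j\<in>S. clifford_unit (Suc h) (k j) i (\<tau> i)))"
    unfolding lessThan_atLeast0[symmetric]
  proof (intro sum.cong refl)
    fix \<tau> assume "\<tau> \<in> {\<tau>. \<tau> permutes {..<l}}"
    hence \<tau>: "\<tau> permutes {..<l}" by simp
    have "(\<Prod>i<l. clifford (Suc h) ?y $$ (i, \<tau> i)) =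
        (\<Prod>i<l. \<Sum>j\<in>S. clifford_unit (Suc h) (k j) i (\<tau> i))"
    proof (intro prod.cong refl)
      fix i assume "i \<in> {..<l}"
      hence "i < 2 ^ Suc h" "\<tau> i < 2 ^ Suc h"
        using permutes_lessThan_iff[OF \<tau>] by (auto simp: l_def)
      from clifford_sum[OF this, of "\<lambda>j v. if v = k j then 1 else 0" S]
      show "clifford (Suc h) ?y $$ (i, \<tau> i) = (\<Sum>j\<in>S. clifford_unit (Suc h) (k j) i (\<tau> i))"
        by (simp only: clifford_unit_def)
    qed
    thus "signof \<tau> * (\<Prod>i<l. clifford (Suc h) ?y $$ (i, \<tau> i)) =
        of_int (sign \<tau>) * (\<Prod>i<l. \<Sum>j\<in>S. clifford_unit (Suc h) (k j) i (\<tau> i))"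
      by simp
  qed
  finally show ?thesis by (simp only: det_clifford[OF assms(1)])
qed

section \<open>Gaussian moments\<close>

definition gauss :: "real measure" where
  "gauss = density lborel (\<lambda>x. ennreal (std_normal_density x))"

lemma sets_gauss [measurable_cong, simp]: "sets gauss = sets borel"
  and space_gauss [simp]: "space gauss = UNIV"
  by (simp_all add: gauss_def)

interpretation gauss: prob_space gauss
  unfolding gauss_def by (rule prob_space_normal_density) simp

interpretation gauss_prod: product_prob_space "\<lambda>_. gauss" UNIV ..

lemma integrable_gauss_power: "integrable gauss (\<lambda>x. x ^ k)"
  unfolding gauss_def
  using integrable_std_normal_moment[of k] by (subst integrable_density) auto

definition gvec :: "nat \<Rightarrow> (nat \<Rightarrow> real) measure" where
  "gvec N = PiM {..<N} (\<lambda>_. gauss)"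

lemma prob_space_gvec: "prob_space (gvec N)"
  unfolding gvec_def by (intro prob_space_PiM) unfold_locales

interpretation gvec: prob_space "gvec N" for N
  by (rule prob_space_gvec)

lemma measurable_gvec_component [measurable]: "v < N \<Longrightarrow> (\<lambda>\<omega>. \<omega> v) \<in> borel_measurable (gvec N)"
  unfolding gvec_def by measurable

lemma distr_gvec_component:
  assumes "v < N"
  shows "distr (gvec N) borel (\<lambda>\<omega>. \<omega> v) = gauss"
proof -
  have "distr (gvec N) gauss (\<lambda>\<omega>. \<omega> v) = gauss"
    unfolding gvec_def using assms by (intro distr_PiM_component) (auto intro: gauss.prob_space_axioms)
  moreover have "distr (gvec N) borel (\<lambda>\<omega>. \<omega> v) = distr (gvec N) gauss (\<lambda>\<omega>. \<omega> v)"
    by (intro distr_cong) auto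
  ultimately show ?thesis by simp
qed

lemma indep_vars_gvec: "gvec.indep_vars N (\<lambda>_. borel) (\<lambda>v \<omega>. \<omega> v) {..<N}"
proof (cases "N = 0")
  case True
  \<comment> \<open>The empty family is treated directly; the criterion used below, through the
    joint distribution, is applied to a nonempty index set.\<close>
  thus ?thesis by (simp add: gvec.indep_vars_def gvec.indep_sets_def)
next
  case False
  have "distr (gvec N) (\<Pi>\<^sub>M v\<in>{..<N}. borel) (\<lambda>\<omega>. \<lambda>v\<in>{..<N}. \<omega> v) = gvec N"
  proof -
    have "distr (gvec N) (\<Pi>\<^sub>M v\<in>{..<N}. borel) (\<lambda>\<omega>. \<lambda>v\<in>{..<N}. \<omega> v) = distr (gvec N) (gvec N) (\<lambda>\<omega>. \<omega>)"
    proof (rule distr_cong)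
      show "sets (\<Pi>\<^sub>M v\<in>{..<N}. borel) = sets (gvec N)"
        unfolding gvec_def by (intro sets_PiM_cong) auto
      show "(\<lambda>v\<in>{..<N}. \<omega> v) = \<omega>" if "\<omega> \<in> space (gvec N)" for \<omega>
        using that by (auto simp: gvec_def space_PiM PiE_def extensional_def restrict_def fun_eq_iff)
    qed simp
    thus ?thesis by simp
  qed
  moreover have "(\<Pi>\<^sub>M v\<in>{..<N}. distr (gvec N) borel (\<lambda>\<omega>. \<omega> v)) = gvec N"
    unfolding gvec_def by (intro PiM_cong refl) (simp add: distr_gvec_component[unfolded gvec_def])
  ultimately show ?thesis
    using False by (subst gvec.indep_vars_iff_distr_eq_PiM') auto
qed

text \<open>The double factorial of \<open>2 * L - 1\<close>, which is the moment of order
  \<open>2 * L\<close> of a standard normal variable.\<close>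

definition gmoment :: "nat \<Rightarrow> real" where "gmoment L = fact (2 * L) / (2 ^ L * fact L)"

lemma gmoment_pos: "gmoment L > 0"
  by (simp add: gmoment_def)

text \<open>A linear form in independent standard normal variables is normal, with variance the sum
  of the squared coefficients.\<close>

lemma gvec_linear_moment:
  fixes y :: "nat \<Rightarrow> real"
  assumes "L > 0"
  shows "(\<integral>\<omega>. (\<Sum>v<N. y v * \<omega> v) ^ (2 * L) \<partial>gvec N) = gmoment L * (\<Sum>v<N. (y v)\<^sup>2) ^ L"
proof -
  \<comment> \<open>Zero coefficients are dropped because their terms have no normal density. If all
    coefficients vanish, \<open>L > 0\<close> makes both sides 0.\<close>
  define J where "J = {v. v < N \<and> y v \<noteq> 0}"
  have J: "finite J" "J \<subseteq> {..<N}" by (auto simp: J_def)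
  have eq1: "(\<Sum>v<N. y v * \<omega> v) = (\<Sum>v\<in>J. y v * \<omega> v)" for \<omega>
    by (intro sum.mono_neutral_right) (auto simp: J_def)
  have eq2: "(\<Sum>v<N. (y v)\<^sup>2) = (\<Sum>v\<in>J. (y v)\<^sup>2)"
    by (intro sum.mono_neutral_right) (auto simp: J_def)
  show ?thesis
  proof (cases "J = {}")
    case True
    thus ?thesis using assms by (simp add: eq1 eq2 zero_power)
  next
    case False
    have "gvec.indep_vars N (\<lambda>_. borel) (\<lambda>v \<omega>. y v * \<omega> v) J"
      by (rule gvec.indep_vars_compose2[where Y = "\<lambda>v x. y v * x", OF gvec.indep_vars_subset[OF indep_vars_gvec J(2)]]) simp
    moreover have "distributed (gvec N) lborel (\<lambda>\<omega>. y v * \<omega> v) (normal_density 0 \<bar>y v\<bar>)" if "v \<in> J" for v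
    proof -
      have v: "v < N" "y v \<noteq> 0" using that by (auto simp: J_def)
      have "distr (gvec N) lborel (\<lambda>\<omega>. \<omega> v) = distr (gvec N) borel (\<lambda>\<omega>. \<omega> v)"
        by (intro distr_cong) auto
      hence "distributed (gvec N) lborel (\<lambda>\<omega>. \<omega> v) (normal_density 0 1)"
        using v by (simp add: distributed_def distr_gvec_component gauss_def)
      from gvec.normal_density_affine[OF this, of "y v" 0] v show ?thesis by simp
    qed
    ultimately have D: "distributed (gvec N) lborel (\<lambda>\<omega>. \<Sum>v\<in>J. y v * \<omega> v)
        (normal_density 0 (sqrt (\<Sum>v\<in>J. (y v)\<^sup>2)))"
      using gvec.sum_indep_normal[of J N "\<lambda>v \<omega>. y v * \<omega> v" "\<lambda>v. \<bar>y v\<bar>" "\<lambda>_. 0"] J(1) False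
      by (simp add: J_def)
    have pos: "(\<Sum>v\<in>J. (y v)\<^sup>2) > 0"
      using J(1) False by (intro sum_pos) (auto simp: J_def)
    have "(\<integral>\<omega>. (\<Sum>v\<in>J. y v * \<omega> v) ^ (2 * L) \<partial>gvec N) =
        (\<integral>x. normal_density 0 (sqrt (\<Sum>v\<in>J. (y v)\<^sup>2)) x * x ^ (2 * L) \<partial>lborel)"
      by (rule distributed_integral[OF D, symmetric]) auto
    also have "\<dots> = gmoment L * (\<Sum>v\<in>J. (y v)\<^sup>2) ^ L"
      using integral_normal_moment_even[of "sqrt (\<Sum>v\<in>J. (y v)\<^sup>2)" 0 L] pos
      by (simp add: gmoment_def power_divide)
    finally show ?thesis by (simp add: eq1 eq2)
  qed
qed

text \<open>Collecting equal indices gives a product of powers of distinct coordinates, for which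
  the one-dimensional moments suffice.\<close>

lemma integrable_gvec_monomial:
  fixes k :: "nat \<Rightarrow> nat" and l :: nat
  assumes "\<And>c. c < l \<Longrightarrow> k c < N"
  shows "integrable (gvec N) (\<lambda>\<omega>. \<Prod>c<l. \<omega> (k c))"
proof -
  have "(\<lambda>\<omega>. \<Prod>c<l. \<omega> (k c)) = (\<lambda>\<omega>::nat \<Rightarrow> real. \<Prod>v<N. \<omega> v ^ card {c. c < l \<and> k c = v})"
  proof
    fix \<omega> :: "nat \<Rightarrow> real"
    have "(\<Prod>c<l. \<omega> (k c)) = (\<Prod>v<N. \<Prod>c | c \<in> {..<l} \<and> k c = v. \<omega> (k c))"
      using assms by (intro prod.group[symmetric]) auto
    also have "\<dots> = (\<Prod>v<N. \<omega> v ^ card {c. c < l \<and> k c = v})"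
      by (intro prod.cong refl) simp
    finally show "(\<Prod>c<l. \<omega> (k c)) = (\<Prod>v<N. \<omega> v ^ card {c. c < l \<and> k c = v})" .
  qed
  thus ?thesis
    unfolding gvec_def
    using gauss_prod.product_integrable_prod[of "{..<N}" "\<lambda>v x. x ^ card {c. c < l \<and> k c = v}"]
      integrable_gauss_power by simp
qed

lemma integrable_gvec_linear_power:
  assumes "finite S" "\<And>j. j \<in> S \<Longrightarrow> k j < N"
  shows "integrable (gvec N) (\<lambda>\<omega>. (\<Sum>j\<in>S. \<omega> (k j)) ^ l)"
proof -
  have "(\<Sum>j\<in>S. \<omega> (k j)) ^ l = (\<Sum>\<phi>\<in>{..<l} \<rightarrow>\<^sub>E S. \<Prod>i<l. \<omega> (k (\<phi> i)))" for \<omega> :: "nat \<Rightarrow> real"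
    using prod_sum_PiE[of "{..<l}" "\<lambda>_. S" "\<lambda>_ j. \<omega> (k j)"] assms(1) by simp
  moreover have "integrable (gvec N) (\<lambda>\<omega>. \<Prod>i<l. \<omega> (k (\<phi> i)))" if "\<phi> \<in> {..<l} \<rightarrow>\<^sub>E S" for \<phi>
    using that assms(2) by (intro integrable_gvec_monomial) auto
  ultimately show ?thesis by simp
qed

text \<open>The mixed discriminants of the Clifford matrices are Gaussian moments: both are obtained by
  polarization, in the form of Ryser's formula, from a multiple of the same power of the sum of squares.\<close>

theorem mixed_disc_clifford:
  fixes k :: "nat \<Rightarrow> nat"
  assumes h: "h > 0" and k: "\<And>c. c < 2 ^ Suc h \<Longrightarrow> k c < h + 2"
  defines "l \<equiv> 2 ^ Suc h"
  shows "mixed_disc l (clifford_unit (Suc h)) k =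
    fact l / gmoment (2 ^ h) * (\<integral>\<omega>. (\<Prod>c<l. \<omega> (k c)) \<partial>gvec (h + 2))"
proof -
  let ?N = "h + 2"
  have l2: "l = 2 * 2 ^ h" by (simp add: l_def)
  have S: "finite S" "\<And>j. j \<in> S \<Longrightarrow> k j < ?N" if "S \<in> Pow {..<l}" for S
    using that k finite_subset[of S "{..<l}"] by (auto simp: l_def)
  have det: "(\<Sum>\<tau> | \<tau> permutes {..<l}. of_int (sign \<tau>) * (\<Prod>i<l. \<Sum>j\<in>S. clifford_unit (Suc h) (k j) i (\<tau> i))) =
      1 / gmoment (2 ^ h) * (\<integral>\<omega>. (\<Sum>j\<in>S. \<omega> (k j)) ^ l \<partial>gvec ?N)" if "S \<in> Pow {..<l}" for S
  proof -
    let ?y = "\<lambda>v. \<Sum>j\<in>S. if v = k j then 1 else 0 :: real"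
    \<comment> \<open>The counting vector that enters the determinant is also the coefficient vector
      of the linear form, so both sides involve the same sum of squares.\<close>
    have "(\<Sum>v<?N. ?y v * \<omega> v) = (\<Sum>j\<in>S. \<omega> (k j))" for \<omega> :: "nat \<Rightarrow> real"
    proof -
      have "(\<Sum>v<?N. ?y v * \<omega> v) = (\<Sum>v<?N. \<Sum>j\<in>S. if v = k j then \<omega> v else 0)"
        unfolding sum_distrib_right by (intro sum.cong refl) auto
      also have "\<dots> = (\<Sum>j\<in>S. \<Sum>v<?N. if v = k j then \<omega> v else 0)" by (rule sum.swap)
      also have "\<dots> = (\<Sum>j\<in>S. \<omega> (k j))" using S(2)[OF that]
        by (intro sum.cong refl, subst sum.delta) simp_all
      finally show ?thesis .
    qed
    hence "(\<integral>\<omega>. (\<Sum>j\<in>S. \<omega> (k j)) ^ l \<partial>gvec ?N) = gmoment (2 ^ h) * (\<Sum>v<?N. (?y v)\<^sup>2) ^ (2 ^ h)"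
      using gvec_linear_moment[where L = "2 ^ h" and y = ?y and N = ?N] by (simp only: l2) simp
    moreover have "{..<?N} = {..Suc h}" by auto
    ultimately show ?thesis
      using clifford_unit_det[OF h, where S = S and k = k] gmoment_pos[of "2 ^ h"] by (simp only: l_def) simp
  qed
  have "mixed_disc l (clifford_unit (Suc h)) k = (\<Sum>S\<in>Pow {..<l}. (-1) ^ card ({..<l} - S) *
      (1 / gmoment (2 ^ h) * (\<integral>\<omega>. (\<Sum>j\<in>S. \<omega> (k j)) ^ l \<partial>gvec ?N)))"
    unfolding mixed_disc_ryser by (intro sum.cong refl) (simp only: det)
  also have "\<dots> = 1 / gmoment (2 ^ h) * (\<Sum>S\<in>Pow {..<l}. (-1) ^ card ({..<l} - S) *
      (\<integral>\<omega>. (\<Sum>j\<in>S. \<omega> (k j)) ^ l \<partial>gvec ?N))"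
    unfolding sum_distrib_left by (intro sum.cong refl) (simp only: mult.left_commute)
  also have "(\<Sum>S\<in>Pow {..<l}. (-1) ^ card ({..<l} - S) * (\<integral>\<omega>. (\<Sum>j\<in>S. \<omega> (k j)) ^ l \<partial>gvec ?N)) =
      (\<integral>\<omega>. (\<Sum>S\<in>Pow {..<l}. (-1) ^ card ({..<l} - S) * (\<Sum>j\<in>S. \<omega> (k j)) ^ l) \<partial>gvec ?N)"
    using integrable_gvec_linear_power[OF S]
    by (subst Bochner_Integration.integral_sum) simp_all
  also have "\<dots> = fact l * (\<integral>\<omega>. (\<Prod>c<l. \<omega> (k c)) \<partial>gvec ?N)"
    by (simp only: ryser_power) simp
  finally show ?thesis by simp
qed

section \<open>Positivity\<close>

text \<open>Independent Gaussian vectors, one for each row of the rectangle, so that products of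
  moments over the rows become single integrals.\<close>

definition gmat :: "nat \<Rightarrow> nat \<Rightarrow> (nat \<Rightarrow> nat \<Rightarrow> real) measure" where
  "gmat m N = PiM {..<m} (\<lambda>_. gvec N)"

interpretation gvec_prod: product_prob_space "\<lambda>_. gvec N" UNIV for N ..

lemma gmat_monomial:
  fixes k :: "nat \<Rightarrow> nat \<Rightarrow> nat" and l m :: nat
  assumes "\<And>s c. s < m \<Longrightarrow> c < l \<Longrightarrow> k s c < N"
  shows "integrable (gmat m N) (\<lambda>z. \<Prod>s<m. \<Prod>c<l. z s (k s c))"
    and "(\<integral>z. (\<Prod>s<m. \<Prod>c<l. z s (k s c)) \<partial>gmat m N) =
      (\<Prod>s<m. \<integral>\<omega>. (\<Prod>c<l. \<omega> (k s c)) \<partial>gvec N)"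
  unfolding gmat_def
  using gvec_prod.product_integrable_prod[of "{..<m}" N "\<lambda>s \<omega>. \<Prod>c<l. \<omega> (k s c)"]
    gvec_prod.product_integral_prod[of "{..<m}" N "\<lambda>s \<omega>. \<Prod>c<l. \<omega> (k s c)"]
    integrable_gvec_monomial[where l = l and k = "k s" and N = N for s] assms by auto

lemma gauss_interval_pos:
  assumes "a < b"
  shows "emeasure gauss {a<..<b} > 0"
proof (rule ccontr)
  assume "\<not> emeasure gauss {a<..<b} > 0"
  hence "emeasure gauss {a<..<b} = 0" by simp
  hence "(\<integral>\<^sup>+x. ennreal (std_normal_density x) * indicator {a<..<b} x \<partial>lborel) = 0"
    by (simp add: gauss_def emeasure_density)
  hence "AE x in lborel. ennreal (std_normal_density x) * indicator {a<..<b} x = 0"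
    by (subst (asm) nn_integral_0_iff_AE) auto
  hence "AE x in lborel. x \<notin> {a<..<b}"
  proof (rule eventually_mono)
    fix x assume "ennreal (std_normal_density x) * indicator {a<..<b} x = 0"
    moreover have "std_normal_density x > 0" by (rule normal_density_pos) simp
    ultimately show "x \<notin> {a<..<b}" by (auto simp: indicator_def split: if_splits)
  qed
  hence "{a<..<b} \<in> null_sets lborel" by (subst AE_iff_null_sets) auto
  hence "emeasure lborel {a<..<b} = 0" by (rule null_setsD1)
  thus False using assms by simp
qed

text \<open>Used to find, arbitrarily close to a prescribed point \<open>w\<close>, a point at which
  an almost everywhere valid statement holds.\<close>

lemma gmat_box_pos:
  assumes "\<delta> > 0"
  shows "emeasure (gmat m N) (PiE {..<m} (\<lambda>s. PiE {..<N} (\<lambda>v. {w s v - \<delta><..<w s v + \<delta>}))) > 0"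
proof -
  have sets: "PiE {..<N} (\<lambda>v. {w s v - \<delta><..<w s v + \<delta>}) \<in> sets (gvec N)" for s
    unfolding gvec_def by (intro sets_PiM_I_finite) auto
  have "emeasure (gvec N) (PiE {..<N} (\<lambda>v. {w s v - \<delta><..<w s v + \<delta>})) \<noteq> 0" for s
    unfolding gvec_def using gauss_interval_pos[of "w s v - \<delta>" "w s v + \<delta>" for v] assms
    by (subst gauss_prod.emeasure_PiM) (auto simp: less_le)
  hence "emeasure (gmat m N) (PiE {..<m} (\<lambda>s. PiE {..<N} (\<lambda>v. {w s v - \<delta><..<w s v + \<delta>}))) \<noteq> 0"
    unfolding gmat_def using sets by (subst gvec_prod.emeasure_PiM) auto
  thus ?thesis by (simp add: less_le)
qed


text \<open>The rows of \<open>lam\<close> index the Clifford generators, and \<open>h + 2\<close>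
  is the number of generators of size \<open>l\<close>. The constant \<open>C\<close> of each mixed
  discriminant does not depend on the labels, so it factors out of the signed sum.\<close>

theorem kronecker_coeff_rectangle_pos:
  fixes lam :: "nat list"
  assumes h: "h > 0" "length lam \<le> h + 2"
  defines "l \<equiv> 2 ^ Suc h" and "m \<equiv> sum_list lam"
  shows "kronecker_coeff (map ((*) l) lam) (replicate m l) (replicate m l) > 0"
proof (rule kronecker_coeff_pos_criterion)
  let ?xs = "map ((*) l) lam" and ?N = "h + 2"
  have l: "l > 0" "even l" by (simp_all add: l_def)
  have n: "sum_list ?xs = l * m" by (simp add: m_def sum_list_const_mult)
  show "sum_list ?xs = sum_list (replicate m l)" unfolding n by (simp add: sum_list_replicate)
  define X where "X = (\<lambda>k i j. complex_of_real (clifford_unit (Suc h) k i j))"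
  define C where "C = fact l / gmoment (2 ^ h)"
  have C: "C > 0" by (simp add: C_def gmoment_pos)
  define K where "K = (\<lambda>q s c. trow ?xs (q (l * s + c)))"
  have K_less: "K q s c < ?N" if "q \<in> col_group ?xs" "s < m" "c < l" for q s c
  proof -
    have "q (l * s + c) < l * m"
      using that by (simp add: col_group_eq n fibre_group_def permutes_lessThan_iff mult_add_less m_def)
    hence "trow ?xs (q (l * s + c)) < length ?xs" using cell_in_shape[of "q (l * s + c)" ?xs] unfolding n by blast
    thus ?thesis using h(2) by (simp add: K_def)
  qed
  have form: "mixed_form (replicate m l) X (trow ?xs \<circ> q) =
      complex_of_real (C ^ m * (\<integral>z. (\<Prod>s<m. \<Prod>c<l. z s (K q s c)) \<partial>gmat m ?N))" if q: "q \<in> col_group ?xs" for q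
  proof -
    have "mixed_disc l X k = complex_of_real (mixed_disc l (clifford_unit (Suc h)) k)" for k
      by (simp add: mixed_disc_def X_def)
    hence "mixed_form (replicate m l) X (trow ?xs \<circ> q) =
        complex_of_real (\<Prod>s<m. mixed_disc l (clifford_unit (Suc h)) (K q s))"
      by (simp add: mixed_form_rectangle[OF l(1)] K_def)
    also have "(\<Prod>s<m. mixed_disc l (clifford_unit (Suc h)) (K q s)) =
        (\<Prod>s<m. C * (\<integral>\<omega>. (\<Prod>c<l. \<omega> (K q s c)) \<partial>gvec ?N))"
      unfolding C_def l_def
      by (intro prod.cong refl mixed_disc_clifford h) (use K_less[OF q] in \<open>auto simp: l_def\<close>)
    also have "\<dots> = C ^ m * (\<integral>z. (\<Prod>s<m. \<Prod>c<l. z s (K q s c)) \<partial>gmat m ?N)"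
      using gmat_monomial(2)[where k = "K q" and m = m and l = l and N = ?N] K_less[OF q]
      by (simp add: prod.distrib)
    finally show ?thesis .
  qed
  \<comment> \<open>The product, over the columns of \<open>lam\<close>, of minors of the matrix
    \<open>z\<close>: the boxes of a column select the vectors \<open>z s\<close>, and its rows
    select their coordinates.\<close>
  define \<Phi> where "\<Phi> = (\<lambda>z. \<Sum>q\<in>col_group lam. of_int (sign q) * (\<Prod>s<m. z s (trow lam (q s))) :: real)"
  have int: "integrable (gmat m ?N) (\<lambda>z. \<Prod>s<m. \<Prod>c<l. z s (K q s c))" if "q \<in> col_group ?xs" for q
    using gmat_monomial(1)[where k = "K q" and m = m and l = l and N = ?N] K_less[OF that] by blast
  have \<Phi>_l: "(\<Sum>q\<in>col_group ?xs. of_int (sign q) * (\<Prod>s<m. \<Prod>c<l. z s (K q s c))) = \<Phi> z ^ l" for z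
    unfolding \<Phi>_def K_def m_def by (rule signed_sum_col_group_scale[OF l(1)])
  have "(\<Sum>q\<in>col_group ?xs. of_int (sign q) * mixed_form (replicate m l) X (trow ?xs \<circ> q)) =
      complex_of_real (\<Sum>q\<in>col_group ?xs. of_int (sign q) *
        (C ^ m * (\<integral>z. (\<Prod>s<m. \<Prod>c<l. z s (K q s c)) \<partial>gmat m ?N)))"
    by (simp add: form)
  also have "(\<Sum>q\<in>col_group ?xs. of_int (sign q) *
        (C ^ m * (\<integral>z. (\<Prod>s<m. \<Prod>c<l. z s (K q s c)) \<partial>gmat m ?N))) =
      C ^ m * (\<Sum>q\<in>col_group ?xs. \<integral>z. of_int (sign q) * (\<Prod>s<m. \<Prod>c<l. z s (K q s c)) \<partial>gmat m ?N)"
    by (simp only: integral_mult_right_zero sum_distrib_left mult.left_commute)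
  also have "(\<Sum>q\<in>col_group ?xs. \<integral>z. of_int (sign q) * (\<Prod>s<m. \<Prod>c<l. z s (K q s c)) \<partial>gmat m ?N) =
      (\<integral>z. \<Phi> z ^ l \<partial>gmat m ?N)"
    unfolding \<Phi>_l[symmetric]
    by (rule Bochner_Integration.integral_sum[symmetric]) (rule integrable_mult_right, rule int)
  finally have total: "(\<Sum>q\<in>col_group ?xs. of_int (sign q) * mixed_form (replicate m l) X (trow ?xs \<circ> q)) =
      complex_of_real (C ^ m * (\<integral>z. \<Phi> z ^ l \<partial>gmat m ?N))" .
  have \<Phi>_int: "integrable (gmat m ?N) (\<lambda>z. \<Phi> z ^ l)"
    unfolding \<Phi>_l[symmetric]
    by (rule Bochner_Integration.integrable_sum) (rule integrable_mult_right, rule int)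
  have "(\<integral>z. \<Phi> z ^ l \<partial>gmat m ?N) \<noteq> 0"
  proof
    assume "(\<integral>z. \<Phi> z ^ l \<partial>gmat m ?N) = 0"
    hence AE: "AE z in gmat m ?N. \<Phi> z ^ l = 0"
      using l(2) by (subst (asm) integral_nonneg_eq_0_iff_AE[OF \<Phi>_int]) auto
    \<comment> \<open>At this point every minor in \<Phi> is the determinant of an identity matrix,
      so \<Phi> takes the value 1.\<close>
    define w :: "nat \<Rightarrow> nat \<Rightarrow> real" where "w = (\<lambda>s v. if v = trow lam s then 1 else 0)"
    have "\<exists>z. (\<forall>s<m. \<forall>v<?N. \<bar>z s v - w s v\<bar> < \<delta>) \<and> \<Phi> z = 0" if "\<delta> > 0" for \<delta>
    proof (rule ccontr)
      let ?B = "PiE {..<m} (\<lambda>s. PiE {..<?N} (\<lambda>v. {w s v - \<delta><..<w s v + \<delta>}))"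
      assume no: "\<not> (\<exists>z. (\<forall>s<m. \<forall>v<?N. \<bar>z s v - w s v\<bar> < \<delta>) \<and> \<Phi> z = 0)"
      have box: "\<forall>s<m. \<forall>v<?N. \<bar>z s v - w s v\<bar> < \<delta>" if zB: "z \<in> ?B" for z
      proof (intro allI impI)
        fix s v assume "s < m" "v < ?N"
        hence sv: "s \<in> {..<m}" "v \<in> {..<?N}" by blast+
        from PiE_mem[OF PiE_mem[OF zB sv(1)] sv(2)] show "\<bar>z s v - w s v\<bar> < \<delta>"
          unfolding greaterThanLessThan_iff by linarith
      qed
      have nz: "\<Phi> z \<noteq> 0" if "z \<in> ?B" for z using no box[OF that] by blast
      have sets: "?B \<in> sets (gmat m ?N)"
        unfolding gmat_def gvec_def by (intro sets_PiM_I_finite) auto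
      have "AE z in gmat m ?N. z \<notin> ?B"
      proof (rule eventually_mono[OF AE], rule notI)
        fix z assume "\<Phi> z ^ l = 0" "z \<in> ?B"
        thus False using nz[of z] by (simp only: power_eq_0_iff simp_thms)
      qed
      hence "emeasure (gmat m ?N) ?B = 0"
        by (rule null_setsD1[OF AE_iff_null_sets[OF sets, THEN iffD2]])
      thus False using gmat_box_pos[OF \<open>\<delta> > 0\<close>, of m ?N w] by (simp only: less_irrefl)
    qed
    \<comment> \<open>Zeros of \<Phi> at distance below \<open>1 / Suc i\<close> from
      \<open>w\<close> converge to \<open>w\<close> in the finitely many coordinates on which \<Phi>
      depends, so \<Phi> would vanish at \<open>w\<close> itself.\<close>
    hence "\<exists>z. (\<forall>s<m. \<forall>v<?N. \<bar>z s v - w s v\<bar> < 1 / real (Suc i)) \<and> \<Phi> z = 0" for i by simp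
    then obtain Z where Z: "\<And>i s v. s < m \<Longrightarrow> v < ?N \<Longrightarrow> \<bar>Z i s v - w s v\<bar> < 1 / real (Suc i)"
      and Z0: "\<And>i. \<Phi> (Z i) = 0" by metis
    have lim: "(\<lambda>i. Z i s v) \<longlonglongrightarrow> w s v" if "s < m" "v < ?N" for s v
    proof (rule Lim_transform2)
      show "(\<lambda>i. w s v) \<longlonglongrightarrow> w s v" by simp
      show "(\<lambda>i. w s v - Z i s v) \<longlonglongrightarrow> 0"
      proof (rule Lim_null_comparison)
        show "\<forall>\<^sub>F i in sequentially. norm (w s v - Z i s v) \<le> 1 / real (Suc i)"
          using Z[OF that] by (intro always_eventually allI) (simp add: abs_minus_commute less_imp_le)
        show "(\<lambda>i. 1 / real (Suc i)) \<longlonglongrightarrow> 0" by (rule lim_1_over_n[THEN LIMSEQ_Suc])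
      qed
    qed
    have "(\<lambda>i. \<Phi> (Z i)) \<longlonglongrightarrow> \<Phi> w"
      unfolding \<Phi>_def
    proof (intro tendsto_sum tendsto_mult tendsto_const tendsto_prod lim)
      fix q s assume "q \<in> col_group lam" and s: "s \<in> {..<m}"
      hence "q s < m" by (simp add: col_group_eq fibre_group_def permutes_lessThan_iff m_def)
      thus "trow lam (q s) < ?N" using cell_in_shape[of "q s" lam] h(2) by (simp add: m_def)
      show "s < m" using s by simp
    qed
    hence "\<Phi> w = 0" unfolding Z0 by (simp add: LIMSEQ_const_iff)
    moreover have "\<Phi> w = (\<Sum>q\<in>{id}. of_int (sign q) * (\<Prod>s<m. w s (trow lam (q s))))"
      unfolding \<Phi>_def
    proof (rule sum.mono_neutral_right)
      show "finite (col_group lam)" by (simp add: col_group_eq)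
      show "{id} \<subseteq> col_group lam" by (simp add: col_group_eq fibre_group_id)
      show "\<forall>q\<in>col_group lam - {id}. of_int (sign q) * (\<Prod>s<m. w s (trow lam (q s))) = 0"
      proof
        fix q assume q: "q \<in> col_group lam - {id}"
        \<comment> \<open>A column permutation that also preserves all rows is the identity, so any
          other one meets a factor 0 of \<open>w\<close>.\<close>
        have "\<exists>s<m. trow lam (q s) \<noteq> trow lam s"
        proof (rule ccontr)
          assume "\<not> ?thesis"
          hence "q \<in> row_group lam" using q by (simp add: row_group_eq col_group_eq fibre_group_def m_def)
          thus False using q row_col_group_Int by blast
        qed
        then obtain s where "s < m" "w s (trow lam (q s)) = 0" by (auto simp: w_def)
        hence "(\<Prod>s<m. w s (trow lam (q s))) = 0" by (intro prod_zero) auto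
        thus "of_int (sign q) * (\<Prod>s<m. w s (trow lam (q s))) = 0" by simp
      qed
    qed
    ultimately show False by (simp add: w_def)
  qed
  thus "(\<Sum>q\<in>col_group ?xs. of_int (sign q) * mixed_form (replicate m l) X (trow ?xs \<circ> q)) \<noteq> 0"
    unfolding total using C by simp
qed

section \<open>Points of the Kronecker cone\<close>

text \<open>Dividing the scaled triple by \<open>l\<close> gives back the triple exactly, so the
  point lies in the set whose closure is taken.\<close>

theorem columns_in_kronecker_cone:
  assumes lam: "is_partition lam"
  defines "m \<equiv> sum_list lam"
  shows "(partition_vec lam, partition_vec (replicate m 1), partition_vec (replicate m 1)) \<in> kronecker_cone m"
proof -
  \<comment> \<open>This makes \<open>h\<close> positive and leaves enough generators for the rows
    of \<open>lam\<close>.\<close>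
  define h where "h = Suc (length lam)"
  define l :: nat where "l = 2 ^ Suc h"
  have l: "l > 0" by (simp add: l_def)
  have scale: "partition_vec (map ((*) l) xs) i / of_rat (of_nat l) = partition_vec xs i" for xs i
    using l by (simp add: partition_vec_def)
  have rep: "map ((*) l) (replicate m 1) = replicate m l" by simp
  have pos: "kronecker_coeff (map ((*) l) lam) (replicate m l) (replicate m l) > 0"
    unfolding l_def m_def by (rule kronecker_coeff_rectangle_pos) (simp_all add: h_def)
  have len: "length lam \<le> m"
    using lam unfolding m_def is_partition_def by (induction lam) (auto simp: Suc_le_eq)
  have part: "is_partition (map ((*) l) lam)" "is_partition (replicate m l)"
    using lam l by (auto simp: is_partition_def sorted_wrt_map elim!: sorted_wrt_mono_rel[rotated]
        simp: sorted_wrt_iff_nth_less)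
  have "(partition_vec lam, partition_vec (replicate m 1), partition_vec (replicate m 1)) =
     (\<lambda>i. partition_vec (map ((*) l) lam) i / of_rat (of_nat l),
      \<lambda>i. partition_vec (replicate m l) i / of_rat (of_nat l),
      \<lambda>i. partition_vec (replicate m l) i / of_rat (of_nat l))"
    unfolding rep[symmetric] scale by simp
  moreover have "sum_list (map ((*) l) lam) = sum_list (replicate m l)"
    by (simp add: m_def sum_list_const_mult sum_list_replicate)
  moreover have "(of_nat l :: rat) > 0" using l by simp
  ultimately show ?thesis
    unfolding kronecker_cone_def using pos part len
    by (intro subsetD[OF closure_subset] CollectI exI[of _ "map ((*) l) lam"] exI[of _ "replicate m l"]
        exI[of _ "of_nat l"]) auto
qed

section \<open>Many partitions of small height\<close>

text \<open>The set \<open>S\<close> of middle parts carries the exponential count. The first part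
  absorbs the rest of the size, and the final 2 prevents a hook and ensures two rows even when
  \<open>S\<close> is empty.\<close>

definition subset_partition :: "nat \<Rightarrow> nat set \<Rightarrow> nat list" where
  "subset_partition m S = (m - \<Sum>S - 2) # rev (sorted_list_of_set S) @ [2]"

lemma subset_partition:
  assumes S: "S \<subseteq> {2..K}" and m: "K * K + K + 2 \<le> m" "2 \<le> K"
  shows "is_partition (subset_partition m S)" "sum_list (subset_partition m S) = m"
    "\<not> is_hook (subset_partition m S)" "length (subset_partition m S) \<le> K + 1"
    "length (subset_partition m S) \<ge> 2"
proof -
  have fin: "finite S" using S by (rule finite_subset) simp
  have card: "card S \<le> K - 1" using card_mono[OF _ S] by simp
  have "\<Sum>S \<le> (\<Sum>x\<in>S. K)" using S by (intro sum_mono) auto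
  also have "\<dots> \<le> K * K" using le_trans[OF card diff_le_self] by (simp add: mult_le_mono1)
  finally have sum: "\<Sum>S \<le> K * K" .
  \<comment> \<open>The lower bound on \<open>m\<close> is chosen for this: the first part must
    dominate all parts up to \<open>K\<close>.\<close>
  hence M: "m - \<Sum>S - 2 \<ge> K" using m by linarith
  have sorted: "sorted_wrt (\<ge>) (rev (sorted_list_of_set S) @ [2])"
    using S fin by (auto simp: sorted_wrt_append sorted_wrt_rev)
  have "x \<le> K" if "x \<in> set (rev (sorted_list_of_set S) @ [2])" for x
    using that S fin m by auto
  hence "\<forall>x\<in>set (rev (sorted_list_of_set S) @ [2]). x \<le> m - \<Sum>S - 2" using M by fastforce
  moreover have "0 \<notin> set (subset_partition m S)"
    using S fin M m by (auto simp: subset_partition_def)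
  ultimately show "is_partition (subset_partition m S)"
    using sorted by (simp add: is_partition_def subset_partition_def)
  have "sum_list (sorted_list_of_set S) = \<Sum>S"
    using fin by (simp add: distinct_sum_list_conv_Sum)
  thus "sum_list (subset_partition m S) = m"
    using sum m by (simp add: subset_partition_def)
  show "\<not> is_hook (subset_partition m S)"
  proof
    assume "is_hook (subset_partition m S)"
    then obtain q where "rev (sorted_list_of_set S) @ [2] = replicate q (1::nat)"
      by (auto simp: is_hook_def subset_partition_def)
    hence "2 \<in> set (replicate q (1::nat))" by (metis in_set_conv_decomp)
    thus False by auto
  qed
  show "length (subset_partition m S) \<le> K + 1" "length (subset_partition m S) \<ge> 2"
    using card m by (simp_all add: subset_partition_def)
qed

lemma inj_on_subset_partition: "inj_on (subset_partition m) {S. finite S}"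
proof (rule inj_onI)
  fix S T :: "nat set" assume fin: "S \<in> {S. finite S}" "T \<in> {S. finite S}"
    and "subset_partition m S = subset_partition m T"
  hence "sorted_list_of_set S = sorted_list_of_set T" by (simp add: subset_partition_def)
  thus "S = T" using fin by (metis mem_Collect_eq set_sorted_list_of_set)
qed

lemma length_le_sum_list: "0 \<notin> set xs \<Longrightarrow> length xs \<le> sum_list xs" for xs :: "nat list"
  by (induction xs) (auto simp: Suc_le_eq)

text \<open>A lower bound on a cardinality by an injection requires a finite target, since
  \<open>card\<close> of an infinite set is 0.\<close>

lemma finite_bounded_partitions: "finite {xs. is_partition xs \<and> sum_list xs \<le> b}"
proof (rule finite_subset)
  show "finite {xs. set xs \<subseteq> {..b} \<and> length xs \<le> b}" by (rule finite_lists_length_le) simp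
  show "{xs. is_partition xs \<and> sum_list xs \<le> b} \<subseteq> {xs. set xs \<subseteq> {..b} \<and> length xs \<le> b}"
  proof safe
    fix xs x assume xs: "is_partition xs" "sum_list xs \<le> b"
    show "length xs \<le> b" using length_le_sum_list[of xs] xs by (simp add: is_partition_def)
    assume "x \<in> set xs"
    thus "x \<le> b" using member_le_sum_list[of x xs] xs(2) by simp
  qed
qed

text \<open>With \<open>K\<close> close to the square of \<open>t\<close>, the size condition is
  quadratic in \<open>K\<close>, of order \<open>t ^ 4\<close>; a further factor of two powers of
  \<open>t\<close>, at least 4, absorbs the lower terms. This is where the exponent 6 comes from.
  Taking the square also keeps \<open>K - 1\<close> above \<open>t\<close> after rounding.\<close>

lemma growth_bounds:
  fixes t :: real
  assumes t: "t \<ge> 2"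
  defines "K \<equiv> nat \<lfloor>t\<^sup>2\<rfloor>"
  shows "2 \<le> K" "t \<le> real (K - 1)" "real (K + 1) \<le> t ^ 6" "real (K * K + K + 2) \<le> t ^ 6"
proof -
  have t2: "t\<^sup>2 \<ge> 2 * t" using t by (simp add: power2_eq_square)
  have K_le: "real K \<le> t\<^sup>2" and K_ge: "real K > t\<^sup>2 - 1"
    unfolding K_def by (auto simp: of_nat_nat)
  show K2: "2 \<le> K" using K_ge t2 t by linarith
  show "t \<le> real (K - 1)" using K_ge t2 t K2 by (simp add: of_nat_diff)
  have u: "t\<^sup>2 \<ge> 4" using t2 t by linarith
  have "real K * real K \<le> t\<^sup>2 * t\<^sup>2" using K_le by (intro mult_mono) auto
  hence "real (K * K + K + 2) \<le> t\<^sup>2 * t\<^sup>2 + t\<^sup>2 + 2" using K_le by simp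
  also have "\<dots> \<le> 4 * (t\<^sup>2 * t\<^sup>2)"
  proof -
    have "4 * t\<^sup>2 \<le> t\<^sup>2 * t\<^sup>2" using u by (intro mult_right_mono) auto
    thus ?thesis using u by linarith
  qed
  also have "\<dots> \<le> t\<^sup>2 * (t\<^sup>2 * t\<^sup>2)" using u by (intro mult_right_mono) auto
  also have "\<dots> = t ^ 6" by (simp flip: power_add power2_eq_square)
  finally show le: "real (K * K + K + 2) \<le> t ^ 6" .
  have "real (K + 1) \<le> real (K * K + K + 2)" by simp
  thus "real (K + 1) \<le> t ^ 6" using le by linarith
qed

theorem theorem1p4:
  fixes \<epsilon> :: real
  assumes "0 < \<epsilon>" and "\<epsilon> \<le> 1"
  shows "\<exists>a::real. 0 < a \<and> a < 1 \<and>
    (\<lambda>m::nat. real (card {(lam, mu, nu).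
        is_partition lam \<and> is_partition mu \<and> is_partition nu \<and>
        sum_list lam = sum_list mu \<and> sum_list mu = sum_list nu \<and>
        kronecker_coeff lam mu nu = 0 \<and>
        mu = nu \<and>
        length mu = m \<and> real (length lam) \<le> real m powr \<epsilon> \<and>
        (partition_vec lam, partition_vec mu, partition_vec nu) \<in> kronecker_cone m \<and>
        sum_list lam \<le> m ^ 3 \<and>
        \<not> is_hook lam}))
      \<in> \<Omega>(\<lambda>m. 2 powr (real m powr a))"
proof (intro exI[of _ "\<epsilon> / 6"] conjI)
  \<comment> \<open>For \<open>t = m powr (\<epsilon> / 6)\<close>, the sixth power of
    \<open>t\<close> is the allowed height \<open>m powr \<epsilon>\<close>, which is at most
    \<open>m\<close> because \<open>\<epsilon> \<le> 1\<close>; thus the bounds in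
    \<open>growth_bounds\<close> control height and size together.\<close>
  show "0 < \<epsilon> / 6" "\<epsilon> / 6 < 1" using assms by auto
  define T where "T = (\<lambda>m::nat. {(lam, mu, nu).
        is_partition lam \<and> is_partition mu \<and> is_partition nu \<and>
        sum_list lam = sum_list mu \<and> sum_list mu = sum_list nu \<and>
        kronecker_coeff lam mu nu = 0 \<and>
        mu = nu \<and>
        length mu = m \<and> real (length lam) \<le> real m powr \<epsilon> \<and>
        (partition_vec lam, partition_vec mu, partition_vec nu) \<in> kronecker_cone m \<and>
        sum_list lam \<le> m ^ 3 \<and>
        \<not> is_hook lam})"
  have bound: "2 powr (real m powr (\<epsilon> / 6)) \<le> real (card (T m))"
    if t: "real m powr (\<epsilon> / 6) \<ge> 2" for m
  proof -
    define t where "t = real m powr (\<epsilon> / 6)"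
    define K where "K = nat \<lfloor>t\<^sup>2\<rfloor>"
    have m: "m \<ge> 1" using t by (cases "m = 0") auto
    have t6: "t ^ 6 = real m powr \<epsilon>"
      using m by (simp add: t_def powr_realpow[symmetric] powr_powr flip: powr_numeral)
    have "t ^ 6 \<le> real m" unfolding t6 using powr_mono[of \<epsilon> 1 "real m"] m assms by simp
    with growth_bounds[of t] t have K: "2 \<le> K" "t \<le> real (K - 1)" "real (K + 1) \<le> real m powr \<epsilon>"
      "real (K * K + K + 2) \<le> real m"
      by (auto simp: t_def K_def t6[unfolded t_def])
    have Km: "K * K + K + 2 \<le> m" using K(4) by linarith
    let ?mu = "replicate m (1::nat)"
    let ?f = "\<lambda>S. (subset_partition m S, ?mu, ?mu)"
    have mu: "is_partition ?mu" "sum_list ?mu = m"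
      by (auto simp: is_partition_def sum_list_replicate sorted_wrt_iff_nth_less)
    have fin: "finite (T m)"
    proof (rule finite_subset)
      let ?P = "{xs. is_partition xs \<and> sum_list xs \<le> m ^ 3}"
      show "T m \<subseteq> ?P \<times> ?P \<times> ?P" by (auto simp: T_def)
      show "finite (?P \<times> ?P \<times> ?P)" by (intro finite_cartesian_product finite_bounded_partitions)
    qed
    have im: "?f ` Pow {2..K} \<subseteq> T m"
    proof (rule image_subsetI)
      fix S assume "S \<in> Pow {2..K}"
      hence S: "S \<subseteq> {2..K}" by simp
      note sp = subset_partition[OF S Km K(1)]
      have "kronecker_coeff (subset_partition m S) ?mu ?mu = 0"
        using kronecker_coeff_columns_eq_0[OF sp(5)] sp(1,2) by (simp add: is_partition_def)
      moreover have "(partition_vec (subset_partition m S), partition_vec ?mu, partition_vec ?mu) \<in> kronecker_cone m"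
        using columns_in_kronecker_cone[OF sp(1)] unfolding sp(2) .
      moreover have "real (length (subset_partition m S)) \<le> real m powr \<epsilon>"
        using sp(4) K(3) by linarith
      moreover have "m \<le> m ^ 3" using m by (intro self_le_power) auto
      ultimately show "?f S \<in> T m" using sp mu by (simp add: T_def)
    qed
    have inj: "inj_on ?f (Pow {2..K})"
      using inj_on_subset[OF inj_on_subset_partition, of "Pow {2..K}" m]
      by (auto simp: inj_on_def intro: finite_subset)
    have "card (Pow {2..K}) \<le> card (T m)" by (rule card_inj_on_le[OF inj im fin])
    hence "2 ^ (K - 1) \<le> card (T m)" by (simp add: card_Pow)
    have "2 powr t \<le> 2 powr real (K - 1)" using K(2) by simp
    also have "\<dots> = real (2 ^ (K - 1))" by (simp add: powr_realpow)
    also have "\<dots> \<le> real (card (T m))" using \<open>2 ^ (K - 1) \<le> card (T m)\<close> by (simp only: of_nat_le_iff)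
    finally show ?thesis by (simp add: t_def)
  qed
  \<comment> \<open>The threshold solves \<open>m powr (\<epsilon> / 6) = 2\<close> up to rounding;
    beyond it the lower bound holds with constant 1.\<close>
  have "real m powr (\<epsilon> / 6) \<ge> 2" if "m \<ge> nat \<lceil>2 powr (6 / \<epsilon>)\<rceil>" for m
  proof -
    have "2 powr (6 / \<epsilon>) \<le> real m" using that by linarith
    hence "(2 powr (6 / \<epsilon>)) powr (\<epsilon> / 6) \<le> real m powr (\<epsilon> / 6)"
      using assms by (intro powr_mono2) auto
    thus ?thesis using assms by (simp add: powr_powr)
  qed
  hence "\<forall>\<^sub>F m in at_top. real m powr (\<epsilon> / 6) \<ge> 2"
    using eventually_ge_at_top by (rule eventually_mono[rotated])
  hence "\<forall>\<^sub>F m in at_top. norm (real (card (T m))) \<ge> 1 * norm (2 powr (real m powr (\<epsilon> / 6)))"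
    by (rule eventually_mono) (use bound in simp)
  thus "(\<lambda>m. real (card (T m))) \<in> \<Omega>(\<lambda>m. 2 powr (real m powr (\<epsilon> / 6)))"
    by (intro landau_omega.bigI[of 1]) simp_all
qed

end
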